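(* Let $X$ be a $C^1$ nonvanishing vector field on the torus $\mathbb T^2$ with flow $\phi_X=(\phi_X^t)_{t\in\mathbb R}$. Then ${\rm h_{pol}}(\phi_X)\in[0,1]$. Moreover, if $\phi_X$ possesses periodic orbits, then ${\rm h_{pol}}(\phi_X)\in\{0,1\}$, and ${\rm h_{pol}}(\phi_X)=0$ if and only if the time-one map $\phi_X^1$ is topologically conjugate to a rotation (translation) of $\mathbb T^2$.
   Context: For a continuous flow $\phi=(\phi^t)_{t\in\mathbb R}$ on a compact metric space $(X,d)$ and $t>0$, define $d_t^\phi(x,y)=\max_{0\le s\le t}d(\phi^s(x),\phi^s(y))$; for $Y\subset X$ and $\varepsilon>0$ let $G_t^\phi(Y,\varepsilon)$ be the minimal number of $d_t^\phi$-balls of radius $\varepsilon$ covering $Y$. The polynomial entropy is ${\rm h_{pol}}(\phi,Y)=\lim_{\varepsilon\to0}\limsup_{t\to\infty}\frac{\log G_t^\phi(Y,\varepsilon)}{\log t}$ and ${\rm h_{pol}}(\phi)={\rm h_{pol}}(\phi,X)$ (this coincides with the polynomial entropy of the time-one map $\phi^1$, where for a map $f$ one uses $d_n^f(x,y)=\max_{0\le k\le n-1}d(f^kx,f^ky)$ and $\limsup_{n\to\infty}\log G_n^f(\varepsilon)/\log n$). A rotation of $\mathbb T^2$ is a translation $z\mapsto z+c$. *)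

theory Defs
  imports "HOL-Analysis.Analysis"
begin

text \<open>The torus T^2 is realised as the compact subset S^1 x S^1 of complex x complex,
  with the metric inherited from the ambient space; the covering map from the plane is torus_proj.\<close>

definition torus_proj :: "real \<times> real \<Rightarrow> complex \<times> complex" where
  "torus_proj z = (cis (2 * pi * fst z), cis (2 * pi * snd z))"

definition torus :: "(complex \<times> complex) set" where
  "torus = range torus_proj"

definition torus_translate :: "real \<times> real \<Rightarrow> complex \<times> complex \<Rightarrow> complex \<times> complex" where
  "torus_translate c w = (fst (torus_proj c) * fst w, snd (torus_proj c) * snd w)"

definition flow_dist :: "(real \<Rightarrow> 'a \<Rightarrow> 'a::metric_space) \<Rightarrow> real \<Rightarrow> 'a \<Rightarrow> 'a \<Rightarrow> real" where
  "flow_dist \<phi> t x y = (SUP s\<in>{0..t}. dist (\<phi> s x) (\<phi> s y))"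

definition flow_cover :: "(real \<Rightarrow> 'a \<Rightarrow> 'a::metric_space) \<Rightarrow> 'a set \<Rightarrow> 'a set \<Rightarrow> real \<Rightarrow> real \<Rightarrow> nat" where
  "flow_cover \<phi> X Y t \<epsilon> =
     (LEAST n. \<exists>C. finite C \<and> C \<subseteq> X \<and> card C = n \<and>
                   Y \<subseteq> (\<Union>x\<in>C. {y. flow_dist \<phi> t x y < \<epsilon>}))"

definition hpol_flow_on :: "(real \<Rightarrow> 'a \<Rightarrow> 'a::metric_space) \<Rightarrow> 'a set \<Rightarrow> 'a set \<Rightarrow> ereal" where
  "hpol_flow_on \<phi> X Y =
     Lim (at_right (0::real))
       (\<lambda>\<epsilon>. Limsup at_top (\<lambda>t::real. ereal (ln (real (flow_cover \<phi> X Y t \<epsilon>)) / ln t)))"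

definition hpol_flow :: "(real \<Rightarrow> 'a \<Rightarrow> 'a::metric_space) \<Rightarrow> 'a set \<Rightarrow> ereal" where
  "hpol_flow \<phi> X = hpol_flow_on \<phi> X X"

end

theory Submission
  imports Defs
begin

text \<open>\<^bold>\<open>Upper bound.\<close> Cut a short segment transverse to the flow into pieces that just reach diameter \<open>\<epsilon>\<close> during
  \<open>[0, t]\<close>. At each fixed time the images of the pieces cross a flow box in disjoint intervals, so their
  transverse widths add up to a bounded amount. The time lag between the end points of a piece only grows in
  proportion to its width, so each piece has total width at least \<open>c \<epsilon>\<close> over \<open>[0, t]\<close>; hence there are \<open>O(t)\<close> pieces.

  \<^bold>\<open>Rigidity.\<close> Let the entropy be less than 1, so that the number of separated orbits does not grow linearly.
  Then every point is recurrent in both directions, because otherwise its preimages at equally spaced times are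
  separated. Near an orbit with \<open>\<Phi>\<^sub>T p = p + v\<close> the return map is increasing, and recurrence makes it the identity.
  If the periods of these orbits varied, shearing would separate linearly many orbits, so \<open>\<Phi>\<^sub>T = id + v\<close> near \<open>p\<close>,
  and by connectedness everywhere.

  \<^bold>\<open>Conjugacy.\<close> If \<open>\<Phi>\<^sub>T = id + v\<close>, average a linear functional over a period to get a coordinate that is linear
  along orbits. A second coordinate, constant on orbits, is the area below an orbit; it is strictly monotone
  across orbits. Together they straighten the flow, equivariantly under integer translations.\<close>

section \<open>Flows of periodic vector fields\<close>

text \<open>The dynamics is studied in the plane, for the lift \<open>\<Phi>\<close>, with integer
  translations carried along; the torus returns only when covers and separated sets are projected.
  The obstacle for the upper bound is that nearby orbits may drift apart along the flow without
  separating transversally, so the time lag must be bounded by the sum of all past widths. For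
  rigidity only one inequality, \<open>u \<le> P u\<close>, comes directly from recurrence, on one
  side of the closed orbit: the reversed flow has the inverse return map and gives the other
  inequality, and reflecting the section gives the other side. In the conjugacy, monotonicity of the
  area is a local fact; global injectivity needs an arc in a global cross-section, and surjectivity
  comes from invariance of domain. A zero displacement over the period is excluded because the area
  would then be doubly periodic and attain a maximum. Conversely, a translation is an isometry, so
  the powers of a conjugate time-one map are equicontinuous and one finite cover serves all
  times.\<close>

definition int_vecs :: "(real \<times> real) set" where
  "int_vecs = range (\<lambda>(m::int, n::int). (of_int m, of_int n))"

lemma int_vecsI [intro, simp]: "(of_int m, of_int n) \<in> int_vecs"
  by (auto simp: int_vecs_def intro!: image_eqI[of _ _ "(m, n)"])

lemma int_vecsE:
  assumes "k \<in> int_vecs"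
  obtains m n :: int where "k = (of_int m, of_int n)" using assms by (auto simp: int_vecs_def)

lemma int_vecs_0 [simp]: "0 \<in> int_vecs"
  using int_vecsI[of 0 0] by (simp add: zero_prod_def)

lemma int_vecs_add: "k \<in> int_vecs \<Longrightarrow> l \<in> int_vecs \<Longrightarrow> k + l \<in> int_vecs"
  by (elim int_vecsE) (metis add_Pair int_vecsI of_int_add)

lemma int_vecs_minus: "k \<in> int_vecs \<Longrightarrow> - k \<in> int_vecs"
  by (elim int_vecsE) (metis uminus_Pair int_vecsI of_int_minus)

lemma int_vecs_diff: "k \<in> int_vecs \<Longrightarrow> l \<in> int_vecs \<Longrightarrow> k - l \<in> int_vecs"
  using int_vecs_add[OF _ int_vecs_minus] by (metis diff_conv_add_uminus)

lemma int_vecs_scale: "k \<in> int_vecs \<Longrightarrow> real n *\<^sub>R k \<in> int_vecs"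
  by (elim int_vecsE) (metis int_vecsI of_int_mult of_int_of_nat_eq scaleR_Pair real_scaleR_def)

lemma abs_fst_le: "\<bar>fst z\<bar> \<le> norm (z :: real \<times> real)" and abs_snd_le: "\<bar>snd z\<bar> \<le> norm z"
  by (metis norm_fst_le real_norm_def prod.collapse, metis norm_snd_le real_norm_def prod.collapse)

lemma int_vecs_small:
  assumes "k \<in> int_vecs" "norm k < 1"
  shows "k = 0"
proof -
  obtain m n :: int where k: "k = (of_int m, of_int n)" using assms(1) by (rule int_vecsE)
  have "\<bar>real_of_int m\<bar> < 1" "\<bar>real_of_int n\<bar> < 1"
    using abs_fst_le[of k] abs_snd_le[of k] assms(2) by (auto simp: k)
  hence "m = 0" "n = 0" by linarith+
  thus ?thesis by (simp add: k zero_prod_def)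
qed

lemma int_vecs_translate_into_square:
  obtains k where "k \<in> int_vecs" "x - k \<in> cbox (0, 0) (1, 1)"
proof
  show "(of_int \<lfloor>fst x\<rfloor>, of_int \<lfloor>snd x\<rfloor>) \<in> int_vecs" by simp
  show "x - (of_int \<lfloor>fst x\<rfloor>, of_int \<lfloor>snd x\<rfloor>) \<in> cbox (0, 0) (1, 1)"
    by (cases x) (auto simp: cbox_Pair_eq, linarith+)
qed

section \<open>Gronwall estimates for Lipschitz fields\<close>

lemma has_vector_derivative_affine:
  assumes "(c has_vector_derivative c') (at (r * s + t))"
  shows "((\<lambda>s. c (r * s + t)) has_vector_derivative r *\<^sub>R c') (at s)"
proof -
  have "((\<lambda>s. r * s + t) has_real_derivative r) (at s)" by (auto intro!: derivative_eq_intros)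
  hence "((\<lambda>s. r * s + t) has_vector_derivative r) (at s)"
    by (simp add: has_real_derivative_iff_has_vector_derivative)
  from vector_diff_chain_at[OF this assms] show ?thesis by (simp add: o_def)
qed

text \<open>Gronwall's inequality: by Cauchy-Schwarz the squared distance \<open>E\<close> has
  derivative at most \<open>2 * L * E\<close>, so \<open>exp (- 2 * L * s) * E s\<close> does not
  increase. Squaring avoids the point where the norm is not differentiable.\<close>

lemma solution_dist_nonneg:
  fixes a b :: "real \<Rightarrow> 'a::real_inner" and W :: "'a \<Rightarrow> 'a"
  assumes W: "\<And>x y. norm (W x - W y) \<le> L * norm (x - y)"
    and a: "\<And>s. (a has_vector_derivative W (a s)) (at s)"
    and b: "\<And>s. (b has_vector_derivative W (b s)) (at s)"
    and "0 \<le> t"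
  shows "norm (a t - b t) \<le> exp (L * t) * norm (a 0 - b 0)"
proof -
  define E where "E s = (a s - b s) \<bullet> (a s - b s)" for s
  define f where "f s = exp (- 2 * L * s) * E s" for s
  have dE: "(E has_real_derivative 2 * ((a s - b s) \<bullet> (W (a s) - W (b s)))) (at s)" for s
  proof -
    have "((\<lambda>s. a s - b s) has_vector_derivative W (a s) - W (b s)) (at s)" by (intro derivative_intros a b)
    hence d: "((\<lambda>s. a s - b s) has_derivative (\<lambda>h. h *\<^sub>R (W (a s) - W (b s)))) (at s)"
      by (simp add: has_vector_derivative_def)
    from has_derivative_inner[OF d d]
    show ?thesis unfolding E_def has_field_derivative_def
      by (rule has_derivative_eq_rhs) (auto simp: inner_commute algebra_simps)
  qed
  have le: "(a s - b s) \<bullet> (W (a s) - W (b s)) \<le> L * E s" for s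
  proof -
    have "(a s - b s) \<bullet> (W (a s) - W (b s)) \<le> norm (a s - b s) * norm (W (a s) - W (b s))"
      by (rule norm_cauchy_schwarz)
    also have "\<dots> \<le> norm (a s - b s) * (L * norm (a s - b s))" by (intro mult_left_mono W) auto
    also have "\<dots> = L * E s" by (simp add: E_def dot_square_norm power2_eq_square)
    finally show ?thesis .
  qed
  have "f t \<le> f 0"
  proof (rule DERIV_nonpos_imp_nonincreasing[OF \<open>0 \<le> t\<close>])
    fix s
    have "(f has_real_derivative exp (- 2 * L * s) * (- 2 * L) * E s
           + exp (- 2 * L * s) * (2 * ((a s - b s) \<bullet> (W (a s) - W (b s))))) (at s)"
      unfolding f_def by (auto intro!: derivative_eq_intros dE)
    moreover have "exp (- 2 * L * s) * (- 2 * L) * E s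
           + exp (- 2 * L * s) * (2 * ((a s - b s) \<bullet> (W (a s) - W (b s))))
        = 2 * exp (- 2 * L * s) * ((a s - b s) \<bullet> (W (a s) - W (b s)) - L * E s)"
      by (simp add: algebra_simps)
    moreover have "\<dots> \<le> 0" using le[of s] by (intro mult_nonneg_nonpos) auto
    ultimately show "\<exists>y. (f has_real_derivative y) (at s) \<and> y \<le> 0" by metis
  qed
  hence "exp (- 2 * L * t) * E t \<le> E 0" by (simp add: f_def)
  hence "exp (2 * L * t) * (exp (- 2 * L * t) * E t) \<le> exp (2 * L * t) * E 0" by (intro mult_left_mono) auto
  hence "E t \<le> exp (2 * L * t) * E 0" by (simp add: mult.assoc[symmetric] exp_add[symmetric])
  hence "(norm (a t - b t))\<^sup>2 \<le> (exp (L * t) * norm (a 0 - b 0))\<^sup>2"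
    by (simp add: E_def dot_square_norm power_mult_distrib exp_double[symmetric] mult.assoc)
  thus ?thesis by (rule power2_le_imp_le) auto
qed

lemma solution_dist:
  fixes a b :: "real \<Rightarrow> 'a::real_inner" and W :: "'a \<Rightarrow> 'a"
  assumes W: "\<And>x y. norm (W x - W y) \<le> L * norm (x - y)"
    and a: "\<And>s. (a has_vector_derivative W (a s)) (at s)"
    and b: "\<And>s. (b has_vector_derivative W (b s)) (at s)"
  shows "norm (a t - b t) \<le> exp (L * \<bar>t\<bar>) * norm (a 0 - b 0)"
proof (cases "0 \<le> t")
  case True
  thus ?thesis using solution_dist_nonneg[OF W a b, of t] by simp
next
  case False
  have rev: "((\<lambda>s. c (- s)) has_vector_derivative - W (c (- s))) (at s)"
    if "\<And>s. (c has_vector_derivative W (c s)) (at s)" for c s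
    using has_vector_derivative_affine[of c "W (c (- s))" "-1" s 0] that by simp
  have "norm (- W x - - W y) \<le> L * norm (x - y)" for x y using W[of x y] by (simp add: norm_minus_commute)
  from solution_dist_nonneg[of "\<lambda>x. - W x" L "\<lambda>s. a (- s)" "\<lambda>s. b (- s)" "- t", OF this rev[OF a] rev[OF b]]
  show ?thesis using False by simp
qed

text \<open>The lifted flow with the constants that all later estimates are made of. Bounds over the
  whole plane are available because \<open>V\<close> is doubly periodic, hence determined by its
  values on the unit square.\<close>

locale periodic_flow =
  fixes V :: "real \<times> real \<Rightarrow> real \<times> real"
    and \<Phi> :: "real \<Rightarrow> real \<times> real \<Rightarrow> real \<times> real"
    and L M m :: real
  assumes V_lipschitz: "norm (V x - V y) \<le> L * norm (x - y)"
    and V_le: "norm (V x) \<le> M"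
    and V_ge: "m \<le> norm (V x)"
    and m_pos: "0 < m"
    and L_pos: "0 < L"
    and V_periodic: "k \<in> int_vecs \<Longrightarrow> V (x + k) = V x"
    and flow_0 [simp]: "\<Phi> 0 x = x"
    and flow_deriv: "((\<lambda>s. \<Phi> s x) has_vector_derivative V (\<Phi> t x)) (at t)"
begin

lemma M_pos: "0 < M"
  using V_le V_ge m_pos by (meson less_le_trans)

lemma V_nz [simp]: "V x \<noteq> 0"
  using V_ge[of x] m_pos by auto

lemma flow_lipschitz: "norm (\<Phi> t x - \<Phi> t y) \<le> exp (L * \<bar>t\<bar>) * norm (x - y)"
  using solution_dist[of V L "\<lambda>s. \<Phi> s x" "\<lambda>s. \<Phi> s y" t, OF V_lipschitz flow_deriv flow_deriv] by simp

lemma flow_lipschitz_le: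
  assumes "\<bar>t\<bar> \<le> c"
  shows "norm (\<Phi> t x - \<Phi> t y) \<le> exp (L * c) * norm (x - y)"
  using flow_lipschitz[of t x y] mult_right_mono[of "exp (L * \<bar>t\<bar>)" "exp (L * c)" "norm (x - y)"]
    assms L_pos by auto

lemma flow_unique:
  assumes "\<And>s. (a has_vector_derivative V (a s)) (at s)"
  shows "a t = \<Phi> t (a 0)" using solution_dist[of V L a "\<lambda>s. \<Phi> s (a 0)" t, OF V_lipschitz assms flow_deriv]
  by simp

lemma flow_add: "\<Phi> (s + t) x = \<Phi> s (\<Phi> t x)"
proof -
  have "((\<lambda>s. \<Phi> (s + t) x) has_vector_derivative V (\<Phi> (s + t) x)) (at s)" for s
    using has_vector_derivative_affine[of "\<lambda>s. \<Phi> s x" "V (\<Phi> (s + t) x)" 1 s t] flow_deriv by simp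
  from flow_unique[of "\<lambda>s. \<Phi> (s + t) x", OF this] show ?thesis by simp
qed

lemma flow_inverse [simp]: "\<Phi> (- t) (\<Phi> t x) = x" "\<Phi> t (\<Phi> (- t) x) = x"
  using flow_add[of "-t" t x] flow_add[of t "-t" x] by simp_all

lemma flow_translate: "k \<in> int_vecs \<Longrightarrow> \<Phi> t (x + k) = \<Phi> t x + k"
proof -
  assume k: "k \<in> int_vecs"
  have "((\<lambda>s. \<Phi> s x + k) has_vector_derivative V (\<Phi> s x + k)) (at s)" for s
    using has_vector_derivative_add[OF flow_deriv[of x s] has_vector_derivative_const[of k]]
    by (simp add: V_periodic[OF k])
  from flow_unique[OF this, of t] show ?thesis by simp
qed

lemma flow_translate_diff: "k \<in> int_vecs \<Longrightarrow> \<Phi> t (x - k) = \<Phi> t x - k"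
  using flow_translate[of "- k" t x] int_vecs_minus by simp



lemma flow_speed: "norm (\<Phi> t x - \<Phi> s x) \<le> M * \<bar>t - s\<bar>"
proof -
  have "norm (\<Phi> t x - \<Phi> s x) \<le> M * norm (t - s)"
  proof (rule differentiable_bound[of UNIV "\<lambda>s. \<Phi> s x" "\<lambda>t h. h *\<^sub>R V (\<Phi> t x)"])
    show "((\<lambda>s. \<Phi> s x) has_derivative (\<lambda>h. h *\<^sub>R V (\<Phi> t x))) (at t)" for t
      using flow_deriv[of x t] by (simp add: has_vector_derivative_def)
    show "onorm (\<lambda>h. h *\<^sub>R V (\<Phi> t x)) \<le> M" for t
      using V_le[of "\<Phi> t x"] by (auto intro!: onorm_le simp: mult.commute[of M] mult_left_mono)
  qed auto
  thus ?thesis by simp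
qed

lemma flow_speed_0: "norm (\<Phi> t x - x) \<le> M * \<bar>t\<bar>"
  using flow_speed[of t x 0] by simp



lemma V_continuous: "continuous_on S V"
  by (rule lipschitz_on_continuous_on[of L], rule lipschitz_onI)
     (use V_lipschitz L_pos in \<open>auto simp: dist_norm\<close>)

lemma flow_tendsto [tendsto_intros]:
  assumes f: "(f \<longlongrightarrow> s) F" and g: "(g \<longlongrightarrow> x) F"
  shows "((\<lambda>w. \<Phi> (f w) (g w)) \<longlongrightarrow> \<Phi> s x) F"
proof -
  have "((\<lambda>w. exp (L * \<bar>f w\<bar>) * norm (g w - x) + M * \<bar>f w - s\<bar>)
           \<longlongrightarrow> exp (L * \<bar>s\<bar>) * norm (x - x) + M * \<bar>s - s\<bar>) F" by (intro tendsto_intros f g)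
  hence "((\<lambda>w. exp (L * \<bar>f w\<bar>) * norm (g w - x) + M * \<bar>f w - s\<bar>) \<longlongrightarrow> 0) F" by simp
  moreover have "norm (\<Phi> (f w) (g w) - \<Phi> s x) \<le> exp (L * \<bar>f w\<bar>) * norm (g w - x) + M * \<bar>f w - s\<bar>" for w
    using norm_triangle_ineq[of "\<Phi> (f w) (g w) - \<Phi> (f w) x" "\<Phi> (f w) x - \<Phi> s x"]
      flow_lipschitz[of "f w" "g w" x] flow_speed[of "f w" x s] by simp
  ultimately have "((\<lambda>w. \<Phi> (f w) (g w) - \<Phi> s x) \<longlongrightarrow> 0) F"
    by (intro Lim_null_comparison[OF _ \<open>(_ \<longlongrightarrow> 0) F\<close>] always_eventually allI)
  thus ?thesis by (simp add: LIM_zero_iff)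
qed

lemma flow_continuous_on [continuous_intros]:
  "continuous_on S f \<Longrightarrow> continuous_on S g \<Longrightarrow> continuous_on S (\<lambda>w. \<Phi> (f w) (g w))"
  by (auto simp: continuous_on_def intro!: flow_tendsto)

lemma V_continuous_on [continuous_intros]:
  "continuous_on S g \<Longrightarrow> continuous_on S (\<lambda>w. V (g w))"
  using continuous_on_compose2[OF V_continuous[of UNIV], of S g] by auto

lemma V_tendsto [tendsto_intros]: "(g \<longlongrightarrow> x) F \<Longrightarrow> ((\<lambda>w. V (g w)) \<longlongrightarrow> V x) F"
  using V_continuous[of UNIV] by (metis UNIV_I continuous_on_eq_continuous_at isCont_tendsto_compose open_UNIV)

text \<open>Time reversal keeps all constants, so a statement proved for forward orbits can be
  instantiated for backward ones; this is how the return map gets its second inequality.\<close>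

lemma reversed_flow: "periodic_flow (\<lambda>x. - V x) (\<lambda>t. \<Phi> (- t)) L M m"
proof
  show "norm (- V x - - V y) \<le> L * norm (x - y)" for x y
    using V_lipschitz[of x y] by (simp add: norm_minus_commute)
  show "((\<lambda>s. \<Phi> (- s) x) has_vector_derivative - V (\<Phi> (- t) x)) (at t)" for x t
    using has_vector_derivative_affine[of "\<lambda>s. \<Phi> s x" "V (\<Phi> (- t) x)" "-1" t 0] flow_deriv by simp
qed (use V_le V_ge m_pos L_pos V_periodic in auto)

end

section \<open>Local sections\<close>

definition det2 :: "real \<times> real \<Rightarrow> real \<times> real \<Rightarrow> real" where
  "det2 a b = fst a * snd b - snd a * fst b"

lemma det2_lagrange: "(det2 a b)\<^sup>2 + (a \<bullet> b)\<^sup>2 = (norm a)\<^sup>2 * (norm b)\<^sup>2"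
  unfolding power2_norm_eq_inner
  by (cases a; cases b) (simp add: det2_def inner_Pair power2_eq_square algebra_simps)

lemma abs_det2_le: "\<bar>det2 a b\<bar> \<le> norm a * norm b"
proof -
  have "(det2 a b)\<^sup>2 \<le> (norm a * norm b)\<^sup>2"
    using det2_lagrange[of a b] zero_le_power2[of "a \<bullet> b"] unfolding power_mult_distrib by linarith
  thus ?thesis by (simp add: abs_le_square_iff[symmetric])
qed

lemma abs_det2_orthogonal: "a \<bullet> b = 0 \<Longrightarrow> \<bar>det2 a b\<bar> = norm a * norm b"
  by (rule power2_eq_imp_eq) (use det2_lagrange[of a b] in \<open>simp_all add: power_mult_distrib\<close>)

lemma det2_linear: "det2 a (b + c) = det2 a b + det2 a c" "det2 a (b - c) = det2 a b - det2 a c"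
   "det2 a (r *\<^sub>R b) = r * det2 a b" "det2 a 0 = 0" "det2 a a = 0" by (auto simp: det2_def algebra_simps)

context periodic_flow begin

text \<open>Within \<open>tube\<close> of \<open>p\<close> the field differs from \<open>V p\<close>
  by at most \<open>m / 2\<close>, so orbits cross the line normal to \<open>V p\<close> in one
  direction only; the cap \<open>1 / 4\<close> keeps displacements below the length of a nonzero
  integer vector. During \<open>t1\<close> an orbit moves at most \<open>tube / 2\<close>. The
  factor in \<open>t0\<close> leaves room for differences of hitting times below \<open>t1\<close>.
  Points within \<open>rad\<close> of \<open>p\<close> reach the line within time \<open>t0\<close>,
  and \<open>slant\<close> bounds how much farther from \<open>p\<close> they may land.\<close>

definition tube :: real where "tube = min (m / (2 * L)) (1 / 4)"
definition t1 :: real where "t1 = tube / (2 * M)"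
definition t0 :: real where "t0 = t1 / 4"
abbreviation slant :: real where "slant \<equiv> 1 + 2 * M / m"
definition rad :: real where "rad = min (tube / 2) (t0 * m / 4)"

lemma tube_pos: "0 < tube" using m_pos L_pos by (simp add: tube_def)
lemma t1_pos: "0 < t1" using tube_pos M_pos by (simp add: t1_def)
lemma t0_pos: "0 < t0" using t1_pos by (simp add: t0_def)
lemma rad_pos: "0 < rad" using tube_pos t0_pos m_pos by (simp add: rad_def)
lemma rad_le: "rad \<le> tube / 2" by (simp add: rad_def)
lemma tube_le: "tube \<le> 1 / 4" by (simp add: tube_def)
lemma M_t1: "M * t1 = tube / 2" using M_pos by (simp add: t1_def)

text \<open>In the tube the inner product of the velocity with \<open>V p\<close> is at least half
  of its value at \<open>p\<close>. This monotonicity plays the role of the implicit function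
  theorem: existence, uniqueness and continuity of hitting times all follow from it.\<close>

lemma section_slope:
  assumes z: "norm (z - p) \<le> tube / 2" and r: "\<bar>r\<bar> \<le> t1" "\<bar>r'\<bar> \<le> t1" "r \<le> r'"
  shows "(r' - r) * ((norm (V p))\<^sup>2 / 2) \<le> (\<Phi> r' z - \<Phi> r z) \<bullet> V p"
proof -
  define f where "f s = \<Phi> s z \<bullet> V p - s * ((norm (V p))\<^sup>2 / 2)" for s
  have "f r \<le> f r'"
  proof (rule DERIV_nonneg_imp_nondecreasing[OF \<open>r \<le> r'\<close>])
    fix s assume s: "r \<le> s" "s \<le> r'"
    hence "\<bar>s\<bar> \<le> t1" using r by auto
    have "norm (\<Phi> s z - p) \<le> norm (\<Phi> s z - z) + norm (z - p)"
      using norm_triangle_ineq[of "\<Phi> s z - z" "z - p"] by simp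
    also have "\<dots> \<le> M * t1 + tube / 2"
      using flow_speed_0[of s z] z mult_left_mono[OF \<open>\<bar>s\<bar> \<le> t1\<close>, of M] M_pos by linarith
    finally have d: "norm (\<Phi> s z - p) \<le> tube" by (simp add: M_t1)
    have "norm (V (\<Phi> s z) - V p) \<le> L * tube"
      using V_lipschitz[of "\<Phi> s z" p] mult_left_mono[OF d, of L] L_pos by linarith
    also have "\<dots> \<le> L * (m / (2 * L))" using L_pos by (intro mult_left_mono) (auto simp: tube_def)
    also have "\<dots> = m / 2" using L_pos by simp
    also have "\<dots> \<le> norm (V p) / 2" using V_ge[of p] by simp
    finally have "norm (V p - V (\<Phi> s z)) \<le> norm (V p) / 2" by (simp add: norm_minus_commute)
    hence "(V p - V (\<Phi> s z)) \<bullet> V p \<le> norm (V p) / 2 * norm (V p)"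
      by (meson norm_cauchy_schwarz order_trans mult_right_mono norm_ge_zero)
    hence "0 \<le> V (\<Phi> s z) \<bullet> V p - (norm (V p))\<^sup>2 / 2"
      by (simp add: inner_diff_left dot_square_norm power2_eq_square)
    moreover have "((\<lambda>s. \<Phi> s z \<bullet> V p) has_real_derivative V (\<Phi> s z) \<bullet> V p) (at s)"
      using bounded_linear.has_vector_derivative[OF bounded_linear_inner_left[of "V p"] flow_deriv[of z s]]
      by (simp add: has_real_derivative_iff_has_vector_derivative)
    hence "(f has_real_derivative V (\<Phi> s z) \<bullet> V p - (norm (V p))\<^sup>2 / 2) (at s)"
      unfolding f_def by (auto intro!: derivative_eq_intros)
    ultimately show "\<exists>y. (f has_real_derivative y) (at s) \<and> 0 \<le> y" by blast
  qed
  thus ?thesis unfolding f_def inner_diff_left left_diff_distrib by linarith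
qed

lemma section_slope_abs:
  assumes z: "norm (z - p) \<le> tube / 2" and r: "\<bar>r\<bar> \<le> t1" "\<bar>r'\<bar> \<le> t1"
  shows "\<bar>r' - r\<bar> * ((norm (V p))\<^sup>2 / 2) \<le> \<bar>(\<Phi> r' z - \<Phi> r z) \<bullet> V p\<bar>"
proof (cases "r \<le> r'")
  case True
  thus ?thesis using section_slope[OF z r True] by simp
next
  case False
  hence "r' \<le> r" by simp
  have "(\<Phi> r' z - \<Phi> r z) \<bullet> V p = - ((\<Phi> r z - \<Phi> r' z) \<bullet> V p)" by (simp add: inner_diff_left)
  thus ?thesis using section_slope[OF z r(2,1) \<open>r' \<le> r\<close>] False by simp
qed

text \<open>Turns a distance into a time lag: at time \<open>r\<close> the orbit is level with
  \<open>w\<close>, and away from that time it gains height over \<open>w\<close> at a definite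
  rate.\<close>

lemma time_le_dist:
  assumes z: "norm (z - p) \<le> tube / 2" "\<bar>r\<bar> \<le> t1" "\<bar>r'\<bar> \<le> t1" and w: "(\<Phi> r z - w) \<bullet> V p = 0"
  shows "\<bar>r' - r\<bar> \<le> 2 / m * norm (\<Phi> r' z - w)"
proof -
  have "(\<Phi> r' z - \<Phi> r z) \<bullet> V p = (\<Phi> r' z - w) \<bullet> V p" using w by (simp add: inner_diff_left)
  hence "\<bar>r' - r\<bar> * ((norm (V p))\<^sup>2 / 2) \<le> norm (\<Phi> r' z - w) * norm (V p)"
    using section_slope_abs[OF z] Cauchy_Schwarz_ineq2[of "\<Phi> r' z - w" "V p"] by simp
  hence "(\<bar>r' - r\<bar> * norm (V p)) * norm (V p) \<le> (2 * norm (\<Phi> r' z - w)) * norm (V p)"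
    by (simp add: power2_eq_square algebra_simps)
  hence "\<bar>r' - r\<bar> * norm (V p) \<le> 2 * norm (\<Phi> r' z - w)" by (rule mult_right_le_imp_le) simp
  moreover have "\<bar>r' - r\<bar> * m \<le> \<bar>r' - r\<bar> * norm (V p)" by (intro mult_left_mono V_ge) auto
  ultimately show ?thesis using m_pos by (simp add: field_simps)
qed

lemma hit_time_unique:
  assumes "norm (z - p) \<le> tube / 2" "\<bar>r\<bar> \<le> t1" "\<bar>r'\<bar> \<le> t1"
    and "(\<Phi> r z - p) \<bullet> V p = 0" "(\<Phi> r' z - p) \<bullet> V p = 0"
  shows "r = r'"
proof -
  have "(\<Phi> r' z - \<Phi> r z) \<bullet> V p = 0" using assms(4,5) by (simp add: inner_diff_left)
  hence "\<bar>r' - r\<bar> * ((norm (V p))\<^sup>2 / 2) \<le> 0" using section_slope_abs[OF assms(1-3)] by simp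
  thus ?thesis by (simp add: mult_le_0_iff)
qed

text \<open>The signed time in which \<open>z\<close> flows to the line through \<open>p\<close>
  normal to \<open>V p\<close>. For \<open>z\<close> within \<open>rad\<close> of \<open>p\<close>
  such a time exists and is unique; farther away the choice carries no information.
  \<open>foot\<close> is then the projection to this line along orbits.\<close>

definition hit :: "real \<times> real \<Rightarrow> real \<times> real \<Rightarrow> real" where
  "hit p z = (SOME r. \<bar>r\<bar> \<le> t0 \<and> (\<Phi> r z - p) \<bullet> V p = 0)"

definition foot :: "real \<times> real \<Rightarrow> real \<times> real \<Rightarrow> real \<times> real" where
  "foot p z = \<Phi> (hit p z) z"

lemma hit_ex:
  assumes z: "norm (z - p) \<le> rad"
  shows "\<exists>r. \<bar>r\<bar> \<le> t0 \<and> (\<Phi> r z - p) \<bullet> V p = 0"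
proof -
  define g where "g r = (\<Phi> r z - p) \<bullet> V p" for r
  have zt: "norm (z - p) \<le> tube / 2" using z rad_le by linarith
  have le: "\<bar>g 0\<bar> \<le> t0 * ((norm (V p))\<^sup>2 / 2)"
  proof -
    have "\<bar>g 0\<bar> \<le> norm (z - p) * norm (V p)"
      using Cauchy_Schwarz_ineq2[of "z - p" "V p"] by (simp add: g_def)
    also have "\<dots> \<le> (t0 * norm (V p) / 2) * norm (V p)"
    proof (intro mult_right_mono)
      have "norm (z - p) \<le> t0 * m / 4" using z by (simp add: rad_def)
      also have "\<dots> \<le> t0 * norm (V p) / 2" using V_ge[of p] t0_pos m_pos by (simp add: field_simps)
      finally show "norm (z - p) \<le> t0 * norm (V p) / 2" .
    qed auto
    finally show ?thesis by (simp add: power2_eq_square)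
  qed
  have "t0 \<le> t1" using t1_pos by (simp add: t0_def)
  hence "g (- t0) \<le> 0" "0 \<le> g t0"
    using section_slope[OF zt, of "-t0" 0] section_slope[OF zt, of 0 t0] abs_le_D1[OF le] abs_le_D2[OF le]
      t0_pos unfolding g_def inner_diff_left by simp_all
  moreover have "continuous_on {-t0..t0} g" unfolding g_def by (intro continuous_intros)
  ultimately obtain r where "-t0 \<le> r" "r \<le> t0" "g r = 0" using IVT'[of g "-t0" 0 t0] t0_pos by auto
  thus ?thesis by (intro exI[of _ r]) (auto simp: g_def)
qed

lemma
  assumes "norm (z - p) \<le> rad"
  shows hit_abs_le: "\<bar>hit p z\<bar> \<le> t0" and foot_orthogonal: "(foot p z - p) \<bullet> V p = 0"
  using someI_ex[OF hit_ex[OF assms]] unfolding hit_def foot_def by auto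

lemma hit_eqI:
  assumes "norm (z - p) \<le> rad" "\<bar>r\<bar> \<le> t1" "(\<Phi> r z - p) \<bullet> V p = 0"
  shows "hit p z = r"
proof (rule hit_time_unique[of z p])
  show "norm (z - p) \<le> tube / 2" using assms(1) rad_le by linarith
  show "\<bar>hit p z\<bar> \<le> t1" using hit_abs_le[OF assms(1)] t1_pos by (simp add: t0_def)
  show "(\<Phi> (hit p z) z - p) \<bullet> V p = 0" using foot_orthogonal[OF assms(1)] by (simp add: foot_def)
qed (use assms in auto)

text \<open>An approximate solution of the hitting equation is close to the true one. With
  \<open>r\<close> frozen at its limit value, this yields continuity of \<open>hit\<close> jointly
  in the base point and the argument.\<close>

lemma hit_approx:
  assumes "norm (z - p) \<le> rad" "\<bar>r\<bar> \<le> t1"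
  shows "\<bar>hit p z - r\<bar> \<le> 2 / m\<^sup>2 * \<bar>(\<Phi> r z - p) \<bullet> V p\<bar>"
proof -
  have "(\<Phi> (hit p z) z - \<Phi> r z) \<bullet> V p = - ((\<Phi> r z - p) \<bullet> V p)"
    using foot_orthogonal[OF assms(1)] by (simp add: foot_def inner_diff_left)
  hence "\<bar>hit p z - r\<bar> * ((norm (V p))\<^sup>2 / 2) \<le> \<bar>(\<Phi> r z - p) \<bullet> V p\<bar>"
    using section_slope_abs[of z p r "hit p z"] hit_abs_le[OF assms(1)] assms rad_le t1_pos
    by (simp add: t0_def)
  moreover have "m\<^sup>2 \<le> (norm (V p))\<^sup>2" using V_ge[of p] m_pos by (simp add: power_mono)
  hence "\<bar>hit p z - r\<bar> * (m\<^sup>2 / 2) \<le> \<bar>hit p z - r\<bar> * ((norm (V p))\<^sup>2 / 2)" by (intro mult_left_mono) auto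
  ultimately show ?thesis using m_pos by (simp add: field_simps)
qed

lemma hit_le:
  assumes "norm (z - p) \<le> rad"
  shows "\<bar>hit p z\<bar> \<le> 2 / m * norm (z - p)"
  using time_le_dist[of z p "hit p z" 0 p] foot_orthogonal[OF assms] hit_abs_le[OF assms] assms rad_le t1_pos
  by (simp add: t0_def foot_def)

lemma foot_dist:
  assumes "norm (z - p) \<le> rad"
  shows "norm (foot p z - p) \<le> slant * norm (z - p)"
proof -
  have "norm (foot p z - p) \<le> norm (\<Phi> (hit p z) z - z) + norm (z - p)"
    using norm_triangle_ineq[of "foot p z - z" "z - p"] by (simp add: foot_def)
  also have "\<dots> \<le> M * (2 / m * norm (z - p)) + norm (z - p)"
    using flow_speed_0[of "hit p z" z] mult_left_mono[OF hit_le[OF assms], of M] M_pos by linarith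
  finally show ?thesis by (simp add: algebra_simps)
qed

lemma hit_tendsto:
  assumes f: "(f \<longlongrightarrow> p) F" and g: "(g \<longlongrightarrow> z) F" and z: "norm (z - p) \<le> rad"
    and ev: "\<forall>\<^sub>F w in F. norm (g w - f w) \<le> rad"
  shows "((\<lambda>w. hit (f w) (g w)) \<longlongrightarrow> hit p z) F"
proof -
  define r where "r = hit p z"
  have "((\<lambda>w. 2 / m\<^sup>2 * \<bar>(\<Phi> r (g w) - f w) \<bullet> V (f w)\<bar>) \<longlongrightarrow> 2 / m\<^sup>2 * \<bar>(\<Phi> r z - p) \<bullet> V p\<bar>) F"
    by (intro tendsto_intros f g)
  moreover have "(\<Phi> r z - p) \<bullet> V p = 0" using foot_orthogonal[OF z] by (simp add: r_def foot_def)
  ultimately have "((\<lambda>w. 2 / m\<^sup>2 * \<bar>(\<Phi> r (g w) - f w) \<bullet> V (f w)\<bar>) \<longlongrightarrow> 0) F" by simp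
  moreover have "\<bar>r\<bar> \<le> t1" using hit_abs_le[OF z] t1_pos by (simp add: r_def t0_def)
  hence "\<forall>\<^sub>F w in F. norm (hit (f w) (g w) - r) \<le> 2 / m\<^sup>2 * \<bar>(\<Phi> r (g w) - f w) \<bullet> V (f w)\<bar>"
    by (intro eventually_mono[OF ev]) (simp only: real_norm_def, rule hit_approx)
  ultimately have "((\<lambda>w. hit (f w) (g w) - r) \<longlongrightarrow> 0) F" by (rule Lim_null_comparison[rotated])
  thus ?thesis by (simp add: LIM_zero_iff r_def)
qed

lemma hit_continuous_on:
  assumes "continuous_on S f" "continuous_on S g" "\<And>w. w \<in> S \<Longrightarrow> norm (g w - f w) \<le> rad"
  shows "continuous_on S (\<lambda>w. hit (f w) (g w))" unfolding continuous_on_def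
proof
  fix w assume w: "w \<in> S"
  show "((\<lambda>w. hit (f w) (g w)) \<longlongrightarrow> hit (f w) (g w)) (at w within S)"
  proof (rule hit_tendsto)
    show "\<forall>\<^sub>F w in at w within S. norm (g w - f w) \<le> rad" using assms(3) by (simp add: eventually_at_filter)
  qed (use assms w in \<open>auto simp: continuous_on_def\<close>)
qed

lemma foot_continuous_on:
  assumes "continuous_on S f" "continuous_on S g" "\<And>w. w \<in> S \<Longrightarrow> norm (g w - f w) \<le> rad"
  shows "continuous_on S (\<lambda>w. foot (f w) (g w))"
  unfolding foot_def by (intro continuous_intros hit_continuous_on assms)

text \<open>All displacements involved add up to less than 1, which rules out a nonzero translation;
  the rest is uniqueness of hitting times. Disjointness of crossings and injectivity of the return
  map both rest on this fact.\<close>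

lemma same_orbit_on_section:
  assumes z: "norm (z - p) \<le> rad" "(z - p) \<bullet> V p = 0"
    and z': "norm (z' - p) \<le> rad" "(z' - p) \<bullet> V p = 0"
    and k: "k \<in> int_vecs" and r: "\<bar>r\<bar> \<le> t1" "\<Phi> r z = z' + k"
  shows "k = 0 \<and> r = 0 \<and> z' = z"
proof -
  have "norm k = norm ((\<Phi> r z - z) + (z - p) + (p - z'))" by (simp add: r(2))
  also have "\<dots> \<le> norm (\<Phi> r z - z) + norm (z - p) + norm (p - z')"
    using norm_triangle_ineq[of "(\<Phi> r z - z) + (z - p)" "p - z'"] norm_triangle_ineq[of "\<Phi> r z - z" "z - p"]
    by linarith
  also have "\<dots> \<le> tube / 2 + rad + rad"
    using flow_speed_0[of r z] mult_left_mono[OF r(1), of M] M_pos M_t1 z(1) z'(1)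
    by (simp add: norm_minus_commute)
  also have "\<dots> < 1" using rad_le tube_le tube_pos by linarith
  finally have "k = 0" using int_vecs_small[OF k] by simp
  moreover have "0 = r"
  proof (rule hit_time_unique[of z p])
    show "norm (z - p) \<le> tube / 2" using z rad_le by linarith
  qed (use z z' r t1_pos \<open>k = 0\<close> in auto)
  ultimately show ?thesis using r by auto
qed

end

section \<open>Growth of covers and polynomial entropy\<close>

definition flow_covering :: "(real \<Rightarrow> 'a \<Rightarrow> 'a::metric_space) \<Rightarrow> 'a set \<Rightarrow> real \<Rightarrow> real \<Rightarrow> 'a set \<Rightarrow> bool" where
  "flow_covering \<phi> X t e C \<longleftrightarrow> finite C \<and> C \<subseteq> X \<and> (\<forall>y\<in>X. \<exists>x\<in>C. flow_dist \<phi> t x y < e)"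

lemma flow_cover_altdef:
  "flow_cover \<phi> X X t e = (LEAST n. \<exists>C. flow_covering \<phi> X t e C \<and> card C = n)"
  unfolding flow_cover_def flow_covering_def
  by (intro arg_cong[of _ _ Least] ext arg_cong[of _ _ Ex]) (simp add: subset_eq conj_ac)

text \<open>The metric side of the entropy, free of the torus. Besides the bound by 1,
  \<open>linear_cover\<close> supplies the finite covers without which the \<open>LEAST\<close> in
  \<open>flow_cover\<close> would be unspecified.\<close>

locale linear_growth_flow =
  fixes \<phi> :: "real \<Rightarrow> 'a \<Rightarrow> 'a::metric_space" and X :: "'a set"
  assumes bounded: "bounded X" and nonempty: "X \<noteq> {}"
    and invariant: "x \<in> X \<Longrightarrow> \<phi> s x \<in> X"
    and linear_cover: "e > 0 \<Longrightarrow> \<exists>K. \<forall>t\<ge>1. \<exists>C. flow_covering \<phi> X t e C \<and> real (card C) \<le> K * t"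
begin

abbreviation G :: "real \<Rightarrow> real \<Rightarrow> nat" where "G t e \<equiv> flow_cover \<phi> X X t e"

lemma flow_dist_bdd: "x \<in> X \<Longrightarrow> y \<in> X \<Longrightarrow> bdd_above ((\<lambda>s. dist (\<phi> s x) (\<phi> s y)) ` {0..t})"
  by (intro bdd_aboveI[of _ "diameter X"]) (auto intro!: diameter_bounded_bound bounded invariant)

lemma dist_le_flow_dist:
  "x \<in> X \<Longrightarrow> y \<in> X \<Longrightarrow> s \<in> {0..t} \<Longrightarrow> dist (\<phi> s x) (\<phi> s y) \<le> flow_dist \<phi> t x y"
  unfolding flow_dist_def by (rule cSUP_upper[OF _ flow_dist_bdd])

lemma flow_dist_triangle:
  assumes "x \<in> X" "y \<in> X" "z \<in> X" "0 \<le> t"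
  shows "flow_dist \<phi> t x y \<le> flow_dist \<phi> t z x + flow_dist \<phi> t z y" unfolding flow_dist_def[of \<phi> t x y]
proof (rule cSUP_least)
  fix s assume "s \<in> {0..t}"
  hence "dist (\<phi> s z) (\<phi> s x) \<le> flow_dist \<phi> t z x" "dist (\<phi> s z) (\<phi> s y) \<le> flow_dist \<phi> t z y"
    using assms by (auto intro!: dist_le_flow_dist)
  thus "dist (\<phi> s x) (\<phi> s y) \<le> flow_dist \<phi> t z x + flow_dist \<phi> t z y"
    using dist_triangle3[of "\<phi> s x" "\<phi> s y" "\<phi> s z"] by linarith
qed (use assms in auto)

lemma flow_cover_attained:
  assumes "t \<ge> 1" "e > 0"
  obtains C where "flow_covering \<phi> X t e C" "card C = G t e"
proof -
  have "\<exists>n C. flow_covering \<phi> X t e C \<and> card C = n" using linear_cover[OF assms(2)] assms(1) by blast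
  hence "\<exists>C. flow_covering \<phi> X t e C \<and> card C = G t e" unfolding flow_cover_altdef by (rule LeastI_ex)
  thus ?thesis using that by blast
qed

lemma flow_cover_le: "flow_covering \<phi> X t e C \<Longrightarrow> G t e \<le> card C"
  unfolding flow_cover_altdef by (rule Least_le) blast

lemma flow_cover_ge_1:
  assumes "t \<ge> 1" "e > 0"
  shows "1 \<le> G t e"
proof -
  obtain C where C: "flow_covering \<phi> X t e C" "card C = G t e" using flow_cover_attained[OF assms] .
  hence "C \<noteq> {}" "finite C" using nonempty by (auto simp: flow_covering_def)
  thus ?thesis using C(2) by (metis One_nat_def Suc_leI card_gt_0_iff)
qed

lemma flow_cover_antimono:
  assumes "t \<ge> 1" "0 < e" "e \<le> e'"
  shows "G t e' \<le> G t e"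
proof -
  obtain C where C: "flow_covering \<phi> X t e C" "card C = G t e" using flow_cover_attained[OF assms(1,2)] .
  hence "flow_covering \<phi> X t e' C" using assms(3) unfolding flow_covering_def by (meson less_le_trans)
  thus ?thesis using flow_cover_le C(2) by metis
qed

lemma separated_le_flow_cover:
  assumes "t \<ge> 1" "0 < e" "finite S" "S \<subseteq> X"
    and sep: "\<And>x y. x \<in> S \<Longrightarrow> y \<in> S \<Longrightarrow> x \<noteq> y \<Longrightarrow> 2 * e \<le> flow_dist \<phi> t x y"
  shows "card S \<le> G t e"
proof -
  obtain C where C: "flow_covering \<phi> X t e C" "card C = G t e" using flow_cover_attained[OF assms(1,2)] .
  have "\<forall>y\<in>S. \<exists>x\<in>C. flow_dist \<phi> t x y < e" using C(1) assms(4) by (auto simp: flow_covering_def)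
  then obtain c where c: "\<And>y. y \<in> S \<Longrightarrow> c y \<in> C \<and> flow_dist \<phi> t (c y) y < e" by metis
  have "inj_on c S"
  proof (rule inj_onI, rule ccontr)
    fix x y assume xy: "x \<in> S" "y \<in> S" "c x = c y" "x \<noteq> y"
    have "flow_dist \<phi> t x y \<le> flow_dist \<phi> t (c x) x + flow_dist \<phi> t (c x) y"
      using xy assms C(1) c[of x] by (intro flow_dist_triangle) (auto simp: flow_covering_def)
    thus False using c[of x] c[of y] xy sep[of x y] by auto
  qed
  thus ?thesis using C c by (metis card_inj_on_le flow_covering_def image_subsetI)
qed

definition growth :: "real \<Rightarrow> ereal" where
  "growth e = Limsup at_top (\<lambda>t. ereal (ln (real (G t e)) / ln t))"

lemma growth_antimono:
  assumes "0 < e" "e \<le> e'"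
  shows "growth e' \<le> growth e" unfolding growth_def
proof (rule Limsup_mono, rule eventually_mono[OF eventually_gt_at_top[of 1]])
  fix t :: real assume t: "1 < t"
  thus "ereal (ln (real (G t e')) / ln t) \<le> ereal (ln (real (G t e)) / ln t)"
    using flow_cover_antimono[of t, OF _ assms] flow_cover_ge_1[of t e'] assms
    by (auto intro!: divide_right_mono ln_mono)
qed

text \<open>\<open>growth e\<close> increases as \<open>e\<close> decreases, so the one-sided limit
  exists among the extended reals and is a supremum. This identifies the value of \<open>Lim\<close>
  in the definition of the entropy.\<close>

lemma hpol_flow_eq_SUP: "hpol_flow \<phi> X = (SUP e\<in>{0<..}. growth e)"
proof -
  have "(growth \<longlongrightarrow> (SUP e\<in>{0<..}. growth e)) (at_right 0)"
  proof (rule order_tendstoI)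
    fix a assume "a < (SUP e\<in>{0<..}. growth e)"
    then obtain e where e: "e > 0" "a < growth e" by (auto simp: less_SUP_iff)
    have "\<forall>\<^sub>F x in at_right 0. x \<in> {0<..<e}" using e(1) by (rule eventually_at_right_real)
    thus "\<forall>\<^sub>F x in at_right 0. a < growth x"
      by eventually_elim (use growth_antimono e in \<open>auto intro: less_le_trans\<close>)
  next
    fix a assume a: "(SUP e\<in>{0<..}. growth e) < a"
    have "\<forall>\<^sub>F x in at_right (0::real). x \<in> {0<..<1}" by (rule eventually_at_right_real) simp
    thus "\<forall>\<^sub>F x in at_right 0. growth x < a"
      by eventually_elim (use a in \<open>auto intro: le_less_trans[OF SUP_upper]\<close>)
  qed
  hence "Lim (at_right 0) growth = (SUP e\<in>{0<..}. growth e)" by (intro tendsto_Lim) auto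
  thus ?thesis by (simp add: hpol_flow_def hpol_flow_on_def growth_def[abs_def])
qed

lemma growth_le_hpol: "e > 0 \<Longrightarrow> growth e \<le> hpol_flow \<phi> X"
  unfolding hpol_flow_eq_SUP by (rule SUP_upper) auto

lemma ln_ratio_tendsto: "((\<lambda>t::real. ereal (c / ln t + d)) \<longlongrightarrow> ereal d) at_top"
proof -
  have "((\<lambda>t::real. c / ln t) \<longlongrightarrow> 0) at_top"
    by (rule tendsto_divide_0[OF tendsto_const]) (auto intro: filterlim_at_top_imp_at_infinity ln_at_top)
  from tendsto_add[OF this tendsto_const[of d]] show ?thesis by simp
qed

lemma hpol_flow_nonneg: "0 \<le> hpol_flow \<phi> X"
proof -
  have "0 \<le> growth 1" unfolding growth_def
  proof (rule le_Limsup, simp, rule eventually_mono[OF eventually_gt_at_top[of 1]])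
    fix t :: real assume t: "1 < t"
    thus "0 \<le> ereal (ln (real (G t 1)) / ln t)" using flow_cover_ge_1[of t 1] by auto
  qed
  thus ?thesis using growth_le_hpol[of 1] by (auto intro: order_trans)
qed

text \<open>The exponent is kept general because two values occur: 1 for the linear upper bound, and
  0 for flows whose covers stay bounded.\<close>

lemma hpol_flow_le:
  assumes "\<And>e. e > 0 \<Longrightarrow> \<exists>K. \<forall>t\<ge>1. \<exists>C. flow_covering \<phi> X t e C \<and> real (card C) \<le> K * t powr a"
  shows "hpol_flow \<phi> X \<le> ereal a" unfolding hpol_flow_eq_SUP
proof (rule SUP_least)
  fix e :: real assume "e \<in> {0<..}"
  hence e: "e > 0" by simp
  obtain K where K: "\<And>t. t \<ge> 1 \<Longrightarrow> \<exists>C. flow_covering \<phi> X t e C \<and> real (card C) \<le> K * t powr a"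
    using assms[OF e] by blast
  have "growth e \<le> Limsup at_top (\<lambda>t. ereal (ln (max K 1) / ln t + a))" unfolding growth_def
  proof (rule Limsup_mono, rule eventually_mono[OF eventually_gt_at_top[of 1]])
    fix t :: real assume t: "1 < t"
    obtain C where C: "flow_covering \<phi> X t e C" "real (card C) \<le> K * t powr a" using K[of t] t by auto
    have "real (G t e) \<le> K * t powr a" using flow_cover_le[OF C(1)] C(2) by linarith
    also have "\<dots> \<le> max K 1 * t powr a" by (intro mult_right_mono) auto
    finally have "ln (real (G t e)) \<le> ln (max K 1 * t powr a)"
      using flow_cover_ge_1[of t e] t e by (intro ln_mono) auto
    also have "\<dots> = ln (max K 1) + a * ln t" using t by (subst ln_mult_pos) (auto simp: ln_powr)
    finally have "ln (real (G t e)) / ln t \<le> (ln (max K 1) + a * ln t) / ln t"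
      using t by (intro divide_right_mono) auto
    thus "ereal (ln (real (G t e)) / ln t) \<le> ereal (ln (max K 1) / ln t + a)"
      using t by (simp add: add_divide_distrib)
  qed
  also have "\<dots> = ereal a" using lim_imp_Limsup[OF _ ln_ratio_tendsto] by simp
  finally show "growth e \<le> ereal a" .
qed

lemma hpol_flow_le_1: "hpol_flow \<phi> X \<le> 1"
  using hpol_flow_le[of 1] linear_cover by (simp add: one_ereal_def)

text \<open>A single scale \<open>e\<close> gives a lower bound because the entropy is a supremum
  over scales. A ball of radius \<open>e / 2\<close> contains at most one point of an
  \<open>e\<close>-separated set.\<close>

lemma hpol_flow_ge_1:
  assumes "e > 0" "c > 0"
    and sep: "\<And>t. t \<ge> t0 \<Longrightarrow> \<exists>S. finite S \<and> S \<subseteq> X \<and> c * t \<le> real (card S) \<and>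
               (\<forall>x\<in>S. \<forall>y\<in>S. x \<noteq> y \<longrightarrow> e \<le> flow_dist \<phi> t x y)"
  shows "1 \<le> hpol_flow \<phi> X"
proof -
  have "1 = Limsup at_top (\<lambda>t. ereal (ln c / ln t + 1))"
    using lim_imp_Limsup[OF _ ln_ratio_tendsto] by (simp add: one_ereal_def)
  also have "\<dots> \<le> growth (e / 2)" unfolding growth_def
  proof (rule Limsup_mono, rule eventually_mono[OF eventually_gt_at_top[of "max 1 t0"]])
    fix t :: real assume "max 1 t0 < t"
    hence t: "1 < t" "t0 \<le> t" by auto
    obtain S where S: "finite S" "S \<subseteq> X" "c * t \<le> real (card S)"
      "\<forall>x\<in>S. \<forall>y\<in>S. x \<noteq> y \<longrightarrow> e \<le> flow_dist \<phi> t x y" using sep[OF t(2)] by blast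
    have "card S \<le> G t (e / 2)" using separated_le_flow_cover[of t "e/2" S] S assms t by auto
    hence "c * t \<le> real (G t (e / 2))" using S(3) by linarith
    hence "ln (c * t) \<le> ln (real (G t (e / 2)))" using assms t by (intro ln_mono) auto
    moreover have "ln (c * t) = ln c + ln t" using t assms by (intro ln_mult_pos) auto
    ultimately have "(ln c + ln t) / ln t \<le> ln (real (G t (e / 2))) / ln t"
      using t by (intro divide_right_mono) auto
    thus "ereal (ln c / ln t + 1) \<le> ereal (ln (real (G t (e / 2))) / ln t)"
      using t by (simp add: add_divide_distrib)
  qed
  also have "\<dots> \<le> hpol_flow \<phi> X" using assms by (intro growth_le_hpol) auto
  finally show ?thesis .
qed



end

section \<open>The covering projection and the metric of the torus\<close>

lemma torus_proj_add_int_vec: "k \<in> int_vecs \<Longrightarrow> torus_proj (x + k) = torus_proj x"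
  by (elim int_vecsE) (auto simp: torus_proj_def ring_distribs cis_mult[symmetric] cis_multiple_2pi)

text \<open>Real parts are enough: for a remainder \<open>r\<close> of at most a half turn, the real
  part of \<open>cis (2 * pi * r)\<close> falls short of 1 by an amount that grows with the size of
  \<open>r\<close>. Capping \<open>e'\<close> at \<open>1 / 2\<close> keeps the angles where the
  cosine is monotone.\<close>

lemma cis_close_imp_int_close:
  assumes "e > 0"
  obtains d where "d > 0"
    "\<And>a b. cmod (cis (2 * pi * a) - cis (2 * pi * b)) < d \<Longrightarrow> \<exists>n::int. \<bar>a - b - of_int n\<bar> < e"
proof
  define e' where "e' = min e (1 / 2)"
  show "0 < 1 - cos (2 * pi * e')"
  proof -
    have "cos (2 * pi * e') < cos 0" using assms by (intro cos_monotone_0_pi) (auto simp: e'_def)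
    thus ?thesis by simp
  qed
  fix a b :: real assume d: "cmod (cis (2 * pi * a) - cis (2 * pi * b)) < 1 - cos (2 * pi * e')"
  define r where "r = a - b - of_int (round (a - b))"
  have r: "\<bar>r\<bar> \<le> 1 / 2" using of_int_round_abs_le[of "a - b"] by (simp add: r_def abs_minus_commute)
  have "cis (2 * pi * a) - cis (2 * pi * b) = cis (2 * pi * b) * (cis (2 * pi * (a - b)) - 1)"
    by (simp add: algebra_simps cis_mult)
  hence "cmod (cis (2 * pi * (a - b)) - 1) < 1 - cos (2 * pi * e')" using d by (simp add: norm_mult)
  moreover have "cis (2 * pi * (a - b)) = cis (2 * pi * r) * cis (2 * pi * of_int (round (a - b)))"
    by (simp add: cis_mult r_def algebra_simps)
  hence "cis (2 * pi * (a - b)) = cis (2 * pi * r)" by (simp add: cis_multiple_2pi)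
  ultimately have "\<bar>Re (cis (2 * pi * r) - 1)\<bar> < 1 - cos (2 * pi * e')"
    using abs_Re_le_cmod le_less_trans by metis
  hence "\<bar>cos (2 * pi * r) - 1\<bar> < 1 - cos (2 * pi * e')" by simp
  hence "cos (2 * pi * e') < cos (2 * pi * r)" by linarith
  also have "\<dots> = cos (2 * pi * \<bar>r\<bar>)" by (cases "r \<ge> 0") auto
  finally have "cos (2 * pi * e') < cos (2 * pi * \<bar>r\<bar>)" .
  hence "\<bar>r\<bar> < e'" using cos_monotone_0_pi_le[of "2 * pi * e'" "2 * pi * \<bar>r\<bar>"] r assms
    by (force simp: e'_def)
  thus "\<exists>n::int. \<bar>a - b - of_int n\<bar> < e" unfolding r_def e'_def by auto
qed

lemma torus_proj_close_imp_close:
  assumes "e > 0"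
  obtains d where "d > 0"
    "\<And>x y. dist (torus_proj x) (torus_proj y) < d \<Longrightarrow> \<exists>k\<in>int_vecs. norm (x - y - k) < e"
proof -
  obtain d where d: "d > 0" "\<And>a b. cmod (cis (2 * pi * a) - cis (2 * pi * b)) < d \<Longrightarrow>
      \<exists>n::int. \<bar>a - b - of_int n\<bar> < e / 2" using cis_close_imp_int_close[of "e / 2"] assms by auto
  show ?thesis
  proof (rule that[OF d(1)])
    fix x y assume xy: "dist (torus_proj x) (torus_proj y) < d"
    have "cmod (cis (2 * pi * fst x) - cis (2 * pi * fst y)) < d"
      "cmod (cis (2 * pi * snd x) - cis (2 * pi * snd y)) < d"
      using dist_fst_le[of "torus_proj x" "torus_proj y"] dist_snd_le[of "torus_proj x" "torus_proj y"] xy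
      by (auto simp: torus_proj_def dist_norm)
    then obtain p q :: int where pq: "\<bar>fst x - fst y - p\<bar> < e / 2" "\<bar>snd x - snd y - q\<bar> < e / 2"
      using d(2) by meson
    have "norm (x - y - (of_int p, of_int q)) < e"
      using norm_Pair_le[of "fst x - fst y - p" "snd x - snd y - q"] pq by (simp add: minus_prod_def)
    thus "\<exists>k\<in>int_vecs. norm (x - y - k) < e" by blast
  qed
qed

lemma torus_proj_eqD:
  assumes "torus_proj x = torus_proj y"
  shows "x - y \<in> int_vecs"
proof -
  have "\<exists>n::int. a - b = of_int n" if "cis (2 * pi * a) = cis (2 * pi * b)" for a b
  proof -
    have "sin (2 * pi * a) = sin (2 * pi * b) \<and> cos (2 * pi * a) = cos (2 * pi * b)"
      using that by (auto simp: complex_eq_iff)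
    then obtain n :: int where "2 * pi * a = 2 * pi * b + 2 * pi * of_int n" using sin_cos_eq_iff by metis
    hence "2 * pi * a = 2 * pi * (b + of_int n)" by (simp add: algebra_simps)
    hence "a = b + of_int n" by simp
    thus ?thesis by (intro exI[of _ n]) simp
  qed
  from this[of "fst x" "fst y"] this[of "snd x" "snd y"] assms
  obtain p q :: int where "fst x - fst y = of_int p" "snd x - snd y = of_int q"
    by (auto simp: torus_proj_def)
  hence "x - y = (of_int p, of_int q)" by (simp add: minus_prod_def)
  thus ?thesis by simp
qed

text \<open>A chord is at most its arc, which gives a factor \<open>2 * pi\<close> for each
  coordinate; the two coordinates add up to \<open>4 * pi\<close>.\<close>

lemma torus_proj_dist_le: "dist (torus_proj x) (torus_proj y) \<le> 4 * pi * norm (x - y)"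
proof -
  have cis: "cmod (cis a - cis b) \<le> \<bar>a - b\<bar>" for a b
  proof -
    have "cis a - cis b = cis b * (cis (a - b) - 1)" by (simp add: algebra_simps cis_mult)
    hence "cmod (cis a - cis b) = cmod (cis (a - b) - 1)" by (simp add: norm_mult)
    also have "\<dots> = 2 * \<bar>sin ((a - b) / 2)\<bar>"
    proof (rule power2_eq_imp_eq)
      have "cos (a - b) = 1 - 2 * (sin ((a - b) / 2))\<^sup>2" using cos_double_sin[of "(a - b) / 2"] by (simp only: mult_2 field_sum_of_halves)
      moreover have "(cmod (cis (a - b) - 1))\<^sup>2 = 2 - 2 * cos (a - b)"
        using sin_cos_squared_add[of "a - b"] by (simp add: cmod_power2 power2_diff algebra_simps)
      ultimately show "(cmod (cis (a - b) - 1))\<^sup>2 = (2 * \<bar>sin ((a - b) / 2)\<bar>)\<^sup>2"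
        by (simp add: power_mult_distrib)
    qed auto
    also have "\<dots> \<le> \<bar>a - b\<bar>" using abs_sin_x_le_abs_x[of "(a - b) / 2"] by simp
    finally show ?thesis .
  qed
  have "dist (torus_proj x) (torus_proj y)
      \<le> cmod (cis (2 * pi * fst x) - cis (2 * pi * fst y)) + cmod (cis (2 * pi * snd x) - cis (2 * pi * snd y))"
    using norm_Pair_le[of "cis (2 * pi * fst x) - cis (2 * pi * fst y)" "cis (2 * pi * snd x) - cis (2 * pi * snd y)"]
    by (simp add: torus_proj_def dist_norm)
  also have "\<dots> \<le> \<bar>2 * pi * fst x - 2 * pi * fst y\<bar> + \<bar>2 * pi * snd x - 2 * pi * snd y\<bar>"
    by (intro add_mono cis)
  also have "\<dots> = 2 * pi * (\<bar>fst (x - y)\<bar> + \<bar>snd (x - y)\<bar>)"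
  proof -
    have "\<bar>2 * pi * a - 2 * pi * b\<bar> = 2 * pi * \<bar>a - b\<bar>" for a b
      by (metis abs_mult abs_of_pos mult_pos_pos pi_gt_zero right_diff_distrib zero_less_numeral)
    thus ?thesis by (simp add: distrib_left)
  qed
  also have "\<dots> \<le> 2 * pi * (norm (x - y) + norm (x - y))"
    by (intro mult_left_mono add_mono abs_fst_le abs_snd_le) auto
  finally show ?thesis by simp
qed

lemma continuous_on_torus_proj: "continuous_on S torus_proj"
  unfolding torus_proj_def by (intro continuous_intros)

lemma torus_eq_image_square: "torus = torus_proj ` cbox (0, 0) (1, 1)"
proof -
  have "torus_proj x \<in> torus_proj ` cbox (0, 0) (1, 1)" for x
  proof -
    obtain k where k: "k \<in> int_vecs" "x - k \<in> cbox (0, 0) (1, 1)" by (rule int_vecs_translate_into_square)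
    moreover have "torus_proj x = torus_proj (x - k)" using torus_proj_add_int_vec[OF k(1), of "x - k"] by simp
    ultimately show ?thesis by blast
  qed
  thus ?thesis by (auto simp: torus_def)
qed

lemma compact_torus: "compact torus"
  unfolding torus_eq_image_square by (intro compact_continuous_image continuous_on_torus_proj compact_cbox)

section \<open>The linear upper bound\<close>

context periodic_flow begin

definition nrm :: "real \<times> real \<Rightarrow> real \<times> real" where
  "nrm p = (- snd (V p) / norm (V p), fst (V p) / norm (V p))"

lemma nrm_orthogonal [simp]: "nrm p \<bullet> V p = 0"
  by (cases "V p") (simp add: nrm_def)

lemma norm_V_squared: "(norm (V p))\<^sup>2 = (fst (V p))\<^sup>2 + (snd (V p))\<^sup>2"
  by (cases "V p") (simp add: norm_Pair)

lemma norm_nrm [simp]: "norm (nrm p) = 1"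
proof -
  have "(- snd (V p) / norm (V p))\<^sup>2 + (fst (V p) / norm (V p))\<^sup>2 = (norm (V p))\<^sup>2 / (norm (V p))\<^sup>2"
    unfolding power_divide power2_minus norm_V_squared add_divide_distrib[symmetric] by (simp only: add.commute)
  also have "\<dots> = 1" by simp
  finally show ?thesis unfolding nrm_def norm_Pair real_norm_def power2_abs by simp
qed

lemma orthogonal_eq_nrm:
  assumes "w \<bullet> V p = 0"
  shows "w = (w \<bullet> nrm p) *\<^sub>R nrm p"
proof -
  define N a b x y where defs: "N = norm (V p)" "a = fst (V p)" "b = snd (V p)" "x = fst w" "y = snd w"
  have N: "N \<noteq> 0" "N\<^sup>2 = a\<^sup>2 + b\<^sup>2" using norm_V_squared[of p] by (auto simp: defs)
  have w: "x * a + y * b = 0" using assms by (cases w; cases "V p") (simp add: defs)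
  have "N\<^sup>2 * x = (y * a - x * b) * (- b)" "N\<^sup>2 * y = (y * a - x * b) * a"
    using w unfolding N(2) by algebra+
  hence "x = (y * a - x * b) / N * (- b / N)" "y = (y * a - x * b) / N * (a / N)"
    using N(1) unfolding times_divide_times_eq power2_eq_square[symmetric]
    by (simp_all only: nonzero_eq_divide_eq[OF power_not_zero[OF N(1)]] mult.commute[of "N\<^sup>2"])
  moreover have "w \<bullet> nrm p = (y * a - x * b) / N"
    by (simp add: nrm_def inner_prod_def defs diff_divide_distrib)
  ultimately show ?thesis by (intro prod_eqI) (simp_all add: nrm_def defs[symmetric])
qed

text \<open>The transverse coordinate in the flow box at \<open>p\<close>: the signed position at
  which the orbit of \<open>z\<close> crosses the section.\<close>

definition crd :: "real \<times> real \<Rightarrow> real \<times> real \<Rightarrow> real" where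
  "crd p z = (foot p z - p) \<bullet> nrm p"

lemma foot_eq: "norm (z - p) \<le> rad \<Longrightarrow> foot p z = p + crd p z *\<^sub>R nrm p"
  using orthogonal_eq_nrm[OF foot_orthogonal[of z p]] by (simp add: crd_def algebra_simps)

lemma abs_crd_le:
  assumes "norm (z - p) \<le> rad"
  shows "\<bar>crd p z\<bar> \<le> slant * norm (z - p)"
  using Cauchy_Schwarz_ineq2[of "foot p z - p" "nrm p"] foot_dist[OF assms] by (simp add: crd_def)

section \<open>Synchronisation and time lag of neighbouring orbits\<close>

lemma dist_foot:
  assumes "norm (z - p) \<le> rad" "norm (z' - p) \<le> rad"
  shows "norm (foot p z - foot p z') = \<bar>crd p z - crd p z'\<bar>"
  unfolding foot_eq[OF assms(1)] foot_eq[OF assms(2)]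
  by (simp add: scaleR_diff_left[symmetric] del: scaleR_diff_left)

text \<open>Delaying the second orbit by the difference of hitting times makes the two points level.
  Both then come from their feet by flowing for the same short time, so only the transverse distance
  remains.\<close>

lemma synchronise:
  assumes "norm (z - p) \<le> rad" "norm (z' - p) \<le> rad"
  shows "\<bar>hit p z' - hit p z\<bar> \<le> t1"
    and "norm (\<Phi> (hit p z' - hit p z) z' - z) \<le> exp (L * t0) * \<bar>crd p z' - crd p z\<bar>"
proof -
  show "\<bar>hit p z' - hit p z\<bar> \<le> t1"
    using hit_abs_le[OF assms(1)] hit_abs_le[OF assms(2)] t0_pos by (simp add: t0_def)
  have "\<Phi> (hit p z' - hit p z) z' = \<Phi> (- hit p z) (foot p z')"
    unfolding foot_def by (simp add: flow_add[symmetric])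
  moreover have "z = \<Phi> (- hit p z) (foot p z)" by (simp add: foot_def)
  ultimately have "norm (\<Phi> (hit p z' - hit p z) z' - z)
      = norm (\<Phi> (- hit p z) (foot p z') - \<Phi> (- hit p z) (foot p z))" by metis
  also have "\<dots> \<le> exp (L * t0) * norm (foot p z' - foot p z)"
    using hit_abs_le[OF assms(1)] by (intro flow_lipschitz_le) auto
  finally show "norm (\<Phi> (hit p z' - hit p z) z' - z) \<le> exp (L * t0) * \<bar>crd p z' - crd p z\<bar>"
    using dist_foot[OF assms(2,1)] by simp
qed

text \<open>Here \<open>\<rho> k\<close> is the lag that synchronises the two orbits at time
  \<open>k\<close>, and \<open>w k\<close> their transverse width. In one unit of time, synchronised
  points separate at most by the factor \<open>exp L\<close>, so consecutive lags differ by a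
  multiple of \<open>w k\<close> and \<open>w (Suc k)\<close>; summing gives the bound. The start
  has a small lag because both points lie on one section.\<close>

lemma drift_offset:
  fixes \<rho> w :: "nat \<Rightarrow> real"
  assumes z: "norm (z' - p) \<le> rad" "(z - p) \<bullet> V p = 0" "(z' - p) \<bullet> V p = 0"
    and \<rho>: "\<And>k. k \<le> N \<Longrightarrow> \<bar>\<rho> k\<bar> \<le> t1"
    and w: "\<And>k. k \<le> N \<Longrightarrow> norm (\<Phi> (\<rho> k) (\<Phi> k z') - \<Phi> k z) \<le> C * w k"
    and w0: "\<And>k. k \<le> N \<Longrightarrow> 0 \<le> w k" and C: "0 \<le> C"
    and "k \<le> N"
  shows "\<bar>\<rho> k\<bar> \<le> 2 / m * C * ((1 + exp L) * (\<Sum>i<k. w i) + w k)" using \<open>k \<le> N\<close>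
proof (induction k)
  case 0
  have "\<bar>\<rho> 0\<bar> \<le> 2 / m * norm (\<Phi> (\<rho> 0) z' - z)"
    using time_le_dist[of z' p 0 "\<rho> 0" z] \<rho>[of 0] z rad_le t1_pos by (simp add: inner_diff_left)
  also have "\<dots> \<le> 2 / m * (C * w 0)" using w[of 0] m_pos by (intro mult_left_mono) auto
  finally show ?case by simp
next
  case (Suc k)
  let ?q = "\<Phi> (Suc k) z'"
  have step: "\<Phi> (Suc k) x = \<Phi> 1 (\<Phi> k x)" for x by (simp add: flow_add[symmetric])
  have "\<Phi> (\<rho> k) ?q = \<Phi> 1 (\<Phi> (\<rho> k) (\<Phi> k z'))" by (simp add: flow_add[symmetric] add_ac)
  hence "norm (\<Phi> (\<rho> k) ?q - \<Phi> (Suc k) z) \<le> exp (L * 1) * norm (\<Phi> (\<rho> k) (\<Phi> k z') - \<Phi> k z)"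
    unfolding step using flow_lipschitz_le[of 1 1] by simp
  also have "\<dots> \<le> exp L * (C * w k)" using w[of k] Suc.prems by simp
  finally have "norm (\<Phi> (\<rho> (Suc k)) ?q - \<Phi> (\<rho> k) ?q) \<le> C * w (Suc k) + exp L * (C * w k)"
    using w[of "Suc k"] Suc.prems
      norm_triangle_ineq4[of "\<Phi> (\<rho> (Suc k)) ?q - \<Phi> (Suc k) z" "\<Phi> (\<rho> k) ?q - \<Phi> (Suc k) z"] by simp
  moreover have "\<bar>\<rho> (Suc k) - \<rho> k\<bar> \<le> 2 / m * norm (\<Phi> (\<rho> (Suc k)) ?q - \<Phi> (\<rho> k) ?q)"
    using \<rho>[of k] \<rho>[of "Suc k"] Suc.prems tube_pos by (intro time_le_dist[of ?q ?q]) auto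
  ultimately have "\<bar>\<rho> (Suc k) - \<rho> k\<bar> \<le> 2 / m * (C * w (Suc k) + exp L * (C * w k))"
    using m_pos by (meson divide_nonneg_pos mult_left_mono order_trans zero_le_numeral)
  hence "\<bar>\<rho> (Suc k)\<bar> \<le> 2 / m * C * ((1 + exp L) * (\<Sum>i<k. w i) + w k) + 2 / m * (C * w (Suc k) + exp L * (C * w k))"
    using Suc.IH Suc.prems by linarith
  also have "\<dots> = 2 / m * C * ((1 + exp L) * (\<Sum>i<Suc k. w i) + w (Suc k))" by (simp add: algebra_simps)
  finally show ?case .
qed

text \<open>The true distance is at most the distance after synchronisation plus the path travelled
  during the lag, and both are controlled by the accumulated width. Read backwards: orbits that
  reach distance \<open>e\<close> must have accumulated width proportional to
  \<open>e\<close>.\<close>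

lemma drift:
  fixes \<rho> w :: "nat \<Rightarrow> real"
  assumes z: "norm (z' - p) \<le> rad" "(z - p) \<bullet> V p = 0" "(z' - p) \<bullet> V p = 0"
    and \<rho>: "\<And>k. k \<le> N \<Longrightarrow> \<bar>\<rho> k\<bar> \<le> t1"
    and w: "\<And>k. k \<le> N \<Longrightarrow> norm (\<Phi> (\<rho> k) (\<Phi> k z') - \<Phi> k z) \<le> C * w k"
    and w0: "\<And>k. k \<le> N \<Longrightarrow> 0 \<le> w k" and C: "0 \<le> C"
    and s: "0 \<le> s" "s \<le> real N + 1"
  shows "norm (\<Phi> s z' - \<Phi> s z) \<le> exp L * (C * (1 + 2 * M / m * (1 + exp L)) * (\<Sum>i\<le>N. w i))"
proof -
  obtain k where k: "k \<le> N" "real k \<le> s" "s \<le> real k + 1"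
  proof
    \<comment> \<open>The minimum matters at \<open>s = real N + 1\<close>, where the floor would
      exceed \<open>N\<close>.\<close>
    show "min N (nat \<lfloor>s\<rfloor>) \<le> N" by simp
    show "real (min N (nat \<lfloor>s\<rfloor>)) \<le> s" "s \<le> real (min N (nat \<lfloor>s\<rfloor>)) + 1" using s by linarith+
  qed
  have S: "(\<Sum>i<k. w i) + w k \<le> (\<Sum>i\<le>N. w i)"
  proof -
    have "(\<Sum>i<k. w i) + w k = (\<Sum>i\<le>k. w i)" by (simp add: lessThan_Suc_atMost[symmetric])
    also have "\<dots> \<le> (\<Sum>i\<le>N. w i)" using w0 k(1) by (intro sum_mono2) auto
    finally show ?thesis .
  qed
  have S0: "0 \<le> (\<Sum>i<k. w i)" using w0 k(1) by (intro sum_nonneg) auto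
  have w_le: "w k \<le> (\<Sum>i\<le>N. w i)" using S S0 by linarith
  have "(1 + exp L) * (\<Sum>i<k. w i) + w k \<le> (1 + exp L) * ((\<Sum>i<k. w i) + w k)"
    using w0[OF k(1)] by (simp add: distrib_left distrib_right)
  also have "\<dots> \<le> (1 + exp L) * (\<Sum>i\<le>N. w i)" by (intro mult_left_mono S) (simp add: add_nonneg_nonneg)
  finally have "2 / m * C * ((1 + exp L) * (\<Sum>i<k. w i) + w k) \<le> 2 / m * C * ((1 + exp L) * (\<Sum>i\<le>N. w i))"
    using m_pos C by (intro mult_left_mono) auto
  hence rho_le: "\<bar>\<rho> k\<bar> \<le> 2 / m * C * ((1 + exp L) * (\<Sum>i\<le>N. w i))"
    using drift_offset[OF z \<rho> w w0 C k(1)] by linarith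
  have "norm (\<Phi> k z' - \<Phi> k z) \<le> norm (\<Phi> (\<rho> k) (\<Phi> k z') - \<Phi> k z') + norm (\<Phi> (\<rho> k) (\<Phi> k z') - \<Phi> k z)"
    using norm_triangle_ineq4[of "\<Phi> (\<rho> k) (\<Phi> k z') - \<Phi> k z" "\<Phi> (\<rho> k) (\<Phi> k z') - \<Phi> k z'"] by simp
  also have "\<dots> \<le> M * \<bar>\<rho> k\<bar> + C * w k" using flow_speed_0 w[OF k(1)] by (intro add_mono) auto
  also have "\<dots> \<le> M * (2 / m * C * ((1 + exp L) * (\<Sum>i\<le>N. w i))) + C * (\<Sum>i\<le>N. w i)"
    using M_pos C rho_le w_le by (intro add_mono mult_left_mono) auto
  also have "\<dots> = C * (1 + 2 * M / m * (1 + exp L)) * (\<Sum>i\<le>N. w i)"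
    by (simp add: algebra_simps add_divide_distrib)
  finally have le: "norm (\<Phi> k z' - \<Phi> k z) \<le> C * (1 + 2 * M / m * (1 + exp L)) * (\<Sum>i\<le>N. w i)" .
  have "\<Phi> s x = \<Phi> (s - k) (\<Phi> k x)" for x by (simp add: flow_add[symmetric])
  hence "norm (\<Phi> s z' - \<Phi> s z) \<le> exp (L * 1) * norm (\<Phi> k z' - \<Phi> k z)"
    using flow_lipschitz_le[of "s - k" 1 "\<Phi> k z'" "\<Phi> k z"] k by simp
  also have "\<dots> \<le> exp L * (C * (1 + 2 * M / m * (1 + exp L)) * (\<Sum>i\<le>N. w i))" using le by simp
  finally show ?thesis .
qed

section \<open>Greedy subdivision of a transverse section\<close>

definition sec :: "real \<times> real \<Rightarrow> real \<Rightarrow> real \<times> real" where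
  "sec p u = p + u *\<^sub>R nrm p"

lemma sec_orthogonal [simp]: "(sec p u - p) \<bullet> V p = 0"
  and sec_dist [simp]: "norm (sec p u - p) = \<bar>u\<bar>"
  by (simp_all add: sec_def)

lemma sec_inj: "sec p u = sec p u' \<longleftrightarrow> u = u'"
  unfolding sec_def by (metis add_left_cancel norm_nrm norm_zero scaleR_cancel_right zero_neq_one)

lemma dist_sec: "norm (sec p u - sec p u') = \<bar>u - u'\<bar>"
  by (simp add: sec_def scaleR_diff_left[symmetric] del: scaleR_diff_left)

lemma sec_continuous [continuous_intros]:
  "continuous_on S f \<Longrightarrow> continuous_on S (\<lambda>u. sec p (f u))" unfolding sec_def by (intro continuous_intros)



abbreviation sdist :: "real \<times> real \<Rightarrow> real \<Rightarrow> real \<Rightarrow> real \<Rightarrow> real" where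
  "sdist p s u v \<equiv> norm (\<Phi> s (sec p v) - \<Phi> s (sec p u))"

text \<open>One piece of the greedy subdivision. The upper bound keeps the whole piece inside flow
  boxes and makes its left end a good centre for it; the attained lower bound makes the piece
  expensive in accumulated width, which limits the number of pieces.\<close>

definition full_step :: "real \<times> real \<Rightarrow> real \<Rightarrow> real \<Rightarrow> real \<Rightarrow> real \<Rightarrow> bool" where
  "full_step p t e a b \<longleftrightarrow> a < b \<and>
     (\<forall>u\<in>{a..b}. \<forall>s\<in>{0..t}. sdist p s a u \<le> e) \<and>
     (\<exists>s\<in>{0..t}. e \<le> sdist p s a b)"

definition chain :: "real \<times> real \<Rightarrow> real \<Rightarrow> real \<Rightarrow> nat \<Rightarrow> (nat \<Rightarrow> real) \<Rightarrow> bool" where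
  "chain p t e n u \<longleftrightarrow> u 0 = - rad \<and> u n \<le> rad \<and> (\<forall>j<n. full_step p t e (u j) (u (Suc j)))"

lemma chain_mono:
  assumes "chain p t e n u" "i \<le> j" "j \<le> n"
  shows "u i \<le> u j" using assms(2,3)
proof (induction j rule: dec_induct)
  case (step j)
  thus ?case using assms(1) by (auto simp: chain_def full_step_def dest!: spec[of _ j])
qed auto

lemma chain_range:
  assumes "chain p t e n u" "i \<le> n"
  shows "\<bar>u i\<bar> \<le> rad" using chain_mono[OF assms(1), of 0 i] chain_mono[OF assms(1), of i n] assms
  by (auto simp: chain_def)

text \<open>The next division point is the least parameter that reaches distance \<open>e\<close> at
  some time in \<open>{0..t}\<close>. It exists because the set \<open>E\<close> of such pairs of
  parameter and time is compact.\<close>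

lemma chain_extend:
  assumes c: "chain p t e n u" and t: "0 \<le> t" and e: "0 < e"
    and nt: "\<not> (\<forall>v\<in>{u n..rad}. \<forall>s\<in>{0..t}. sdist p s (u n) v < e)"
  obtains b where "chain p t e (Suc n) (u(Suc n := b))"
proof -
  define d where "d v s = sdist p s (u n) v" for v s
  define E where "E = ({u n..rad} \<times> {0..t}) \<inter> (\<lambda>x. d (fst x) (snd x)) -` {e..}"
  have cont: "continuous_on S (\<lambda>x. d (f x) (g x))"
    if "continuous_on S f" "continuous_on S g" for S :: "'b::topological_space set" and f g
    unfolding d_def by (intro continuous_intros that)
  have "closed E" unfolding E_def by (intro continuous_closed_preimage cont continuous_intros closed_Times)
  hence "compact (({u n..rad} \<times> {0..t}) \<inter> E)" by (intro compact_Int_closed compact_Times compact_Icc)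
  hence "compact E" by (simp add: E_def inf.absorb2)
  moreover have "E \<noteq> {}" using nt by (force simp: E_def d_def)
  ultimately obtain x where x: "x \<in> E" "\<And>y. y \<in> E \<Longrightarrow> fst x \<le> fst y"
    using continuous_attains_inf[of E fst] continuous_on_fst[OF continuous_on_id, of E] by blast
  define b where "b = fst x"
  have b: "u n \<le> b" "b \<le> rad" "snd x \<in> {0..t}" "e \<le> d b (snd x)" using x(1) by (auto simp: E_def b_def)
  have "b \<noteq> u n" using b(4) e by (auto simp: d_def)
  have lt: "d v s < e" if "u n \<le> v" "v < b" "s \<in> {0..t}" for v s
    using x(2)[of "(v, s)"] that b by (force simp: E_def b_def)
  \<comment> \<open>At \<open>b\<close> itself the distance could exceed \<open>e\<close> at some
    time; but then the intermediate value theorem would give a parameter below \<open>b\<close> at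
    distance exactly \<open>e\<close>.\<close>
  have le: "d v s \<le> e" if vs: "v \<in> {u n..b}" "s \<in> {0..t}" for v s
  proof (rule ccontr)
    assume "\<not> d v s \<le> e"
    moreover have "d (u n) s = 0" by (simp add: d_def)
    moreover have "continuous_on {u n..v} (\<lambda>v. d v s)" by (intro cont continuous_intros)
    ultimately obtain v' where "u n \<le> v'" "v' \<le> v" "d v' s = e"
      using IVT'[of "\<lambda>v. d v s" "u n" e v] vs e by auto
    thus False using lt[of v' s] vs \<open>\<not> d v s \<le> e\<close> by (cases "v' = v") auto
  qed
  have "full_step p t e (u n) b" unfolding full_step_def using b le \<open>b \<noteq> u n\<close> by (auto simp: d_def)
  hence "chain p t e (Suc n) (u(Suc n := b))" using c b by (auto simp: chain_def less_Suc_eq)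
  thus ?thesis by (rule that)
qed

lemma finite_boxes:
  assumes "r > 0"
  obtains P where "finite P" "\<And>x. \<exists>p\<in>P. \<exists>k\<in>int_vecs. norm (x - k - p) \<le> r"
proof -
  have "compact (cbox (0, 0) (1, 1) :: (real \<times> real) set)" by (rule compact_cbox)
  then obtain P where P: "finite P" "(cbox (0, 0) (1, 1) :: (real \<times> real) set) \<subseteq> (\<Union>p\<in>P. ball p r)"
    using assms unfolding compact_eq_totally_bounded by meson
  have "\<exists>p\<in>P. \<exists>k\<in>int_vecs. norm (x - k - p) \<le> r" for x
  proof -
    obtain k where k: "k \<in> int_vecs" "x - k \<in> cbox (0, 0) (1, 1)" by (rule int_vecs_translate_into_square)
    then obtain p where "p \<in> P" "x - k \<in> ball p r" using P(2) by auto
    thus ?thesis using k(1) by (intro bexI[of _ p] bexI[of _ k]) (auto simp: dist_norm norm_minus_commute)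
  qed
  thus ?thesis using that P(1) by blast
qed

lemma sum_disjoint_intervals:
  fixes a b :: "'i \<Rightarrow> real"
  assumes J: "finite J" and B: "\<And>j. j \<in> J \<Longrightarrow> \<bar>a j\<bar> \<le> B \<and> \<bar>b j\<bar> \<le> B" "0 \<le> B"
    and disj: "disjoint_family_on (\<lambda>j. {min (a j) (b j) <..< max (a j) (b j)}) J"
  shows "(\<Sum>j\<in>J. \<bar>b j - a j\<bar>) \<le> 2 * B"
proof -
  define I where "I j = {min (a j) (b j) <..< max (a j) (b j)}" for j
  have "(\<Sum>j\<in>J. \<bar>b j - a j\<bar>) = (\<Sum>j\<in>J. measure lborel (I j))"
    by (intro sum.cong) (auto simp: I_def min_def max_def)
  also have "\<dots> = measure lborel (\<Union>j\<in>J. I j)"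
    unfolding I_def by (intro measure_finite_Union[symmetric] J disj) auto
  also have "\<dots> \<le> measure lborel {-B..B}"
  proof (rule measure_mono_fmeasurable)
    show "(\<Union>j\<in>J. I j) \<subseteq> {-B..B}" using B by (fastforce simp: I_def)
    show "(\<Union>j\<in>J. I j) \<in> sets lborel" by (intro sets.finite_UN J) (simp add: I_def)
    show "{-B..B} \<in> fmeasurable lborel" using B(2) by (intro fmeasurableI) auto
  qed
  also have "\<dots> = 2 * B" using B(2) by simp
  finally show ?thesis .
qed

text \<open>If two pieces crossed the box at the same point, flowing back by \<open>k\<close> would
  put two distinct points of the initial section, up to a translation, on one orbit at most
  \<open>t1\<close> apart, which \<open>same_orbit_on_section\<close> forbids. Disjoint crossings
  inside an interval of radius \<open>slant * rad\<close> have bounded total length.\<close>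

lemma chain_crossing_le:
  fixes k :: nat
  assumes e: "e \<le> rad / 2" and c: "chain p0 t e n u" and k: "real k \<le> t"
    and b: "\<And>j. norm (\<Phi> k (sec p0 (u j)) - l j - b j) \<le> rad / 2"
    and l: "\<And>j. l j \<in> int_vecs"
    and J: "J \<subseteq> {..<n}" "\<And>j. j \<in> J \<Longrightarrow> b j = p"
  defines "q \<equiv> \<lambda>j v. \<Phi> k (sec p0 v) - l j"
  shows "(\<Sum>j\<in>J. \<bar>crd p (q j (u (Suc j))) - crd p (q j (u j))\<bar>) \<le> 2 * (slant * rad)"
proof (rule sum_disjoint_intervals)
  \<comment> \<open>Half of \<open>rad\<close> is spent on the left end of the piece, the other half
    on the extent \<open>e\<close> of the piece.\<close>
  have near: "norm (q j v - p) \<le> rad" if "j \<in> J" "v \<in> {u j..u (Suc j)}" for j v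
  proof -
    have "norm (\<Phi> k (sec p0 v) - \<Phi> k (sec p0 (u j))) \<le> e"
      using c that J(1) k by (auto simp: chain_def full_step_def)
    thus ?thesis using b[of j] J(2)[OF that(1)] e
        norm_triangle_ineq[of "\<Phi> k (sec p0 v) - \<Phi> k (sec p0 (u j))" "\<Phi> k (sec p0 (u j)) - l j - b j"]
      by (simp add: q_def algebra_simps)
  qed
  have mono: "u j < u (Suc j)" if "j \<in> J" for j using c that J(1) by (auto simp: chain_def full_step_def)
  show "finite J" using J(1) finite_subset by blast
  show "0 \<le> slant * rad" using M_pos m_pos rad_pos by simp
  have bound: "\<bar>crd p (q j v)\<bar> \<le> slant * rad" if "j \<in> J" "v \<in> {u j..u (Suc j)}" for j v
  proof -
    have "slant * norm (q j v - p) \<le> slant * rad"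
      using near[OF that] M_pos m_pos by (intro mult_left_mono) auto
    thus ?thesis using abs_crd_le[OF near[OF that]] by linarith
  qed
  show "\<bar>crd p (q j (u j))\<bar> \<le> slant * rad \<and> \<bar>crd p (q j (u (Suc j)))\<bar> \<le> slant * rad"
    if "j \<in> J" for j using bound[OF that] mono[OF that] by auto
  define I where "I j = {min (crd p (q j (u j))) (crd p (q j (u (Suc j)))) <..< max (crd p (q j (u j))) (crd p (q j (u (Suc j))))}" for j
  have ivt: "\<exists>v. u j < v \<and> v < u (Suc j) \<and> crd p (q j v) = x" if "j \<in> J" "x \<in> I j" for j x
  proof -
    have "continuous_on {u j..u (Suc j)} (\<lambda>v. crd p (q j v))" unfolding crd_def
      by (intro continuous_intros foot_continuous_on near[OF that(1)]) (auto simp: q_def intro!: continuous_intros)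
    hence "\<exists>v\<ge>u j. v \<le> u (Suc j) \<and> crd p (q j v) = x" using IVT'[of "\<lambda>v. crd p (q j v)" "u j" x "u (Suc j)"]
        IVT2'[of "\<lambda>v. crd p (q j v)" "u (Suc j)" x "u j"] mono[OF that(1)] that
      by (auto simp: I_def min_def max_def split: if_splits)
    then obtain v where "u j \<le> v" "v \<le> u (Suc j)" "crd p (q j v) = x" by blast
    moreover have "v \<noteq> u j" "v \<noteq> u (Suc j)" using calculation that by (auto simp: I_def min_def max_def split: if_splits)
    ultimately show ?thesis by (intro exI[of _ v]) auto
  qed
  have False if ij: "i \<in> J" "j \<in> J" "i \<noteq> j" "x \<in> I i" "x \<in> I j" for i j x
  proof -
    obtain v where v: "u i < v" "v < u (Suc i)" "crd p (q i v) = x" using ivt[OF ij(1,4)] by blast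
    obtain v' where v': "u j < v'" "v' < u (Suc j)" "crd p (q j v') = x" using ivt[OF ij(2,5)] by blast
    have ni: "norm (q i v - p) \<le> rad" "norm (q j v' - p) \<le> rad" using near ij v v' by auto
    define h where "h = hit p (q i v) - hit p (q j v')"
    have "norm (foot p (q i v) - foot p (q j v')) = 0" using dist_foot[OF ni] v v' by simp
    hence "\<Phi> (- hit p (q j v')) (foot p (q i v)) = \<Phi> (- hit p (q j v')) (foot p (q j v'))" by simp
    hence "\<Phi> h (q i v) = q j v'" by (simp add: foot_def flow_add[symmetric] h_def)
    hence "\<Phi> h (\<Phi> k (sec p0 v)) = \<Phi> k (sec p0 v') + (l i - l j)"
      by (simp add: q_def flow_translate_diff l algebra_simps)
    hence "\<Phi> (- real k) (\<Phi> h (\<Phi> k (sec p0 v))) = sec p0 v' + (l i - l j)"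
      using l int_vecs_diff by (simp add: flow_translate)
    hence "\<Phi> h (sec p0 v) = sec p0 v' + (l i - l j)" by (simp add: flow_add[symmetric])
    moreover have "\<bar>h\<bar> \<le> t1" using synchronise(1)[OF ni(2,1)] by (simp add: h_def)
    moreover have "\<bar>v\<bar> \<le> rad" "\<bar>v'\<bar> \<le> rad"
      using chain_range[OF c, of i] chain_range[OF c, of "Suc i"] chain_range[OF c, of j] chain_range[OF c, of "Suc j"]
        v v' ij(1,2) J(1) by (auto simp: subset_iff less_eq_Suc_le[symmetric] less_imp_le)
    ultimately have "sec p0 v' = sec p0 v"
      using same_orbit_on_section[of "sec p0 v" p0 "sec p0 v'" "l i - l j" h] l int_vecs_diff by auto
    hence "v = v'" by (simp add: sec_inj)
    moreover have "Suc i \<le> j \<or> Suc j \<le> i" using ij(3) by auto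
    hence "u (Suc i) \<le> u j \<or> u (Suc j) \<le> u i"
      using chain_mono[OF c] ij(1,2) J(1) by (auto simp: subset_iff less_imp_le)
    ultimately show False using v v' by linarith
  qed
  thus "disjoint_family_on (\<lambda>j. {min (crd p (q j (u j))) (crd p (q j (u (Suc j)))) <..<
      max (crd p (q j (u j))) (crd p (q j (u (Suc j))))}) J"
    unfolding I_def[symmetric] disjoint_family_on_def by blast
qed

text \<open>Double counting of widths over pieces and integer times: each piece contributes at least
  \<open>e / D\<close> in total, while each time contributes at most \<open>card P * B\<close>, and
  there are \<open>N + 1\<close> times.\<close>

lemma chain_length_le:
  assumes e: "0 < e" "e \<le> rad / 2"
  obtains K where "0 \<le> K" "\<And>p0 t n u. 1 \<le> t \<Longrightarrow> chain p0 t e n u \<Longrightarrow> real n \<le> K * t"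
proof -
  obtain P where P: "finite P" "\<And>x. \<exists>p\<in>P. \<exists>k\<in>int_vecs. norm (x - k - p) \<le> rad / 2"
    using finite_boxes[of "rad / 2"] rad_pos by auto
  define B where "B = 2 * (slant * rad)"
  define C0 where "C0 = exp (L * t0)"
  define D where "D = exp L * (C0 * (1 + 2 * M / m * (1 + exp L)))"
  have pos: "0 \<le> B" "0 \<le> D" using M_pos m_pos rad_pos by (auto simp: B_def D_def C0_def add_nonneg_nonneg)
  show ?thesis
  proof (rule that)
    show "0 \<le> 2 * (D * (card P * B)) / e" using pos e by simp
    fix p0 t n u assume t: "1 \<le> t" and c: "chain p0 t e n u"
    define N where "N = nat \<lfloor>t\<rfloor>"
    have N: "real N \<le> t" "t \<le> real N + 1" "real N + 1 \<le> 2 * t" using t by (auto simp: N_def) linarith+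
    have "\<forall>j k. \<exists>p\<in>P. \<exists>l\<in>int_vecs. norm (\<Phi> (real k) (sec p0 (u j)) - l - p) \<le> rad / 2" using P(2) by blast
    then obtain b l where b: "\<And>j k. b j k \<in> P" and l: "\<And>j k. l j k \<in> int_vecs"
      and near: "\<And>j k. norm (\<Phi> (real k) (sec p0 (u j)) - l j k - b j k) \<le> rad / 2"
      by metis
    define q where "q j k i = \<Phi> (real k) (sec p0 (u i)) - l j k" for j k i
    define w where "w j k = \<bar>crd (b j k) (q j k (Suc j)) - crd (b j k) (q j k j)\<bar>" for j k
    have w_sum: "(\<Sum>j<n. w j k) \<le> card P * B" if "k \<le> N" for k
    proof -
      \<comment> \<open>The pieces are sorted by the flow box in which their left end lies at time
        \<open>k\<close>, up to a translation.\<close>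
      have "(\<Sum>j<n. w j k) = (\<Sum>p\<in>P. \<Sum>j | j \<in> {..<n} \<and> b j k = p. w j k)"
        using P(1) b by (intro sum.group[symmetric]) auto
      also have "\<dots> \<le> (\<Sum>p\<in>P. B)"
      proof (rule sum_mono)
        fix p assume "p \<in> P"
        have "(\<Sum>j | j \<in> {..<n} \<and> b j k = p. w j k)
            = (\<Sum>j | j \<in> {..<n} \<and> b j k = p. \<bar>crd p (q j k (Suc j)) - crd p (q j k j)\<bar>)"
          by (intro sum.cong) (auto simp: w_def)
        also have "\<dots> \<le> B" unfolding B_def q_def
          by (rule chain_crossing_le[where b = "\<lambda>j. b j k" and n = n and t = t and e = e])
             (use e c near l that N in \<open>auto simp: q_def\<close>)
        finally show "(\<Sum>j | j \<in> {..<n} \<and> b j k = p. w j k) \<le> B" .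
      qed
      finally show ?thesis by simp
    qed
    have w_ge: "e \<le> D * (\<Sum>k\<le>N. w j k)" if j: "j < n" for j
    proof -
      have fs: "full_step p0 t e (u j) (u (Suc j))" using c j by (simp add: chain_def)
      then obtain s where s: "s \<in> {0..t}" "e \<le> sdist p0 s (u j) (u (Suc j))" by (auto simp: full_step_def)
      define \<rho> where "\<rho> k = hit (b j k) (q j k (Suc j)) - hit (b j k) (q j k j)" for k
      have q: "norm (q j k j - b j k) \<le> rad" "norm (q j k (Suc j) - b j k) \<le> rad" if "k \<le> N" for k
      proof -
        show "norm (q j k j - b j k) \<le> rad" using near[of k j] rad_pos by (simp add: q_def)
        have "norm (\<Phi> (real k) (sec p0 (u (Suc j))) - \<Phi> (real k) (sec p0 (u j))) \<le> e"
          using fs that N by (auto simp: full_step_def)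
        thus "norm (q j k (Suc j) - b j k) \<le> rad"
          using near[of k j] e norm_triangle_ineq[of "q j k (Suc j) - q j k j" "q j k j - b j k"]
          by (simp add: q_def algebra_simps)
      qed
      have "sdist p0 s (u j) (u (Suc j))
          \<le> exp L * (C0 * (1 + 2 * M / m * (1 + exp L)) * (\<Sum>k\<le>N. w j k))"
      proof (rule drift[where p = p0 and \<rho> = \<rho>])
        show "norm (sec p0 (u (Suc j)) - p0) \<le> rad" using chain_range[OF c, of "Suc j"] j by simp
        fix k assume k: "k \<le> N"
        show "\<bar>\<rho> k\<bar> \<le> t1" using synchronise(1)[OF q[OF k]] by (simp add: \<rho>_def)
        show "0 \<le> w j k" by (simp add: w_def)
        have "\<Phi> (\<rho> k) (q j k (Suc j)) - q j k j
            = \<Phi> (\<rho> k) (\<Phi> k (sec p0 (u (Suc j)))) - \<Phi> k (sec p0 (u j))"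
          by (simp add: q_def flow_translate_diff l)
        thus "norm (\<Phi> (\<rho> k) (\<Phi> k (sec p0 (u (Suc j)))) - \<Phi> k (sec p0 (u j))) \<le> C0 * w j k"
          using synchronise(2)[OF q[OF k]] by (simp add: \<rho>_def w_def C0_def)
      qed (use s N in \<open>auto simp: C0_def\<close>)
      thus ?thesis using s(2) by (simp add: D_def mult.assoc)
    qed
    have "real n * e = (\<Sum>j<n. e)" by simp
    also have "\<dots> \<le> (\<Sum>j<n. D * (\<Sum>k\<le>N. w j k))" using w_ge by (intro sum_mono) auto
    also have "\<dots> = D * (\<Sum>k\<le>N. \<Sum>j<n. w j k)" by (subst sum.swap) (simp add: sum_distrib_left)
    also have "\<dots> \<le> D * (\<Sum>k\<le>N. card P * B)" using pos w_sum by (intro mult_left_mono sum_mono) auto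
    also have "\<dots> = D * (card P * B) * (real N + 1)" by simp
    also have "\<dots> \<le> D * (card P * B) * (2 * t)" using pos N by (intro mult_left_mono) auto
    finally show "real n \<le> 2 * (D * (card P * B)) / e * t" using e by (simp add: field_simps)
  qed
qed

lemma chain_covers:
  assumes "chain p t e n u" "v \<in> {- rad..u n}" "s \<in> {0..t}" "0 < e"
  shows "\<exists>j\<le>n. \<forall>s\<in>{0..t}. sdist p s (u j) v \<le> e" using assms(1,2)
proof (induction n)
  case 0
  hence "v = u 0" by (auto simp: chain_def)
  thus ?case using assms(4) by (intro exI[of _ 0]) auto
next
  case (Suc n)
  have fs: "full_step p t e (u n) (u (Suc n))" using Suc.prems(1) by (simp add: chain_def)
  show ?case
  proof (cases "v \<le> u n")
    case True
    have "chain p t e n u" using Suc.prems(1) fs by (auto simp: chain_def full_step_def)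
    from Suc.IH[OF this] True Suc.prems(2) show ?thesis by (auto intro: le_SucI)
  next
    case False
    thus ?thesis using fs Suc.prems(2) by (intro exI[of _ n]) (auto simp: full_step_def)
  qed
qed

abbreviation section_net :: "real \<times> real \<Rightarrow> real \<Rightarrow> real \<Rightarrow> real set \<Rightarrow> bool" where
  "section_net p t e U \<equiv> \<forall>v. \<bar>v\<bar> \<le> rad \<longrightarrow> (\<exists>u\<in>U. \<forall>s\<in>{0..t}. sdist p s u v \<le> e)"

text \<open>The length bound forces the greedy subdivision to stop, and it can stop only when its
  last point serves the rest of the section. A chain of \<open>n\<close> steps has
  \<open>n + 1\<close> points, whence the constant \<open>K + 1\<close>.\<close>

lemma section_cover:
  assumes "0 < e" "e \<le> rad / 2"
  obtains K where "0 \<le> K" "\<And>p t. 1 \<le> t \<Longrightarrow> \<exists>U. finite U \<and> real (card U) \<le> K * t \<and> section_net p t e U"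
proof -
  obtain K where K: "0 \<le> K" "\<And>p0 t n u. 1 \<le> t \<Longrightarrow> chain p0 t e n u \<Longrightarrow> real n \<le> K * t"
    using chain_length_le[OF assms] by metis
  show ?thesis
  proof (rule that)
    show "0 \<le> K + 1" using K by simp
    fix p and t :: real assume t: "1 \<le> t"
    let ?terminal = "\<lambda>a. \<forall>v\<in>{a..rad}. \<forall>s\<in>{0..t}. sdist p s a v < e"
    have "\<exists>n u. chain p t e n u \<and> ?terminal (u n)"
    proof (rule ccontr)
      assume no: "\<nexists>n u. chain p t e n u \<and> ?terminal (u n)"
      have "\<exists>u. chain p t e n u" for n
      proof (induction n)
        case 0
        show ?case using rad_pos by (intro exI[of _ "\<lambda>_. - rad"]) (auto simp: chain_def)
      next
        case (Suc n)
        then obtain u where u: "chain p t e n u" by blast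
        show ?case using chain_extend[OF u _ assms(1)] no u t by (metis order_trans zero_le_one)
      qed
      then obtain u where "chain p t e (nat \<lceil>K * t\<rceil> + 1) u" by blast
      hence "real (nat \<lceil>K * t\<rceil> + 1) \<le> K * t" using K(2)[OF t] by blast
      thus False by linarith
    qed
    then obtain n u where u: "chain p t e n u" "?terminal (u n)" by blast
    show "\<exists>U. finite U \<and> real (card U) \<le> (K + 1) * t \<and>
     section_net p t e U"
    proof (intro exI[of _ "u ` {..n}"] conjI allI impI)
      have "card (u ` {..n}) \<le> Suc n" by (metis card_atMost card_image_le finite_atMost)
      hence "real (card (u ` {..n})) \<le> real n + 1" by linarith
      also have "\<dots> \<le> K * t + t" using K(2)[OF t u(1)] t by linarith
      finally show "real (card (u ` {..n})) \<le> (K + 1) * t" by (simp add: algebra_simps)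
      fix v assume v: "\<bar>v\<bar> \<le> rad"
      show "\<exists>u\<in>u ` {..n}. \<forall>s\<in>{0..t}. sdist p s u v \<le> e"
      proof (cases "v \<le> u n")
        case True
        thus ?thesis using chain_covers[OF u(1), of v 0] v t assms(1) by fastforce
      next
        case False
        thus ?thesis using u(2) v by (intro bexI[of _ "u n"]) (auto intro: less_imp_le)
      qed
    qed simp
  qed
qed

text \<open>A point is determined, up to a translation, by a flow box, a position on its section and
  a bounded time. The box and a discretised time take finitely many values independent of
  \<open>t\<close>, so only the net on the section contributes growth. Half of the error is spent on
  the net, half on the time grid \<open>R\<close>.\<close>

lemma linear_plane_cover:
  assumes "0 < \<epsilon>"
  shows "\<exists>K. \<forall>t\<ge>1. \<exists>S. finite S \<and> real (card S) \<le> K * t \<and>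
     (\<forall>x. \<exists>y\<in>S. \<exists>k\<in>int_vecs. \<forall>s\<in>{0..t}. norm (\<Phi> s x - \<Phi> s y - k) \<le> \<epsilon>)"
proof -
  define e where "e = min (rad / 2) (\<epsilon> / (2 * exp (L * t0)))"
  have e: "0 < e" "e \<le> rad / 2" using rad_pos assms by (auto simp: e_def)
  have e_le: "exp (L * t0) * e \<le> \<epsilon> / 2"
  proof -
    have "exp (L * t0) * e \<le> exp (L * t0) * (\<epsilon> / (2 * exp (L * t0)))"
      by (intro mult_left_mono) (auto simp: e_def)
    thus ?thesis by simp
  qed
  obtain K where K: "0 \<le> K" "\<And>p t. 1 \<le> t \<Longrightarrow> \<exists>U. finite U \<and> real (card U) \<le> K * t \<and> section_net p t e U"
    using section_cover[OF e] by blast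
  \<comment> \<open>Boxes of this smaller radius have transverse coordinates within
    \<open>rad\<close>, where the net is available.\<close>
  define r where "r = rad / slant"
  have M: "slant > 0" "1 \<le> slant" using M_pos m_pos by (simp_all add: add_pos_pos)
  have r: "0 < r" "r \<le> rad" "slant * r = rad"
  proof -
    show "0 < r" "slant * r = rad" using M rad_pos by (auto simp: r_def)
    thus "r \<le> rad" using M(2) mult_right_mono[OF M(2), of r] by simp
  qed
  obtain P where P: "finite P" "\<And>x. \<exists>p\<in>P. \<exists>k\<in>int_vecs. norm (x - k - p) \<le> r"
    using finite_boxes[OF r(1)] by blast
  have "compact {-t0..t0}" by simp
  moreover have "\<epsilon> / (2 * M) > 0" using assms M_pos by simp
  ultimately obtain R where R: "finite R" "R \<subseteq> {-t0..t0}" "{-t0..t0} \<subseteq> (\<Union>x\<in>R. ball x (\<epsilon> / (2 * M)))"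
    using seq_compact_imp_totally_bounded[of "{-t0..t0}"] compact_imp_seq_compact by metis
  show ?thesis
  proof (intro exI[of _ "card P * card R * K"] allI impI)
    fix t :: real assume t: "1 \<le> t"
    have "\<forall>p. \<exists>U. finite U \<and> real (card U) \<le> K * t \<and> section_net p t e U" using K(2)[OF t] by blast
    then obtain U where U: "\<And>p. finite (U p)" "\<And>p. real (card (U p)) \<le> K * t"
      "\<And>p v. \<bar>v\<bar> \<le> rad \<Longrightarrow> \<exists>u\<in>U p. \<forall>s\<in>{0..t}. sdist p s u v \<le> e" by metis
    define I where "I = (SIGMA p:P. R \<times> U p)"
    define S where "S = (\<lambda>(p, \<tau>, u). \<Phi> \<tau> (sec p u)) ` I"
    have fin: "finite I" unfolding I_def using P(1) R(1) U(1) by auto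
    have "real (card S) \<le> real (card I)" unfolding S_def using card_image_le[OF fin] by simp
    also have "card I = (\<Sum>p\<in>P. card R * card (U p))"
      unfolding I_def using P(1) R(1) U(1) by (subst card_SigmaI) (auto simp: card_cartesian_product)
    also have "real \<dots> = (\<Sum>p\<in>P. real (card R) * real (card (U p)))" by simp
    also have "\<dots> \<le> (\<Sum>p\<in>P. real (card R) * (K * t))" using U(2) by (intro sum_mono mult_left_mono) auto
    also have "\<dots> = card P * card R * K * t" by simp
    finally have card: "real (card S) \<le> card P * card R * K * t" .
    have "\<exists>y\<in>S. \<exists>k\<in>int_vecs. \<forall>s\<in>{0..t}. norm (\<Phi> s x - \<Phi> s y - k) \<le> \<epsilon>" for x
    proof -
      obtain p l where p: "p \<in> P" "l \<in> int_vecs" "norm (x - l - p) \<le> r" using P(2) by blast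
      define z h v where "z = x - l" "h = hit p z" "v = crd p z"
      have z: "norm (z - p) \<le> rad" using p(3) r(2) by (simp add: z_h_v_def)
      have h: "\<bar>h\<bar> \<le> t0" using hit_abs_le[OF z] by (simp add: z_h_v_def)
      have "slant * norm (z - p) \<le> slant * r" using p(3) M by (intro mult_left_mono) (auto simp: z_h_v_def)
      hence "\<bar>v\<bar> \<le> rad" using abs_crd_le[OF z] r(3) by (simp add: z_h_v_def)
      then obtain u where u: "u \<in> U p"
        "\<And>s. s \<in> {0..t} \<Longrightarrow> sdist p s u v \<le> e" using U(3) by blast
      have "- h \<in> {-t0..t0}" using h by auto
      then obtain \<tau> where \<tau>: "\<tau> \<in> R" "dist \<tau> (- h) < \<epsilon> / (2 * M)"
        using R(3) by (meson UN_E mem_ball subsetD)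
      hence \<tau>: "\<tau> \<in> R" "\<bar>- h - \<tau>\<bar> < \<epsilon> / (2 * M)" by (simp_all add: dist_real_def abs_minus_commute)
      have foot: "\<Phi> h z = sec p v" using foot_eq[OF z] by (simp add: foot_def sec_def z_h_v_def)
      have zv: "z = \<Phi> (- h) (sec p v)" by (simp add: foot[symmetric])
      have "norm (\<Phi> s x - \<Phi> s (\<Phi> \<tau> (sec p u)) - l) \<le> \<epsilon>" if s: "s \<in> {0..t}" for s
      proof -
        let ?a = "\<Phi> s (sec p v)" and ?b = "\<Phi> s (sec p u)"
        have "\<Phi> s x = \<Phi> s z + l" using flow_translate[OF p(2), of s z] by (simp add: z_h_v_def)
        also have "\<Phi> s z = \<Phi> (- h) ?a" by (subst zv) (simp add: flow_add[symmetric] add.commute)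
        finally have "\<Phi> s x - \<Phi> s (\<Phi> \<tau> (sec p u)) - l = \<Phi> (- h) ?a - \<Phi> \<tau> ?b"
          by (simp add: flow_add[symmetric] add.commute)
        also have "norm \<dots> \<le> norm (\<Phi> (- h) ?a - \<Phi> \<tau> ?a) + norm (\<Phi> \<tau> ?a - \<Phi> \<tau> ?b)"
          using norm_triangle_ineq[of "\<Phi> (- h) ?a - \<Phi> \<tau> ?a" "\<Phi> \<tau> ?a - \<Phi> \<tau> ?b"] by simp
        also have "\<dots> \<le> M * \<bar>- h - \<tau>\<bar> + exp (L * t0) * norm (?a - ?b)"
        proof (intro add_mono flow_speed flow_lipschitz_le)
          have "\<tau> \<in> {-t0..t0}" using \<tau>(1) R(2) by blast
          thus "\<bar>\<tau>\<bar> \<le> t0" by auto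
        qed
        also have "\<dots> \<le> M * (\<epsilon> / (2 * M)) + exp (L * t0) * e"
          using \<tau>(2) u(2)[OF s] M_pos by (intro add_mono mult_left_mono) auto
        also have "\<dots> \<le> \<epsilon>" using e_le M_pos by simp
        finally show ?thesis .
      qed
      moreover have "\<Phi> \<tau> (sec p u) \<in> S"
        unfolding S_def I_def using p(1) \<tau>(1) u(1) by (force intro!: image_eqI[of _ _ "(p, \<tau>, u)"])
      ultimately show ?thesis using p(2) by blast
    qed
    thus "\<exists>S. finite S \<and> real (card S) \<le> card P * card R * K * t \<and>
     (\<forall>x. \<exists>y\<in>S. \<exists>k\<in>int_vecs. \<forall>s\<in>{0..t}. norm (\<Phi> s x - \<Phi> s y - k) \<le> \<epsilon>)"
      using card fin by (intro exI[of _ S]) (auto simp: S_def)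
  qed
qed

end

section \<open>Recurrence and the return map of a periodic orbit\<close>

lemma int_vecs_limit:
  assumes "\<And>n. k n \<in> int_vecs" "k \<longlonglongrightarrow> l"
  shows "l \<in> int_vecs"
proof -
  have "Cauchy k" using assms(2) LIMSEQ_imp_Cauchy by blast
  from CauchyD[OF this zero_less_one]
  obtain N where N: "\<forall>i\<ge>N. \<forall>n\<ge>N. norm (k i - k n) < 1" ..
  have "k n = k N" if "n \<ge> N" for n
    using int_vecs_small[OF int_vecs_diff[OF assms(1)[of n] assms(1)[of N]]] N that by simp
  hence "\<forall>\<^sub>F n in sequentially. k n = k N" unfolding eventually_sequentially by blast
  hence "k \<longlonglongrightarrow> k N" by (simp add: tendsto_eventually)
  thus ?thesis using LIMSEQ_unique[OF assms(2)] assms(1) by metis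
qed

context periodic_flow begin

definition separated :: "real \<Rightarrow> real \<Rightarrow> real \<times> real \<Rightarrow> real \<times> real \<Rightarrow> bool" where
  "separated e t x y \<longleftrightarrow> (\<exists>s\<in>{0..t}. \<forall>k\<in>int_vecs. e \<le> norm (\<Phi> s x - \<Phi> s y - k))"

text \<open>The negation is the form in which entropy below 1 enters the rigidity argument. Since
  \<open>separated\<close> is taken modulo integer translations, such sets project injectively to
  the torus.\<close>

definition linear_growth :: bool where
  "linear_growth \<longleftrightarrow> (\<exists>e>0. \<exists>c>0. \<exists>a. \<forall>t\<ge>a. \<exists>S. finite S \<and> c * t \<le> real (card S) \<and>
     pairwise (separated e t) S)"

lemma separated_sym: "separated e t x y \<Longrightarrow> separated e t y x"
proof -
  have "norm (a - b - (- k)) = norm (b - a - k)" for a b k :: "real \<times> real"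
    by (metis minus_diff_eq minus_diff_minus norm_minus_cancel)
  thus "separated e t x y \<Longrightarrow> separated e t y x" unfolding separated_def using int_vecs_minus by metis
qed

lemma separated_neq: "separated e t x y \<Longrightarrow> 0 < e \<Longrightarrow> x \<noteq> y"
  unfolding separated_def using int_vecs_0 by (metis diff_self norm_zero not_le)

lemma linear_growthI:
  assumes "0 < e" "0 < c"
    and z: "\<And>t. a \<le> t \<Longrightarrow> \<exists>z n. c * t \<le> real n + 1 \<and> (\<forall>j\<le>n. \<forall>i<j. separated e t (z i) (z (j::nat)))"
  shows linear_growth unfolding linear_growth_def
proof (rule exI[of _ e], intro conjI assms(1), rule exI[of _ c], intro conjI assms(2), rule exI[of _ a], intro allI impI)
  fix t assume "a \<le> t"
  then obtain z n where n: "c * t \<le> real n + 1" and "\<And>i j. j \<le> n \<Longrightarrow> i < j \<Longrightarrow> separated e t (z i) (z j)"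
    using z by blast
  hence sep: "separated e t (z i) (z j)" if "i \<le> n" "j \<le> n" "i \<noteq> j" for i j
    using that separated_sym by (metis linorder_neqE_nat)
  have inj: "inj_on z {..n}" using sep separated_neq[OF _ assms(1)] by (metis atMost_iff inj_onI)
  have "pairwise (separated e t) (z ` {..n})" unfolding pairwise_def using sep by (metis atMost_iff imageE)
  thus "\<exists>S. finite S \<and> c * t \<le> real (card S) \<and> pairwise (separated e t) S"
    using n by (intro exI[of _ "z ` {..n}"]) (simp add: card_image[OF inj])
qed

text \<open>If \<open>y\<close> does not come back \<open>e\<close>-close to itself after time \<open>a\<close>, its preimages at the times
  \<open>i * a\<close> are separated: the orbit of the \<open>i\<close>-th one visits \<open>y\<close> at time \<open>i * a\<close>, when the others are away.\<close>

lemma nonrecurrent_imp_linear_growth: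
  assumes \<sigma>: "\<sigma> = 1 \<or> \<sigma> = -1" and e: "0 < e" and a: "0 < a"
    and nr: "\<And>s k. a \<le> s \<Longrightarrow> k \<in> int_vecs \<Longrightarrow> e \<le> norm (\<Phi> (\<sigma> * s) y - y - k)"
  shows linear_growth
proof (rule linear_growthI[OF e, of "1 / a" 0], use a in simp)
  fix t :: real assume t: "0 \<le> t"
  define n where "n = nat \<lfloor>t / a\<rfloor>"
  define z where "z i = \<Phi> (- (real i * a)) y" for i
  have n: "real n * a \<le> t" "1 / a * t \<le> real n + 1"
    using a t by (simp_all add: n_def pos_le_divide_eq[symmetric])
  have "separated e t (z i) (z j)" if ij: "i < j" "j \<le> n" for i j
  proof -
    have "real j * a \<le> real n * a" "real i * a \<le> real n * a" using ij a by (auto intro!: mult_right_mono)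
    hence ja: "a \<le> (real j - real i) * a" "real j * a \<le> t" "real i * a \<le> t"
      using ij a n by (simp, linarith, linarith)
    show ?thesis
    proof (cases "\<sigma> = 1")
      case True
      have "e \<le> norm (\<Phi> (real j * a) (z i) - \<Phi> (real j * a) (z j) - k)" if "k \<in> int_vecs" for k
        using nr[OF ja(1) that] True by (simp add: z_def flow_add[symmetric] algebra_simps)
      thus ?thesis using ja a unfolding separated_def by (intro bexI[of _ "real j * a"]) auto
    next
      case False
      have "e \<le> norm (\<Phi> (real i * a) (z j) - \<Phi> (real i * a) (z i) - k)" if "k \<in> int_vecs" for k
        using nr[OF ja(1) that] False \<sigma> by (simp add: z_def flow_add[symmetric] algebra_simps)
      hence "separated e t (z j) (z i)" using ja a unfolding separated_def by (intro bexI[of _ "real i * a"]) auto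
      thus ?thesis by (rule separated_sym)
    qed
  qed
  thus "\<exists>z n. 1 / a * t \<le> real n + 1 \<and> (\<forall>j\<le>n. \<forall>i<j. separated e t (z i) (z j))" using n(2) by blast
qed

definition recurrent :: "real \<times> real \<Rightarrow> bool" where
  "recurrent y \<longleftrightarrow> (\<forall>e>0. \<forall>a>0. \<exists>s\<ge>a. \<exists>k\<in>int_vecs. norm (\<Phi> s y - y - k) < e)"

lemma recurrent_if_not_linear_growth: "\<not> linear_growth \<Longrightarrow> recurrent y"
  unfolding recurrent_def using nonrecurrent_imp_linear_growth[of 1] by (metis mult_1 not_le)

lemma foot_translate: "k \<in> int_vecs \<Longrightarrow> foot (p + k) (z + k) = foot p z + k"
  by (simp add: foot_def hit_def flow_translate V_periodic)

lemma hit_eq_0: "norm (z - p) \<le> rad \<Longrightarrow> (z - p) \<bullet> V p = 0 \<Longrightarrow> hit p z = 0"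
  using t1_pos by (intro hit_eqI) auto

lemma det2_nrm: "det2 (V p) (nrm p) = norm (V p)"
proof -
  have "det2 (V p) (nrm p) = (fst (V p) * fst (V p) + snd (V p) * snd (V p)) / norm (V p)"
    by (simp add: det2_def nrm_def add_divide_distrib)
  also have "\<dots> = (norm (V p) * norm (V p)) / norm (V p)"
    using norm_V_squared[of p] unfolding power2_eq_square by (simp only:)
  finally show ?thesis by simp
qed

lemma det2_foot: "norm (z - p) \<le> rad \<Longrightarrow> det2 (V p) (foot p z - p) = crd p z * norm (V p)"
  by (simp add: foot_eq det2_linear det2_nrm)

lemma crd_sec: "\<bar>u\<bar> \<le> rad \<Longrightarrow> crd p (sec p u) = u"
proof -
  assume u: "\<bar>u\<bar> \<le> rad"
  have "nrm p \<bullet> nrm p = 1" using dot_square_norm[of "nrm p"] by simp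
  thus "crd p (sec p u) = u" using hit_eq_0[of "sec p u" p] u by (simp add: crd_def foot_def sec_def)
qed

text \<open>The signed distance between the two orbits in the section moving with \<open>p\<close>,
  scaled by the speed: the displacement of the foot is orthogonal to the field, so the determinant
  is, up to sign, the product of the two norms.\<close>

definition width :: "real \<times> real \<Rightarrow> real \<times> real \<Rightarrow> real \<Rightarrow> real" where
  "width p z s = det2 (V (\<Phi> s p)) (foot (\<Phi> s p) (\<Phi> s z) - \<Phi> s p)"

text \<open>Orbits do not cross. A zero of the width would put \<open>p\<close> on the orbit of
  \<open>z\<close> within time \<open>t1\<close>, although both lie on one section; a continuous
  function without zeros keeps its sign.\<close>

lemma width_same_sign:
  assumes near: "\<And>s. s \<in> {0..T} \<Longrightarrow> norm (\<Phi> s z - \<Phi> s p) \<le> rad"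
    and z: "z \<noteq> p" "(z - p) \<bullet> V p = 0" and s: "s \<in> {0..T}"
  shows "0 < width p z 0 * width p z s"
proof (rule ccontr)
  assume neg: "\<not> 0 < width p z 0 * width p z s"
  have nz: "width p z r \<noteq> 0" if r: "r \<in> {0..T}" for r
  proof
    assume "width p z r = 0"
    moreover have "\<bar>width p z r\<bar> = norm (V (\<Phi> r p)) * norm (foot (\<Phi> r p) (\<Phi> r z) - \<Phi> r p)"
      unfolding width_def using foot_orthogonal[OF near[OF r]]
      by (intro abs_det2_orthogonal) (simp add: inner_commute)
    ultimately have "foot (\<Phi> r p) (\<Phi> r z) = \<Phi> r p" by simp
    hence "\<Phi> (- r) (foot (\<Phi> r p) (\<Phi> r z)) = p" by simp
    hence "\<Phi> (hit (\<Phi> r p) (\<Phi> r z)) z = p" by (simp add: foot_def flow_add[symmetric])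
    moreover have "\<bar>hit (\<Phi> r p) (\<Phi> r z)\<bar> \<le> t1" using hit_abs_le[OF near[OF r]] t0_pos by (simp add: t0_def)
    ultimately have "p = z"
      using same_orbit_on_section[of z p p 0 "hit (\<Phi> r p) (\<Phi> r z)"] z near[of 0] s rad_pos by simp
    thus False using z by simp
  qed
  have cont: "continuous_on {0..s} (width p z)" unfolding width_def[abs_def] det2_def
    by (intro continuous_intros foot_continuous_on near) (use s in auto)
  have "\<exists>r\<ge>0. r \<le> s \<and> width p z r = 0"
    using IVT'[of "width p z" 0 0 s, OF _ _ _ cont] IVT2'[of "width p z" s 0 0, OF _ _ _ cont] neg s
    by (auto simp: not_less mult_le_0_iff)
  thus False using nz s by auto
qed

end

section \<open>The return map along a closed orbit\<close>

locale periodic_point = periodic_flow +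
  fixes p v :: "real \<times> real" and T \<sigma> :: real
  assumes v: "v \<in> int_vecs" and T_pos: "0 < T" and per: "\<Phi> T p = p + v" and \<sigma>: "\<sigma> = 1 \<or> \<sigma> = -1"
begin

text \<open>Starting within \<open>b0\<close>, an orbit stays within \<open>rad\<close> of the
  closed orbit for a whole period. The sign \<open>\<sigma>\<close> in the parametrisation
  \<open>z\<close> selects the side of the section that corresponds to positive parameters.\<close>

definition b0 :: real where "b0 = rad / exp (L * T)"

definition z :: "real \<Rightarrow> real \<times> real" where "z u = sec p (\<sigma> * u)"
definition y :: "real \<Rightarrow> real \<times> real" where "y u = \<Phi> T (z u) - v"
text \<open>The Poincare map in the parameter of the section, with \<open>\<tau>\<close> as return
  time: \<open>y u\<close> is the point after time \<open>T\<close>, moved back by \<open>v\<close>,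
  and the hitting time corrects it onto the section.\<close>

definition P :: "real \<Rightarrow> real" where "P u = \<sigma> * crd p (y u)"
definition \<tau> :: "real \<Rightarrow> real" where "\<tau> u = T + hit p (y u)"

lemma b0_pos: "0 < b0" and b0_le: "b0 \<le> rad"
proof -
  show "0 < b0" using rad_pos by (simp add: b0_def)
  have "1 \<le> exp (L * T)" using L_pos T_pos by simp
  thus "b0 \<le> rad" using rad_pos by (simp add: b0_def divide_le_eq)
qed

lemma abs_\<sigma>: "\<bar>\<sigma> * u\<bar> = \<bar>u\<bar>" and \<sigma>_square: "\<sigma> * (\<sigma> * u) = u"
  using \<sigma> by auto

lemma z_dist: "norm (z u - p) = \<bar>u\<bar>" and z_orthogonal: "(z u - p) \<bullet> V p = 0"
  and z_inj: "z u = z u' \<longleftrightarrow> u = u'" and z_0: "z 0 = p"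
  using \<sigma> by (auto simp: z_def abs_\<sigma> sec_inj) (simp_all add: sec_def)

lemma z_continuous: "continuous_on S f \<Longrightarrow> continuous_on S (\<lambda>u. z (f u))"
  unfolding z_def by (intro continuous_intros)

lemma T_ge: "t1 < T"
proof (rule ccontr)
  assume "\<not> t1 < T"
  hence "T = 0" using same_orbit_on_section[of p p p v T] v per T_pos rad_pos by auto
  thus False using T_pos by simp
qed

lemma near_orbit:
  assumes "\<bar>u\<bar> \<le> b0" "s \<in> {0..T}"
  shows "norm (\<Phi> s (z u) - \<Phi> s p) \<le> rad"
proof -
  have "norm (\<Phi> s (z u) - \<Phi> s p) \<le> exp (L * T) * norm (z u - p)"
    using assms by (intro flow_lipschitz_le) auto
  also have "\<dots> \<le> exp (L * T) * b0" using assms by (simp add: z_dist)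
  finally show ?thesis by (simp add: b0_def)
qed

lemma y_dist: "norm (y u - p) \<le> exp (L * T) * \<bar>u\<bar>"
  using flow_lipschitz_le[of T T "z u" p] T_pos by (simp add: y_def per z_dist algebra_simps)

lemma y_near: "\<bar>u\<bar> \<le> b0 \<Longrightarrow> norm (y u - p) \<le> rad"
  using near_orbit[of u T] T_pos by (simp add: y_def per algebra_simps)

lemma \<tau>_near: "\<bar>u\<bar> \<le> b0 \<Longrightarrow> \<bar>\<tau> u - T\<bar> \<le> t0"
  using hit_abs_le[OF y_near] by (simp add: \<tau>_def)

lemma \<tau>_diff: "\<bar>u\<bar> \<le> b0 \<Longrightarrow> \<bar>u'\<bar> \<le> b0 \<Longrightarrow> \<bar>\<tau> u - \<tau> u'\<bar> \<le> t1 / 2"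
  using \<tau>_near[of u] \<tau>_near[of u'] unfolding t0_def by linarith

lemma y_continuous: "continuous_on S y"
  unfolding y_def[abs_def] by (intro continuous_intros z_continuous)

lemma return: 
  assumes "\<bar>u\<bar> \<le> b0"
  shows "\<Phi> (\<tau> u) (z u) = z (P u) + v"
proof -
  have "\<Phi> (\<tau> u) (z u) = \<Phi> (hit p (y u)) (y u + v)"
    by (simp add: \<tau>_def y_def flow_add[symmetric] add.commute)
  also have "\<dots> = foot p (y u) + v" by (simp add: flow_translate v foot_def)
  also have "foot p (y u) = z (P u)"
    using foot_eq[OF y_near[OF assms]] by (simp add: z_def P_def \<sigma>_square sec_def)
  finally show ?thesis .
qed

lemma P_continuous: "continuous_on {0..b0} P"
  unfolding P_def[abs_def] crd_def by (intro continuous_intros foot_continuous_on y_continuous y_near) auto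

lemma \<tau>_continuous: "continuous_on {-b0..b0} \<tau>"
  unfolding \<tau>_def[abs_def] by (intro continuous_intros hit_continuous_on y_continuous y_near) auto

lemma y_0: "y 0 = p" by (simp add: y_def z_0 per)

lemma P_0: "P 0 = 0" and \<tau>_0: "\<tau> 0 = T"
  using hit_eq_0[of p p] rad_pos by (simp_all add: P_def \<tau>_def y_0 crd_def foot_def)

text \<open>At times 0 and \<open>T\<close> the width between the orbits of \<open>p\<close> and
  \<open>z u\<close> is a positive multiple of \<open>\<sigma> * u\<close> and
  \<open>\<sigma> * P u\<close>, and its sign is preserved.\<close>

lemma P_pos:
  assumes "0 < u" "u \<le> b0"
  shows "0 < P u"
proof -
  have u: "\<bar>u\<bar> \<le> b0" "\<bar>u\<bar> \<le> rad" using assms b0_le by auto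
  have "0 < width p (z u) 0 * width p (z u) T"
    using near_orbit[OF u(1)] z_orthogonal T_pos assms z_inj[of u 0] z_0
    by (intro width_same_sign[of T]) auto
  moreover have "width p (z u) 0 = \<sigma> * u * norm (V p)"
    using det2_foot[of "z u" p] crd_sec[of "\<sigma> * u" p] u
    by (simp add: width_def z_dist) (simp add: z_def abs_\<sigma>)
  moreover have "width p (z u) T = \<sigma> * P u * norm (V p)"
  proof -
    have "width p (z u) T = det2 (V (p + v)) (foot (p + v) (y u + v) - (p + v))"
      by (simp add: width_def per y_def)
    also have "\<dots> = det2 (V p) (foot p (y u) - p)" using v by (simp add: foot_translate V_periodic)
    also have "\<dots> = \<sigma> * P u * norm (V p)" using det2_foot[OF y_near[OF u(1)]] by (simp add: P_def \<sigma>_square)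
    finally show ?thesis .
  qed
  ultimately have "0 < (u * norm (V p) * norm (V p)) * P u" using \<sigma> by (auto simp: mult_ac)
  moreover have "0 < u * norm (V p) * norm (V p)" using assms by simp
  ultimately show ?thesis by (rule zero_less_mult_pos)
qed

lemma P_inj:
  assumes "\<bar>u\<bar> \<le> b0" "\<bar>u'\<bar> \<le> b0" "P u = P u'"
  shows "u = u'"
proof -
  have "\<Phi> (\<tau> u) (z u) = \<Phi> (\<tau> u') (z u')" using assms by (simp add: return)
  hence "\<Phi> (- \<tau> u') (\<Phi> (\<tau> u) (z u)) = z u'" by simp
  hence "\<Phi> (\<tau> u - \<tau> u') (z u) = z u' + 0" by (simp add: flow_add[symmetric])
  hence "z u' = z u"
    using same_orbit_on_section[of "z u" p "z u'" 0 "\<tau> u - \<tau> u'"] assms b0_le \<tau>_diff[OF assms(1,2)] t1_pos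
    by (simp add: z_dist z_orthogonal)
  thus ?thesis by (simp add: z_inj)
qed

lemma P_strict_mono:
  assumes "0 \<le> u" "u < u'" "u' \<le> b0"
  shows "P u < P u'"
proof (cases "u = 0")
  case False
  have "continuous_on {0..u'} P" by (rule continuous_on_subset[OF P_continuous]) (use assms in auto)
  moreover have "inj_on P {0..u'}" using P_inj assms by (intro inj_onI) auto
  ultimately show ?thesis
    using continuous_inj_imp_mono[of 0 u u' P] P_pos[of u] False assms by (auto simp: P_0)
qed (use P_pos assms P_0 in auto)

text \<open>The point can come back exactly only at its own return time, since all return times are
  close to \<open>T\<close>. A second parameter \<open>w\<close> is allowed because the known period
  may be that of another orbit.\<close>

lemma fixed_if_same_time:
  assumes "\<bar>u\<bar> \<le> b0" "\<bar>w\<bar> \<le> b0" "\<Phi> (\<tau> w) (z u) = z u + v"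
  shows "P u = u"
proof -
  have "z u + v = \<Phi> (\<tau> w - \<tau> u) (\<Phi> (\<tau> u) (z u))" using assms(3) by (simp add: flow_add[symmetric])
  also have "\<dots> = \<Phi> (\<tau> w - \<tau> u) (z (P u)) + v" using assms(1) v by (simp add: return flow_translate)
  finally have "\<Phi> (\<tau> u - \<tau> w) (z u) = \<Phi> (\<tau> u - \<tau> w) (\<Phi> (\<tau> w - \<tau> u) (z (P u)))" by simp
  hence "\<Phi> (\<tau> u - \<tau> w) (z u) = z (P u) + 0" by (simp add: flow_add[symmetric])
  hence *: "\<Phi> (\<tau> u - \<tau> w) (z u) = z (P u) + 0" .
  have "0 = \<tau> u - \<tau> w"
  proof (rule hit_time_unique[of "z u" p])
    show "norm (z u - p) \<le> tube / 2" using assms(1) b0_le rad_le by (simp add: z_dist)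
    show "\<bar>\<tau> u - \<tau> w\<bar> \<le> t1" using \<tau>_diff[OF assms(1,2)] t1_pos by linarith
    show "(\<Phi> (\<tau> u - \<tau> w) (z u) - p) \<bullet> V p = 0" unfolding * by (simp add: z_orthogonal)
  qed (use t1_pos in \<open>auto simp: z_orthogonal\<close>)
  hence "z (P u) = z u" using * by (metis add.right_neutral flow_0)
  thus ?thesis by (simp add: z_inj)
qed

lemma P_iterates_limit:
  assumes u: "0 < u" "u \<le> b0" "P u < u"
  defines "w \<equiv> \<lambda>k. (P ^^ k) u"
  obtains u' where "0 \<le> u'" "u' \<le> u" "P u' = u'" "w \<longlonglongrightarrow> u'" "\<And>k. 0 < w k \<and> w k \<le> u"
proof -
  have w_Suc: "w (Suc k) = P (w k)" for k by (simp add: w_def)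
  have inv: "0 < w k \<and> w k \<le> u \<and> w (Suc k) < w k" for k
  proof (induction k)
    case 0
    thus ?case using u by (simp add: w_def)
  next
    case (Suc k)
    hence "0 < P (w k)" using u by (intro P_pos) auto
    moreover have "P (P (w k)) < P (w k)"
      using Suc u \<open>0 < P (w k)\<close> by (intro P_strict_mono) (auto simp: w_Suc)
    ultimately show ?case using Suc by (auto simp: w_Suc)
  qed
  have "decseq w" by (intro decseq_SucI) (use inv in \<open>auto intro: less_imp_le\<close>)
  moreover have "\<forall>k. 0 \<le> w k" using inv less_imp_le by blast
  ultimately obtain u' where "w \<longlonglongrightarrow> u'" "\<forall>k. u' \<le> w k" by (rule decseq_convergent)
  hence u': "w \<longlonglongrightarrow> u'" "\<And>k. u' \<le> w k" by blast+
  have "0 \<le> u'" using u'(1) inv by (intro LIMSEQ_le_const[of w]) (auto intro!: exI[of _ 0] less_imp_le)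
  moreover have "u' \<le> u" using u'(2)[of 0] by (simp add: w_def)
  moreover have "(\<lambda>k. P (w k)) \<longlonglongrightarrow> P u'"
  proof (rule continuous_on_tendsto_compose[OF P_continuous u'(1)])
    show "u' \<in> {0..b0}" using \<open>0 \<le> u'\<close> \<open>u' \<le> u\<close> u(2) by simp
    have "w k \<in> {0..b0}" for k using inv[of k] u(2) by auto
    thus "\<forall>\<^sub>F k in sequentially. w k \<in> {0..b0}" by simp
  qed
  moreover have "(\<lambda>k. P (w k)) \<longlonglongrightarrow> u'" using LIMSEQ_Suc[OF u'(1)] by (simp only: w_Suc)
  ultimately have "0 \<le> u'" "u' \<le> u" "P u' = u'" using LIMSEQ_unique by blast+
  thus ?thesis using that[OF _ _ _ u'(1)] inv by blast
qed

text \<open>If \<open>P u < u\<close>, the iterates decrease to a fixed point \<open>u'\<close>, so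
  the orbit of \<open>z u\<close> spirals towards the closed orbit through \<open>z u'\<close>.
  Recurrence then places \<open>z u\<close>, up to a translation, on that closed orbit, hence
  \<open>z u\<close> is periodic with period \<open>\<tau> u'\<close> and
  \<open>P u = u\<close>.\<close>

lemma recurrent_imp_return_ge:
  assumes rec: "recurrent (z u)" and u: "0 < u" "u \<le> b0"
  shows "u \<le> P u"
proof (rule ccontr)
  assume "\<not> u \<le> P u"
  hence Pu: "P u < u" by simp
  define w where "w k = (P ^^ k) u" for k
  obtain u' where u': "0 \<le> u'" "u' \<le> u" "P u' = u'" "w \<longlonglongrightarrow> u'" and w: "\<And>k. 0 < w k \<and> w k \<le> u"
    using P_iterates_limit[OF u Pu] unfolding w_def by blast
  have w_b0: "\<bar>w k\<bar> \<le> b0" for k using w[of k] u by simp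
  define S where "S k = (\<Sum>i<k. \<tau> (w i))" for k
  have \<tau>w: "T - t0 \<le> \<tau> (w k)" "\<tau> (w k) \<le> T + t0" for k using \<tau>_near[OF w_b0[of k]] by linarith+
  have S_le: "S k \<le> real k * (T + t0)" for k
    unfolding S_def using sum_bounded_above[of "{..<k}" "\<lambda>i. \<tau> (w i)" "T + t0"] \<tau>w by simp
  have S_ge: "real k * (T - t0) \<le> S k" for k
    unfolding S_def using sum_bounded_below[of "{..<k}" "T - t0" "\<lambda>i. \<tau> (w i)"] \<tau>w by simp
  have Tt0: "0 < T - t0" using T_ge t0_pos by (simp add: t0_def)
  have S_flow: "\<Phi> (S k) (z u) = z (w k) + real k *\<^sub>R v" for k
  proof (induction k)
    case 0
    show ?case by (simp add: S_def w_def)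
  next
    case (Suc k)
    have "\<Phi> (S (Suc k)) (z u) = \<Phi> (\<tau> (w k)) (\<Phi> (S k) (z u))"
      by (simp add: S_def flow_add[symmetric] add.commute)
    also have "\<dots> = \<Phi> (\<tau> (w k)) (z (w k)) + real k *\<^sub>R v" by (simp add: Suc flow_translate int_vecs_scale v)
    also have "\<dots> = z (w (Suc k)) + real (Suc k) *\<^sub>R v"
      unfolding return[OF w_b0] by (simp add: w_def scaleR_left_distrib)
    finally show ?case .
  qed
  have "\<exists>s k. real n + 1 \<le> s \<and> k \<in> int_vecs \<and> norm (\<Phi> s (z u) - z u - k) < inverse (real (Suc n))" for n
  proof -
    have "0 < inverse (real (Suc n))" "0 < real n + 1" by auto
    with rec show ?thesis unfolding recurrent_def by blast
  qed
  then obtain s k where sk: "\<And>n. real n + 1 \<le> s n" "\<And>n. k n \<in> int_vecs"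
    "\<And>n. norm (\<Phi> (s n) (z u) - z u - k n) < inverse (real (Suc n))" by metis
  \<comment> \<open>Each recurrence time is split into complete returns and a bounded remainder
    \<open>a n\<close>, of which a subsequence converges.\<close>
  have "\<exists>j. S j \<le> s n \<and> s n < S (Suc j)" for n
  proof -
    obtain N where "s n / (T - t0) < real N" using reals_Archimedean2 by blast
    hence "s n < S N" using S_ge[of N] Tt0 by (simp add: divide_less_eq)
    hence ex: "\<exists>j. s n < S j" by blast
    define J where "J = (LEAST j. s n < S j)"
    have J: "s n < S J" unfolding J_def using ex by (rule LeastI_ex)
    have "J \<noteq> 0"
    proof
      assume "J = 0"
      hence "s n < 0" using J by (simp only: S_def) simp
      thus False using sk(1)[of n] by linarith
    qed
    then obtain j where j: "J = Suc j" using not0_implies_Suc by blast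
    hence "\<not> s n < S j" unfolding J_def using not_less_Least[of j] by (metis J_def lessI)
    thus ?thesis using J j by (intro exI[of _ j]) auto
  qed
  then obtain j where j: "\<And>n. S (j n) \<le> s n" "\<And>n. s n < S (Suc (j n))" by metis
  define a where "a n = s n - S (j n)" for n
  have a: "a n \<in> {0..T + t0}" for n using j[of n] \<tau>w(2)[of "j n"] by (simp add: a_def S_def)
  have j_inf: "filterlim j at_top sequentially"
  proof -
    have "real n \<le> (T + t0) * real (Suc (j n))" for n
      using sk(1)[of n] j(2)[of n] S_le[of "Suc (j n)"] by (simp add: mult.commute)
    hence ge: "real n / (T + t0) - 1 \<le> real (j n)" for n
      using T_pos t0_pos by (simp add: divide_le_eq algebra_simps)
    have "filterlim (\<lambda>n. real n / (T + t0) - 1) at_top sequentially" using T_pos t0_pos by real_asymp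
    hence "filterlim (\<lambda>n. real (j n)) at_top sequentially" by (rule filterlim_at_top_mono) (use ge in auto)
    thus ?thesis by (simp add: filterlim_sequentially_iff_filterlim_real)
  qed
  obtain l r where l: "strict_mono r" "(a \<circ> r) \<longlonglongrightarrow> l"
    using a compact_imp_seq_compact[of "{0..T + t0}"] unfolding seq_compact_def by blast
  have zl: "(\<lambda>n. z (w (j (r n)))) \<longlonglongrightarrow> z u'"
  proof -
    have "filterlim (\<lambda>n. j (r n)) at_top sequentially"
      using filterlim_compose[OF j_inf filterlim_subseq[OF l(1)]] .
    hence "(\<lambda>n. w (j (r n))) \<longlonglongrightarrow> u'" by (rule filterlim_compose[OF u'(4)])
    moreover have "isCont z u'" using z_continuous[of UNIV "\<lambda>u. u"] by (simp add: continuous_on_eq_continuous_at)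
    ultimately show ?thesis using isCont_tendsto_compose by blast
  qed
  \<comment> \<open>The translation left over once those of the complete returns are removed. It
    converges, and integer vectors form a closed set.\<close>
  define k' where "k' n = k (r n) - real (j (r n)) *\<^sub>R v" for n
  have eq: "\<Phi> (s n) (z u) = \<Phi> (a n) (z (w (j n))) + real (j n) *\<^sub>R v" for n
  proof -
    have "\<Phi> (s n) (z u) = \<Phi> (a n) (\<Phi> (S (j n)) (z u))" by (simp add: a_def flow_add[symmetric])
    thus ?thesis by (simp add: S_flow flow_translate int_vecs_scale v)
  qed
  have "(\<lambda>n. \<Phi> (a (r n)) (z (w (j (r n)))) - z u - k' n) \<longlonglongrightarrow> 0"
  proof (rule Lim_null_comparison)
    show "\<forall>\<^sub>F n in sequentially. norm (\<Phi> (a (r n)) (z (w (j (r n)))) - z u - k' n) \<le> inverse (real (Suc (r n)))"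
      using sk(3) unfolding eq k'_def by (intro always_eventually allI) (simp add: algebra_simps less_imp_le)
    show "(\<lambda>n. inverse (real (Suc (r n)))) \<longlonglongrightarrow> 0"
      using LIMSEQ_subseq_LIMSEQ[OF LIMSEQ_inverse_real_of_nat l(1)] by (simp add: o_def)
  qed
  moreover have "(\<lambda>n. \<Phi> (a (r n)) (z (w (j (r n)))) - z u) \<longlonglongrightarrow> \<Phi> l (z u') - z u"
    using l(2) zl by (intro tendsto_intros) (simp_all add: o_def)
  ultimately have "(\<lambda>n. (\<Phi> (a (r n)) (z (w (j (r n)))) - z u) - (\<Phi> (a (r n)) (z (w (j (r n)))) - z u - k' n))
     \<longlonglongrightarrow> (\<Phi> l (z u') - z u) - 0" by (rule tendsto_diff[rotated])
  hence "k' \<longlonglongrightarrow> \<Phi> l (z u') - z u" by simp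
  moreover have "k' n \<in> int_vecs" for n using sk(2) v by (simp add: k'_def int_vecs_diff int_vecs_scale)
  ultimately have int: "\<Phi> l (z u') - z u \<in> int_vecs" using int_vecs_limit by blast
  have u'_b0: "\<bar>u'\<bar> \<le> b0" using u' u by simp
  have zu: "z u = \<Phi> l (z u') - (\<Phi> l (z u') - z u)" by simp
  have "\<Phi> (\<tau> u') (z u) = \<Phi> (\<tau> u') (\<Phi> l (z u')) - (\<Phi> l (z u') - z u)"
    using flow_translate_diff[OF int, of "\<tau> u'" "\<Phi> l (z u')"] by (simp only: zu[symmetric])
  also have "\<Phi> (\<tau> u') (\<Phi> l (z u')) = \<Phi> l (\<Phi> (\<tau> u') (z u'))" by (simp add: flow_add[symmetric] add.commute)
  also have "\<dots> = \<Phi> l (z u') + v" by (simp add: return[OF u'_b0] u'(3) flow_translate v)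
  finally have "\<Phi> (\<tau> u') (z u) = z u + v" by simp
  hence "P u = u" using fixed_if_same_time[of u u'] u u'_b0 by simp
  thus False using Pu by simp
qed

text \<open>Small enough that \<open>P u\<close> remains within \<open>b0\<close>, so that the
  return map of the reversed flow can be applied to it.\<close>

definition b1 :: real where "b1 = b0 / (slant * exp (L * T))"

lemma b1_denominator_ge: "1 \<le> slant * exp (L * T)"
proof -
  have "1 * 1 \<le> slant * exp (L * T)" using M_pos m_pos L_pos T_pos by (intro mult_mono) auto
  thus ?thesis by simp
qed

lemma b1_pos: "0 < b1" and b1_le: "b1 \<le> b0"
proof -
  have pos: "0 < slant * exp (L * T)" using b1_denominator_ge by linarith
  thus "0 < b1" using b0_pos by (simp add: b1_def)
  show "b1 \<le> b0" unfolding b1_def pos_divide_le_eq[OF pos]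
    using mult_left_mono[OF b1_denominator_ge, of b0] b0_pos by simp
qed

lemma abs_P_le:
  assumes "\<bar>u\<bar> \<le> b1"
  shows "\<bar>P u\<bar> \<le> b0"
proof -
  have u: "\<bar>u\<bar> \<le> b0" using assms b1_le by simp
  have "\<bar>P u\<bar> \<le> slant * norm (y u - p)" using abs_crd_le[OF y_near[OF u]] by (simp add: P_def abs_\<sigma>)
  also have "\<dots> \<le> slant * (exp (L * T) * \<bar>u\<bar>)" using M_pos m_pos y_dist by (intro mult_left_mono) auto
  also have "\<dots> = (slant * exp (L * T)) * \<bar>u\<bar>" by simp
  also have "\<dots> \<le> (slant * exp (L * T)) * b1" using assms b1_denominator_ge by (intro mult_left_mono) auto
  also have "\<dots> = b0"
  proof -
    have "slant * exp (L * T) \<noteq> 0" using b1_denominator_ge by linarith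
    thus ?thesis unfolding b1_def by simp
  qed
  finally show ?thesis .
qed

text \<open>Reversing the field flips the normal vector, so \<open>\<sigma>\<close> is negated in
  order to keep the same parametrisation of the section.\<close>

lemma return_reversed: "periodic_point (\<lambda>x. - V x) (\<lambda>t. \<Phi> (- t)) L M m p (- v) T (- \<sigma>)"
proof (rule periodic_point.intro[OF reversed_flow], unfold_locales)
  show "- v \<in> int_vecs" using v by (rule int_vecs_minus)
  have "\<Phi> (- T) (p + v) = p" by (simp add: per[symmetric])
  thus "\<Phi> (- T) p = p + - v" by (simp add: flow_translate v eq_diff_eq)
  show "- \<sigma> = 1 \<or> - \<sigma> = - 1" using \<sigma> by auto
qed (rule T_pos)

lemma return_reflected: "periodic_point V \<Phi> L M m p v T (- \<sigma>)"
proof unfold_locales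
  show "- \<sigma> = 1 \<or> - \<sigma> = - 1" using \<sigma> by auto
qed (use v T_pos per in auto)

text \<open>The return map of the reversed flow is inverse to \<open>P\<close>. Backward recurrence
  gives the inequality \<open>recurrent_imp_return_ge\<close> for it, and evaluation at
  \<open>P u\<close> reads \<open>P u \<le> u\<close>.\<close>

lemma return_le:
  assumes lg: "\<not> linear_growth" and u: "0 < u" "u \<le> b1"
  shows "P u \<le> u"
proof -
  interpret R: periodic_point "\<lambda>x. - V x" "\<lambda>t. \<Phi> (- t)" L M m p "- v" T "- \<sigma>" by (rule return_reversed)
  have Rnrm: "R.nrm p = - nrm p" by (simp add: R.nrm_def nrm_def)
  have Rz: "R.z x = z x" for x by (simp add: R.z_def z_def R.sec_def sec_def Rnrm)

  have ub: "\<bar>u\<bar> \<le> b0" "u \<le> b0" using u b1_le by auto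
  have Pu: "0 < P u" "P u \<le> b0" using P_pos[of u] abs_P_le[of u] u ub by auto
  define h where "h = hit p (y u)"
  have h: "\<bar>h\<bar> \<le> t1" using hit_abs_le[OF y_near[OF ub(1)]] t0_pos by (simp add: h_def t0_def)
  have "R.y (P u) = \<Phi> (- T) (z (P u)) + v" by (simp add: R.y_def Rz)
  also have "\<dots> = \<Phi> (- T) (\<Phi> (\<tau> u) (z u))" by (simp add: return[OF ub(1)] flow_translate v)
  also have "\<dots> = \<Phi> h (z u)" by (simp add: flow_add[symmetric] \<tau>_def h_def)
  finally have Ry: "R.y (P u) = \<Phi> h (z u)" .
  have near: "norm (R.y (P u) - p) \<le> rad" by (rule R.y_near) (use Pu in simp)
  have "R.hit p (R.y (P u)) = h"
  proof (rule R.hit_eqI[OF near h])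
    show "(\<Phi> (- h) (R.y (P u)) - p) \<bullet> - V p = 0" unfolding Ry by (simp add: z_orthogonal)
  qed
  hence foot: "R.foot p (R.y (P u)) = z u" unfolding R.foot_def Ry by simp
  have "nrm p \<bullet> nrm p = 1" using dot_square_norm[of "nrm p"] by simp
  hence RP: "R.P (P u) = u" by (simp add: R.P_def R.crd_def foot Rnrm z_def sec_def \<sigma>_square)
  have "R.recurrent (R.z (P u))" unfolding R.recurrent_def using nonrecurrent_imp_linear_growth[of "-1"] lg
    by (metis mult_minus1 not_le)
  hence "P u \<le> R.P (P u)" using Pu by (intro R.recurrent_imp_return_ge) auto
  thus ?thesis by (simp add: RP)
qed

lemma return_id_nonneg:
  assumes "\<not> linear_growth" "0 \<le> u" "u \<le> b1"
  shows "P u = u"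
proof (cases "u = 0")
  case False
  thus ?thesis using assms return_le[of u] recurrent_imp_return_ge[of u] recurrent_if_not_linear_growth b1_le
    by fastforce
qed (simp add: P_0)

lemma return_id:
  assumes "\<not> linear_growth" "\<bar>u\<bar> \<le> b1"
  shows "P u = u"
proof (cases "0 \<le> u")
  case False
  interpret N: periodic_point V \<Phi> L M m p v T "- \<sigma>" by (rule return_reflected)
  have z: "N.z (- u) = z u" by (simp add: N.z_def z_def)
  have "N.P (- u) = - u" using N.return_id_nonneg[of "- u"] assms False by simp
  thus ?thesis by (simp add: N.P_def P_def N.y_def y_def z)
qed (use assms return_id_nonneg in auto)

section \<open>Shear between closed orbits of different periods\<close>

lemma return_iterate:
  assumes "\<bar>u\<bar> \<le> b0" "P u = u"
  shows "\<Phi> (real j * \<tau> u) (z u) = z u + real j *\<^sub>R v"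
proof (induction j)
  case (Suc j)
  have "\<Phi> (real (Suc j) * \<tau> u) (z u) = \<Phi> (\<tau> u) (\<Phi> (real j * \<tau> u) (z u))"
    by (simp add: flow_add[symmetric] algebra_simps)
  also have "\<dots> = \<Phi> (\<tau> u) (z u) + real j *\<^sub>R v" by (simp add: Suc flow_translate int_vecs_scale v)
  also have "\<dots> = z u + real (Suc j) *\<^sub>R v" by (simp add: return assms scaleR_left_distrib)
  finally show ?case .
qed simp

text \<open>After \<open>j\<close> turns of the first orbit the second is off by the time
  \<open>j * (\<tau> u - \<tau> u')\<close>. If the orbits stayed close, this lag would remain below
  \<open>t1 / 2\<close>, by a bootstrap: one more turn keeps it within \<open>t1\<close>, where
  \<open>time_le_dist\<close> applies and improves it to at most \<open>t1 / 4\<close>. The scale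
  \<open>m * t1 / 8\<close> is chosen for that last bound.\<close>

lemma shear_separated:
  fixes K :: nat
  assumes u: "\<bar>u\<bar> \<le> b0" "P u = u" and u': "\<bar>u'\<bar> \<le> b0" "P u' = u'"
    and K: "real K * (T + t0) \<le> t" "t1 / 2 \<le> real K * \<bar>\<tau> u - \<tau> u'\<bar>"
  shows "separated (m * t1 / 8) t (z u) (z u')"
proof (rule ccontr)
  assume "\<not> ?thesis"
  hence close: "\<exists>k\<in>int_vecs. norm (\<Phi> s (z u) - \<Phi> s (z u') - k) < m * t1 / 8" if "s \<in> {0..t}" for s
    using that unfolding separated_def by (metis not_le)
  define \<Delta> where "\<Delta> = \<tau> u - \<tau> u'"
  have \<Delta>: "\<bar>\<Delta>\<bar> \<le> t1 / 2" using \<tau>_diff u u' by (simp add: \<Delta>_def)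
  have "real j * \<bar>\<Delta>\<bar> < t1 / 2" if "j \<le> K" for j using that
  proof (induction j)
    case 0
    show ?case using t1_pos by simp
  next
    case (Suc j)
    define d where "d = real (Suc j) * \<Delta>"
    have "\<bar>d\<bar> = real (Suc j) * \<bar>\<Delta>\<bar>" by (simp only: d_def abs_mult abs_of_nat)
    hence "\<bar>d\<bar> = real j * \<bar>\<Delta>\<bar> + \<bar>\<Delta>\<bar>" by (simp add: distrib_right)
    hence d: "\<bar>d\<bar> \<le> t1" using Suc \<Delta> by simp
    have \<tau>u: "0 \<le> \<tau> u" "\<tau> u \<le> T + t0" using \<tau>_near[OF u(1)] T_ge t0_pos unfolding t0_def by linarith+
    have "real (Suc j) * \<tau> u \<le> real K * (T + t0)" using Suc.prems \<tau>u by (intro mult_mono) auto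
    hence "real (Suc j) * \<tau> u \<in> {0..t}" using K(1) \<tau>u(1) by (simp del: of_nat_Suc)
    then obtain k where k: "k \<in> int_vecs"
      "norm (\<Phi> (real (Suc j) * \<tau> u) (z u) - \<Phi> (real (Suc j) * \<tau> u) (z u') - k) < m * t1 / 8"
      using close by blast
    have "\<Phi> (real (Suc j) * \<tau> u) (z u') = \<Phi> d (\<Phi> (real (Suc j) * \<tau> u') (z u'))"
      by (simp add: flow_add[symmetric] d_def \<Delta>_def algebra_simps)
    also have "\<dots> = \<Phi> d (z u') + real (Suc j) *\<^sub>R v"
      unfolding return_iterate[OF u'] by (intro flow_translate int_vecs_scale v)
    finally have lt: "norm (z u - \<Phi> d (z u') - k) < m * t1 / 8"
      using k(2) unfolding return_iterate[OF u] by simp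
    have mM: "m * t1 / 8 \<le> 1 / 64"
    proof -
      have "m * t1 \<le> M * t1" using V_ge[of 0] V_le[of 0] t1_pos by (intro mult_right_mono) auto
      thus ?thesis using M_t1 tube_le by simp
    qed
    have "norm k \<le> norm (z u - \<Phi> d (z u') - k) + norm (z u - \<Phi> d (z u'))"
      using norm_triangle_ineq4[of "z u - \<Phi> d (z u')" "z u - \<Phi> d (z u') - k"] by simp
    also have "norm (z u - \<Phi> d (z u')) \<le> norm (z u - p) + norm (z u' - p) + norm (\<Phi> d (z u') - z u')"
      using norm_triangle_ineq4[of "z u - p" "\<Phi> d (z u') - p"] norm_triangle_ineq[of "\<Phi> d (z u') - z u'" "z u' - p"]
      by simp
    also have "\<dots> \<le> rad + rad + tube / 2"
      using flow_speed_0[of d "z u'"] mult_left_mono[OF d, of M] M_t1 M_pos u(1) u'(1) b0_le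
      by (simp add: z_dist)
    finally have "norm k < 1" using lt mM rad_le tube_le by linarith
    hence "k = 0" using k(1) int_vecs_small by blast
    have "\<bar>d\<bar> \<le> 2 / m * norm (z u - \<Phi> d (z u'))"
      using time_le_dist[of "z u'" p 0 d "z u"] d t1_pos u'(1) b0_le rad_le z_orthogonal[of u] z_orthogonal[of u']
      by (simp add: z_dist inner_diff_left norm_minus_commute[of "z u"])
    also have "\<dots> \<le> 2 / m * (m * t1 / 8)" using lt \<open>k = 0\<close> m_pos by (intro mult_left_mono) auto
    also have "\<dots> < t1 / 2" using m_pos t1_pos by simp
    finally show ?case by (simp add: d_def abs_mult)
  qed
  from this[of K] show False using K(2) by (simp add: \<Delta>_def)
qed

text \<open>If \<open>\<tau>\<close> takes a value other than \<open>T\<close>, it takes all values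
  in between, so a number of orbits proportional to \<open>t\<close> can be picked with equally
  spaced periods. About \<open>t / (T + t0)\<close> turns fit into time \<open>t\<close> and
  separate them pairwise. The constant \<open>c\<close> combines this number of turns with the
  spacing that they can resolve.\<close>

lemma period_constant:
  assumes lg: "\<not> linear_growth" and u: "\<bar>u\<bar> \<le> b1"
  shows "\<tau> u = T"
proof (rule ccontr)
  assume neq: "\<tau> u \<noteq> T"
  define \<delta> where "\<delta> = \<tau> u - T"
  define c where "c = \<bar>\<delta>\<bar> / (t1 * (T + t0))"
  have \<delta>: "\<delta> \<noteq> 0" using neq by (simp add: \<delta>_def)
  have c: "0 < c" using \<delta> t1_pos T_pos t0_pos by (simp add: c_def)
  have ivt: "\<exists>x. \<bar>x\<bar> \<le> b1 \<and> \<tau> x = T + r * \<delta>" if r: "r \<in> {0..1}" for r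
  proof -
    have ab: "\<bar>x * u\<bar> \<le> b1" if "x \<in> {0..1}" for x
      using mult_mono[of "\<bar>x\<bar>" 1 "\<bar>u\<bar>" b1] that u by (simp add: abs_mult)
    have "continuous_on {0..1} (\<lambda>x. (\<tau> (x * u) - T) / \<delta>)"
    proof (intro continuous_intros continuous_on_compose2[OF \<tau>_continuous])
      show "(\<lambda>x. x * u) ` {0..1} \<subseteq> {- b0..b0}"
      proof
        fix y assume "y \<in> (\<lambda>x. x * u) ` {0..1}"
        then obtain x where "y = x * u" "x \<in> {0..1}" by blast
        thus "y \<in> {- b0..b0}" using ab[of x] b1_le by auto
      qed
    qed (use \<delta> in auto)
    then obtain x where "0 \<le> x" "x \<le> 1" "(\<tau> (x * u) - T) / \<delta> = r"
      using IVT'[of "\<lambda>x. (\<tau> (x * u) - T) / \<delta>" 0 r 1] r \<delta> by (auto simp: \<tau>_0 \<delta>_def)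
    thus ?thesis using ab[of x] \<delta> by (intro exI[of _ "x * u"]) (auto simp: field_simps)
  qed
  have linear_growth
  proof (rule linear_growthI[of "m * t1 / 8" c "2 * (T + t0)", OF _ c])
    show "0 < m * t1 / 8" using m_pos t1_pos by simp
    fix t :: real assume t: "2 * (T + t0) \<le> t"
    define K where "K = nat \<lfloor>t / (T + t0)\<rfloor>"
    have Tt0: "0 < T + t0" using T_pos t0_pos by simp
    have K: "real K * (T + t0) \<le> t" "t / (2 * (T + t0)) \<le> real K"
    proof -
      have t2: "2 \<le> t / (T + t0)" using t Tt0 by (simp add: pos_le_divide_eq)
      hence "real K \<le> t / (T + t0)" "t / (T + t0) - 1 \<le> real K" unfolding K_def by linarith+
      thus "real K * (T + t0) \<le> t" using Tt0 by (simp add: pos_le_divide_eq)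
      have "t / (2 * (T + t0)) = (t / (T + t0)) / 2" by simp
      also have "\<dots> \<le> t / (T + t0) - 1"
      proof -
        have "x / 2 \<le> x - 1" if "2 \<le> x" for x :: real using that by linarith
        thus ?thesis using t2 .
      qed
      also have "\<dots> \<le> real K" by fact
      finally show "t / (2 * (T + t0)) \<le> real K" .
    qed
    \<comment> \<open>\<open>N\<close> gaps of size \<open>\<bar>\<delta>\<bar> / N\<close> are each
      amplified by \<open>K\<close> turns to at least \<open>t1 / 2\<close>. For
      \<open>N = 0\<close> the family is a single point.\<close>
    define N where "N = nat \<lfloor>2 * real K * \<bar>\<delta>\<bar> / t1\<rfloor>"
    have N: "real N \<le> 2 * real K * \<bar>\<delta>\<bar> / t1" "2 * real K * \<bar>\<delta>\<bar> / t1 \<le> real N + 1"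
      using t1_pos unfolding N_def by simp_all
    have "\<forall>i. \<exists>x. i \<le> N \<longrightarrow> \<bar>x\<bar> \<le> b1 \<and> \<tau> x = T + real i / real N * \<delta>"
    proof (intro allI)
      fix i
      show "\<exists>x. i \<le> N \<longrightarrow> \<bar>x\<bar> \<le> b1 \<and> \<tau> x = T + real i / real N * \<delta>"
        using ivt[of "real i / real N"] by (cases "i \<le> N") (auto simp: divide_le_eq)
    qed
    then obtain x where x: "\<And>i. i \<le> N \<Longrightarrow> \<bar>x i\<bar> \<le> b1"
      "\<And>i. i \<le> N \<Longrightarrow> \<tau> (x i) = T + real i / real N * \<delta>" by metis
    have sep: "t1 / 2 \<le> real K * \<bar>\<tau> (x i) - \<tau> (x j)\<bar>" if ij: "i \<le> N" "j \<le> N" "i \<noteq> j" for i j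
    proof -
      have N0: "0 < real N" using ij by simp
      have "t1 / 2 \<le> real K * (\<bar>\<delta>\<bar> / real N)" using N(1) N0 t1_pos by (simp add: field_simps)
      also have "\<dots> \<le> real K * (\<bar>\<delta>\<bar> / real N * \<bar>real i - real j\<bar>)"
      proof (intro mult_left_mono)
        have "1 \<le> \<bar>real i - real j\<bar>" using ij(3) by linarith
        thus "\<bar>\<delta>\<bar> / real N \<le> \<bar>\<delta>\<bar> / real N * \<bar>real i - real j\<bar>"
          using mult_left_mono[of 1 "\<bar>real i - real j\<bar>" "\<bar>\<delta>\<bar> / real N"] by simp
      qed simp
      also have "\<bar>\<delta>\<bar> / real N * \<bar>real i - real j\<bar> = \<bar>\<tau> (x i) - \<tau> (x j)\<bar>"
      proof -
        have "\<tau> (x i) - \<tau> (x j) = \<delta> / real N * (real i - real j)"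
          using x(2)[OF ij(1)] x(2)[OF ij(2)] by (simp add: algebra_simps diff_divide_distrib)
        thus ?thesis by (simp add: abs_mult)
      qed
      finally show ?thesis .
    qed
    have "c * t = 2 * (t / (2 * (T + t0))) * \<bar>\<delta>\<bar> / t1"
    proof -
      have "2 * (t / (2 * D)) * \<bar>\<delta>\<bar> / t1 = \<bar>\<delta>\<bar> / (t1 * D) * t" for D by (simp add: mult_ac)
      thus ?thesis unfolding c_def by (rule sym)
    qed
    also have "\<dots> \<le> 2 * real K * \<bar>\<delta>\<bar> / t1"
      using K(2) t1_pos by (intro divide_right_mono mult_right_mono mult_left_mono) auto
    also have "\<dots> \<le> real N + 1" by (rule N(2))
    finally have "c * t \<le> real N + 1" .
    moreover have "separated (m * t1 / 8) t (z (x i)) (z (x j))" if ij: "j \<le> N" "i < j" for i j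
      using x(1)[of i] x(1)[of j] b1_le ij
      by (intro shear_separated[OF _ return_id[OF lg] _ return_id[OF lg] K(1) sep]) auto
    ultimately show "\<exists>z n. c * t \<le> real n + 1 \<and> (\<forall>j\<le>n. \<forall>i<j. separated (m * t1 / 8) t (z i) (z j))"
      by (intro exI[of _ "\<lambda>i. z (x i)"] exI[of _ N]) auto
  qed
  thus False using lg by simp
qed

lemma period_locally_constant:
  assumes lg: "\<not> linear_growth" and q: "norm (q - p) \<le> b1 / slant"
  shows "\<Phi> T q = q + v"
proof -
  have "0 < slant" "1 \<le> slant" using M_pos m_pos by (simp_all add: add_pos_pos)
  hence q': "slant * norm (q - p) \<le> b1" "norm (q - p) \<le> slant * norm (q - p)"
    using q mult_right_mono[of 1 "slant" "norm (q - p)"] by (simp_all add: pos_le_divide_eq mult.commute)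
  hence near: "norm (q - p) \<le> rad" using b1_le b0_le by linarith
  define u where "u = \<sigma> * crd p q"
  have u: "\<bar>u\<bar> \<le> b1" using abs_crd_le[OF near] q'(1) by (simp add: u_def abs_\<sigma>)
  have foot: "\<Phi> (hit p q) q = z u"
    using foot_eq[OF near] by (simp add: foot_def z_def sec_def u_def \<sigma>_square)
  hence q_eq: "q = \<Phi> (- hit p q) (z u)" by (metis flow_inverse(1))
  have "\<Phi> T (z u) = z u + v" using return[of u] return_id[OF lg u] period_constant[OF lg u] u b1_le by simp
  hence "\<Phi> (- hit p q) (\<Phi> T (z u)) = q + v" using q_eq v by (simp add: flow_translate)
  thus ?thesis by (subst q_eq) (simp add: flow_add[symmetric] add.commute)
qed

end

context periodic_flow begin

lemma all_orbits_same_period: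
  assumes lg: "\<not> linear_growth" and v: "v \<in> int_vecs" and T: "0 < T" and per: "\<Phi> T p = p + v"
  shows "\<Phi> T x = x + v"
proof -
  define F where "F = {x. \<Phi> T x = x + v}"
  have "closed F" unfolding F_def by (intro closed_Collect_eq continuous_intros)
  moreover have "open F" unfolding open_contains_ball
  proof
    fix q assume "q \<in> F"
    then interpret periodic_point V \<Phi> L M m q v T 1 by unfold_locales (use v T in \<open>auto simp: F_def\<close>)
    have "0 < slant" using M_pos m_pos by (simp add: add_pos_pos)
    hence "0 < b1 / slant" using b1_pos by simp
    moreover have "ball q (b1 / slant) \<subseteq> F"
      using period_locally_constant[OF lg] by (auto simp: F_def dist_norm norm_minus_commute)
    ultimately show "\<exists>e>0. ball q e \<subseteq> F" by blast
  qed
  moreover have "F \<noteq> {}" using per unfolding F_def by blast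
  ultimately have "F = UNIV" using clopen by blast
  thus ?thesis by (auto simp: F_def)
qed

end

section \<open>Straightening a flow with a common period\<close>

lemma no_interior_max:
  fixes \<phi> :: "real \<Rightarrow> real"
  assumes cont: "continuous_on {a..b} \<phi>" and inj: "inj_on \<phi> {a..b}" and c: "a < c" "c < b"
    and max: "\<And>x. x \<in> {a..b} \<Longrightarrow> \<phi> x \<le> \<phi> c"
  shows False using continuous_inj_imp_mono[OF c cont inj] max[of a] max[of b] c by auto

text \<open>With equal end values, either an extremum lies in the interior, where local injectivity
  forces strict monotonicity, or the function is constant. Applied to the area along an arc, this
  carries injectivity from small to large scale.\<close>

lemma locally_injective_interval:
  fixes \<phi> :: "real \<Rightarrow> real"
  assumes cont: "continuous_on {0..1} \<phi>" and \<eta>: "0 < \<eta>"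
    and inj: "\<And>s t. s \<in> {0..1} \<Longrightarrow> t \<in> {0..1} \<Longrightarrow> \<bar>s - t\<bar> < \<eta> \<Longrightarrow> \<phi> s = \<phi> t \<Longrightarrow> s = t"
  shows "\<phi> 0 \<noteq> \<phi> 1"
proof
  assume eq: "\<phi> 0 = \<phi> 1"
  have no_max: False
    if \<psi>: "continuous_on {0..1} \<psi>" "\<And>s t. \<psi> s = \<psi> t \<longleftrightarrow> \<phi> s = \<phi> t" and c: "0 < c" "c < 1"
      and max: "\<And>x. x \<in> {0..1} \<Longrightarrow> \<psi> x \<le> \<psi> c" for \<psi> :: "real \<Rightarrow> real" and c
  proof -
    define h where "h = min (\<eta> / 3) (min (c / 2) ((1 - c) / 2))"
    have "0 < h" "h \<le> \<eta> / 3" "h \<le> c / 2" "h \<le> (1 - c) / 2"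
      unfolding h_def using \<eta> c by (simp, simp, simp, intro min.coboundedI2 order_refl)
    hence h: "0 < h" "2 * h < \<eta>" "0 \<le> c - h" "c + h \<le> 1" using \<eta> c
      by (linarith, linarith, linarith, simp add: field_simps)
    show False
    proof (rule no_interior_max[of "c - h" "c + h" \<psi> c])
      show "continuous_on {c - h..c + h} \<psi>" by (rule continuous_on_subset[OF \<psi>(1)]) (use h in auto)
      show "inj_on \<psi> {c - h..c + h}"
      proof (rule inj_onI)
        fix s t assume st: "s \<in> {c - h..c + h}" "t \<in> {c - h..c + h}" "\<psi> s = \<psi> t"
        have "\<phi> s = \<phi> t" using \<psi>(2) st(3) by blast
        moreover have "\<bar>s - t\<bar> < \<eta>" using st(1,2) h(2) unfolding atLeastAtMost_iff by linarith
        ultimately show "s = t" using st(1,2) h(3,4) unfolding atLeastAtMost_iff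
          by (intro inj[of s t]; simp)
      qed
    qed (use h max in auto)
  qed
  obtain a where a: "a \<in> {0..1}" "\<And>x. x \<in> {0..1} \<Longrightarrow> \<phi> x \<le> \<phi> a"
    using continuous_attains_sup[OF compact_Icc _ cont] by auto
  obtain b where b: "b \<in> {0..1}" "\<And>x. x \<in> {0..1} \<Longrightarrow> \<phi> b \<le> \<phi> x"
    using continuous_attains_inf[OF compact_Icc _ cont] by auto
  have "\<not> (0 < a \<and> a < 1)" using no_max[of \<phi> a, OF cont] a(2) by blast
  hence "\<phi> a = \<phi> 0" using a(1) eq by (cases "a = 0") auto
  moreover have "\<not> (0 < b \<and> b < 1)" using no_max[of "\<lambda>x. - \<phi> x" b] continuous_on_minus[OF cont] b(2) by auto
  hence "\<phi> b = \<phi> 0" using b(1) eq by (cases "b = 0") auto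
  ultimately have const: "\<phi> x = \<phi> 0" if "x \<in> {0..1}" for x using a(2)[OF that] b(2)[OF that] by simp
  have "min 1 (\<eta> / 2) \<in> {0..1}" using \<eta> by simp
  from inj[OF this _ _ const[OF this]] have "min 1 (\<eta> / 2) = 0" using \<eta> by simp
  thus False using \<eta> by (simp add: min_def split: if_splits)
qed

text \<open>As a function of the shift, the integral over the window has derivative
  \<open>q (T + t) - q t\<close>, which is the constant \<open>c\<close>.\<close>

lemma integral_shift_quasiperiodic:
  fixes q :: "real \<Rightarrow> real"
  assumes cont: "continuous_on UNIV q" and q: "\<And>x. q (T + x) = q x + c" and T: "0 \<le> T"
  shows "integral {0..T} (\<lambda>s. q (s + t)) = integral {0..T} q + c * t"
proof -
  define N where "N = \<bar>t\<bar> + T + 1"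
  obtain g where g: "\<And>x. x \<in> {-N..N} \<Longrightarrow> (g has_vector_derivative q x) (at x within {-N..N})"
    using antiderivative_continuous[of "-N" N q] continuous_on_subset[OF cont] by auto
  have gd: "(g has_vector_derivative q x) (at x)" if "\<bar>x\<bar> < N" for x
  proof -
    have "x \<in> interior {-N..N}" using that by (auto simp: interior_atLeastAtMost_real)
    thus ?thesis using g[of x] at_within_interior[of x "{-N..N}"] interior_subset by (metis subsetD)
  qed
  have int: "integral {0..T} (\<lambda>s. q (s + r)) = g (T + r) - g r" if r: "\<bar>r\<bar> \<le> \<bar>t\<bar>" for r
  proof -
    have "((\<lambda>s. q (s + r)) has_integral (g (T + r) - g (0 + r))) {0..T}"
    proof (rule fundamental_theorem_of_calculus[OF T])
      fix s assume s: "s \<in> {0..T}"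
      have "(g has_vector_derivative q (1 * s + r)) (at (1 * s + r))" using s r by (intro gd) (auto simp: N_def)
      from has_vector_derivative_affine[OF this]
      show "((\<lambda>s. g (s + r)) has_vector_derivative q (s + r)) (at s within {0..T})"
        by (simp add: has_vector_derivative_at_within)
    qed
    thus ?thesis by (simp add: integral_unique)
  qed
  define D where "D x = g (T + x) - g x - c * x" for x
  have "\<exists>C. \<forall>x\<in>{-\<bar>t\<bar>..\<bar>t\<bar>}. D x = C"
  proof (rule has_field_derivative_zero_constant)
    fix x assume x: "x \<in> {-\<bar>t\<bar>..\<bar>t\<bar>}"
    have "\<bar>T + x\<bar> < N" "\<bar>x\<bar> < N" using x T by (auto simp: N_def)
    hence "(g has_vector_derivative q (1 * x + T)) (at (1 * x + T))" "(g has_vector_derivative q x) (at x)"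
      by (auto intro!: gd simp: add.commute)
    from has_vector_derivative_affine[OF this(1)] this(2)
    have "((\<lambda>x. g (T + x)) has_real_derivative q (T + x)) (at x)" "(g has_real_derivative q x) (at x)"
      by (simp_all add: has_real_derivative_iff_has_vector_derivative add.commute)
    hence "(D has_real_derivative q (T + x) - q x - c) (at x)"
      unfolding D_def by (auto intro!: derivative_eq_intros)
    thus "(D has_real_derivative 0) (at x within {-\<bar>t\<bar>..\<bar>t\<bar>})"
      by (simp add: q has_field_derivative_at_within)
  qed simp
  then obtain C where "\<And>x. x \<in> {-\<bar>t\<bar>..\<bar>t\<bar>} \<Longrightarrow> D x = C" by blast
  moreover have "t \<in> {-\<bar>t\<bar>..\<bar>t\<bar>}" "0 \<in> {-\<bar>t\<bar>..\<bar>t\<bar>}" by (simp_all, linarith)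
  ultimately have "D t = C" "D 0 = C" by blast+
  hence "D t = D 0" by simp
  thus ?thesis using int[of t] int[of 0] by (simp add: D_def)
qed

locale closed_flow = periodic_flow +
  fixes T :: real and \<alpha> \<beta> \<mu> \<nu> k :: int
  assumes T_pos: "0 < T" and bezout: "\<alpha> * \<mu> + \<beta> * \<nu> = 1"
    and closed: "\<Phi> T x = x + (of_int (k * \<mu>), of_int (k * \<nu>))"
begin

definition v :: "real \<times> real" where "v = (of_int (k * \<mu>), of_int (k * \<nu>))"
text \<open>With \<open>Y\<close> an integral change of coordinates of determinant 1, which maps the
  displacement \<open>v\<close> to \<open>(k, 0)\<close> and preserves \<open>det2\<close> and the
  lattice.\<close>

definition X :: "real \<times> real \<Rightarrow> real" where "X w = of_int \<alpha> * fst w + of_int \<beta> * snd w"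
definition Y :: "real \<times> real \<Rightarrow> real" where "Y w = of_int \<mu> * snd w - of_int \<nu> * fst w"

lemma bezout_real: "real_of_int \<alpha> * of_int \<mu> + of_int \<beta> * of_int \<nu> = 1"
  using bezout by (metis of_int_1 of_int_add of_int_mult)

lemma v_int: "v \<in> int_vecs" unfolding v_def by (rule int_vecsI)

lemma closed': "\<Phi> T x = x + v" by (simp add: closed v_def)

lemma XY_linear: "X (a + b) = X a + X b" "X (a - b) = X a - X b" "Y (a + b) = Y a + Y b" "Y (a - b) = Y a - Y b"
  by (simp_all add: X_def Y_def algebra_simps)

lemma X_v: "X v = of_int k"
proof -
  have "X v = of_int k * (real_of_int \<alpha> * of_int \<mu> + of_int \<beta> * of_int \<nu>)"
    by (simp add: X_def v_def algebra_simps)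
  thus ?thesis by (simp add: bezout_real)
qed

lemma Y_v: "Y v = 0" by (simp add: Y_def v_def)

lemma X_bounded_linear: "bounded_linear X" and Y_bounded_linear: "bounded_linear Y"
  unfolding X_def[abs_def] Y_def[abs_def]
  by (intro bounded_linear_add bounded_linear_sub bounded_linear_const_mult bounded_linear_fst bounded_linear_snd)+

lemma XY_continuous [continuous_intros]:
  "continuous_on S g \<Longrightarrow> continuous_on S (\<lambda>x. X (g x))" "continuous_on S g \<Longrightarrow> continuous_on S (\<lambda>x. Y (g x))"
  unfolding X_def Y_def by (intro continuous_intros; assumption)+

lemma XY_det2: "X a * Y b - Y a * X b = det2 a b"
proof -
  have "X a * Y b - Y a * X b = (real_of_int \<alpha> * of_int \<mu> + of_int \<beta> * of_int \<nu>) * det2 a b"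
    by (simp add: X_def Y_def det2_def algebra_simps)
  thus ?thesis by (simp add: bezout_real)
qed

text \<open>\<open>area\<close> is the integral of the one-form \<open>Y dX\<close> over one period: up to a constant, the area below the orbit.\<close>

definition area :: "real \<times> real \<Rightarrow> real" where
  "area x = integral {0..T} (\<lambda>s. Y (\<Phi> s x) * X (V (\<Phi> s x)))"

definition phase :: "real \<times> real \<Rightarrow> real" where
  "phase x = integral {0..T} (\<lambda>s. X (\<Phi> s x)) / T"

lemma area_flow: "area (\<Phi> t x) = area x"
proof -
  have "integral {0..T} (\<lambda>s. Y (\<Phi> (s + t) x) * X (V (\<Phi> (s + t) x)))
      = integral {0..T} (\<lambda>s. Y (\<Phi> s x) * X (V (\<Phi> s x))) + 0 * t"
  proof (rule integral_shift_quasiperiodic)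
    show "Y (\<Phi> (T + s) x) * X (V (\<Phi> (T + s) x)) = Y (\<Phi> s x) * X (V (\<Phi> s x)) + 0" for s
      by (simp add: flow_add closed' V_periodic v_int XY_linear Y_v)
  qed (use T_pos in \<open>auto intro!: continuous_intros\<close>)
  thus ?thesis by (simp add: area_def flow_add)
qed

lemma phase_flow: "phase (\<Phi> t x) = phase x + of_int k * t / T"
proof -
  have "integral {0..T} (\<lambda>s. X (\<Phi> (s + t) x)) = integral {0..T} (\<lambda>s. X (\<Phi> s x)) + of_int k * t"
  proof (rule integral_shift_quasiperiodic)
    show "X (\<Phi> (T + s) x) = X (\<Phi> s x) + of_int k" for s by (simp add: flow_add closed' XY_linear X_v)
  qed (use T_pos in \<open>auto intro!: continuous_intros\<close>)
  thus ?thesis by (simp add: phase_def flow_add add_divide_distrib)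
qed

lemma X_flow_deriv: "((\<lambda>s. X (\<Phi> s x)) has_vector_derivative X (V (\<Phi> s x))) (at s)"
  and Y_flow_deriv: "((\<lambda>s. Y (\<Phi> s x)) has_vector_derivative Y (V (\<Phi> s x))) (at s)"
  by (rule bounded_linear.has_vector_derivative[OF X_bounded_linear flow_deriv[of x s]],
      rule bounded_linear.has_vector_derivative[OF Y_bounded_linear flow_deriv[of x s]])

lemma area_translate:
  assumes l: "l \<in> int_vecs"
  shows "area (x + l) = area x + of_int k * Y l"
proof -
  have "((\<lambda>s. X (V (\<Phi> s x))) has_integral (X (\<Phi> T x) - X (\<Phi> 0 x))) {0..T}"
    by (rule fundamental_theorem_of_calculus, use T_pos in simp,
        rule has_vector_derivative_at_within, rule X_flow_deriv)
  hence 1: "integral {0..T} (\<lambda>s. X (V (\<Phi> s x))) = of_int k"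
    by (simp add: integral_unique closed' XY_linear X_v)
  have "area (x + l) = integral {0..T} (\<lambda>s. Y (\<Phi> s x) * X (V (\<Phi> s x)) + Y l * X (V (\<Phi> s x)))"
    by (simp add: area_def flow_translate V_periodic l XY_linear distrib_right)
  also have "\<dots> = area x + Y l * integral {0..T} (\<lambda>s. X (V (\<Phi> s x)))"
    unfolding area_def by (subst integral_add) (auto intro!: integrable_continuous_real continuous_intros)
  finally show ?thesis by (simp add: 1)
qed

lemma phase_translate:
  assumes l: "l \<in> int_vecs"
  shows "phase (x + l) = phase x + X l"
proof -
  have "integral {0..T} (\<lambda>s. X (\<Phi> s (x + l))) = integral {0..T} (\<lambda>s. X (\<Phi> s x) + X l)"
    by (simp add: flow_translate l XY_linear)
  also have "\<dots> = integral {0..T} (\<lambda>s. X (\<Phi> s x)) + T * X l"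
    using T_pos by (subst integral_add) (auto intro!: integrable_continuous_real continuous_intros)
  finally show ?thesis using T_pos by (simp add: phase_def add_divide_distrib)
qed

lemma area_continuous: "continuous_on S area" and phase_continuous: "continuous_on S phase"
proof -
  have "continuous_on S (\<lambda>x. integral (cbox 0 T) (\<lambda>s. Y (\<Phi> s x) * X (V (\<Phi> s x))))"
    by (rule integral_continuous_on_param) (auto simp: case_prod_beta' intro!: continuous_intros)
  thus "continuous_on S area" by (simp add: area_def[abs_def])
  have "continuous_on S (\<lambda>x. integral (cbox 0 T) (\<lambda>s. X (\<Phi> s x)))"
    by (rule integral_continuous_on_param) (auto simp: case_prod_beta' intro!: continuous_intros)
  thus "continuous_on S phase" using T_pos by (auto simp: phase_def[abs_def] intro!: continuous_intros)
qed

text \<open>Integration by parts turns the difference of the two areas into a bilinear main term plus a quadratic error.\<close>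

lemma area_difference:
  "area z - area p = integral {0..T} (\<lambda>s. det2 (V (\<Phi> s p)) (\<Phi> s z - \<Phi> s p)
      + Y (\<Phi> s z - \<Phi> s p) * X (V (\<Phi> s z) - V (\<Phi> s p)))"
proof -
  define d where "d s = \<Phi> s z - \<Phi> s p" for s
  have deriv: "((\<lambda>s. Y (\<Phi> s p) * X (d s)) has_vector_derivative
      (Y (V (\<Phi> s p)) * X (d s) + Y (\<Phi> s p) * X (V (\<Phi> s z) - V (\<Phi> s p)))) (at s)" for s
  proof -
    have "((\<lambda>s. Y (\<Phi> s p) * (X (\<Phi> s z) - X (\<Phi> s p))) has_vector_derivative
      (Y (\<Phi> s p) * (X (V (\<Phi> s z)) - X (V (\<Phi> s p))) + Y (V (\<Phi> s p)) * (X (\<Phi> s z) - X (\<Phi> s p)))) (at s)"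
      by (intro has_vector_derivative_mult has_vector_derivative_diff X_flow_deriv Y_flow_deriv)
    thus ?thesis by (simp add: d_def XY_linear add.commute)
  qed
  have "((\<lambda>s. Y (V (\<Phi> s p)) * X (d s) + Y (\<Phi> s p) * X (V (\<Phi> s z) - V (\<Phi> s p))) has_integral
      (Y (\<Phi> T p) * X (d T) - Y (\<Phi> 0 p) * X (d 0))) {0..T}"
    by (rule fundamental_theorem_of_calculus, use T_pos in simp,
        rule has_vector_derivative_at_within, rule deriv)
  moreover have "Y (\<Phi> T p) * X (d T) - Y (\<Phi> 0 p) * X (d 0) = 0" by (simp add: d_def closed' XY_linear Y_v)
  ultimately have zero: "integral {0..T} (\<lambda>s. Y (V (\<Phi> s p)) * X (d s) + Y (\<Phi> s p) * X (V (\<Phi> s z) - V (\<Phi> s p))) = 0"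
    by (simp add: integral_unique)
  have "area z - area p = integral {0..T} (\<lambda>s. Y (\<Phi> s z) * X (V (\<Phi> s z)) - Y (\<Phi> s p) * X (V (\<Phi> s p)))"
    unfolding area_def by (subst integral_diff) (auto intro!: integrable_continuous_real continuous_intros)
  also have "\<dots> = integral {0..T} (\<lambda>s. Y (\<Phi> s z) * X (V (\<Phi> s z)) - Y (\<Phi> s p) * X (V (\<Phi> s p)))
      - integral {0..T} (\<lambda>s. Y (V (\<Phi> s p)) * X (d s) + Y (\<Phi> s p) * X (V (\<Phi> s z) - V (\<Phi> s p)))"
    by (simp add: zero)
  also have "\<dots> = integral {0..T} (\<lambda>s. (Y (\<Phi> s z) * X (V (\<Phi> s z)) - Y (\<Phi> s p) * X (V (\<Phi> s p)))
      - (Y (V (\<Phi> s p)) * X (d s) + Y (\<Phi> s p) * X (V (\<Phi> s z) - V (\<Phi> s p))))"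
    unfolding d_def by (intro integral_diff[symmetric]) (auto intro!: integrable_continuous_real continuous_intros)
  also have "\<dots> = integral {0..T} (\<lambda>s. det2 (V (\<Phi> s p)) (d s) + Y (d s) * X (V (\<Phi> s z) - V (\<Phi> s p)))"
    unfolding XY_det2[symmetric] d_def XY_linear by (intro arg_cong[of _ _ "integral {0..T}"] ext) (simp add: algebra_simps)
  finally show ?thesis by (simp add: d_def)
qed

end

section \<open>Width, displacement and area between two orbits\<close>

context periodic_flow begin

lemma flow_second_order: "norm (\<Phi> r y - y - r *\<^sub>R V y) \<le> L * M * r\<^sup>2"
proof -
  have "norm ((\<Phi> r y - r *\<^sub>R V y) - (\<Phi> 0 y - 0 *\<^sub>R V y)) \<le> (L * (M * \<bar>r\<bar>)) * norm (r - 0)"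
  proof (rule differentiable_bound[of "closed_segment 0 r" "\<lambda>s. \<Phi> s y - s *\<^sub>R V y" "\<lambda>s h. h *\<^sub>R (V (\<Phi> s y) - V y)"])
    fix s assume s: "s \<in> closed_segment 0 r"
    have "((\<lambda>s. \<Phi> s y - s *\<^sub>R V y) has_vector_derivative V (\<Phi> s y) - V y) (at s)"
      by (auto intro!: derivative_eq_intros flow_deriv)
    thus "((\<lambda>s. \<Phi> s y - s *\<^sub>R V y) has_derivative (\<lambda>h. h *\<^sub>R (V (\<Phi> s y) - V y))) (at s within closed_segment 0 r)"
      by (simp add: has_vector_derivative_def has_derivative_at_withinI)
    have "\<bar>s\<bar> \<le> \<bar>r\<bar>" using s by (auto simp: closed_segment_eq_real_ivl split: if_splits)
    hence "M * \<bar>s\<bar> \<le> M * \<bar>r\<bar>" using M_pos by simp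
    hence "norm (\<Phi> s y - y) \<le> M * \<bar>r\<bar>" using flow_speed_0[of s y] by linarith
    hence "norm (V (\<Phi> s y) - V y) \<le> L * (M * \<bar>r\<bar>)"
      using V_lipschitz[of "\<Phi> s y" y] mult_left_mono[of "norm (\<Phi> s y - y)" "M * \<bar>r\<bar>" L] L_pos by linarith
    thus "onorm (\<lambda>h. h *\<^sub>R (V (\<Phi> s y) - V y)) \<le> L * (M * \<bar>r\<bar>)"
      by (intro onorm_le) (simp add: mult.commute[of _ "\<bar>_\<bar>"] mult_left_mono)
  qed auto
  thus ?thesis by (simp add: power2_eq_square algebra_simps)
qed

text \<open>Flowing the foot back by time \<open>s\<close> lands on the orbit of \<open>z\<close>
  near \<open>p\<close>, at a distance controlled by the width. The remaining lag \<open>r\<close>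
  is bounded by the same distance, which accounts for the factor \<open>slant\<close>.\<close>

lemma width_ge:
  assumes near: "norm (\<Phi> s z - \<Phi> s p) \<le> rad" and z: "norm (z - p) \<le> rad" "(z - p) \<bullet> V p = 0"
    and s: "0 \<le> s" "s \<le> T"
  shows "m * norm (z - p) \<le> exp (L * T) * slant * \<bar>width p z s\<bar>"
proof -
  define r where "r = hit (\<Phi> s p) (\<Phi> s z)"
  define w where "w = foot (\<Phi> s p) (\<Phi> s z)"
  have r: "\<bar>r\<bar> \<le> t1" using hit_abs_le[OF near] t0_pos by (simp add: r_def t0_def)
  have wr: "\<Phi> (- s) w = \<Phi> r z" by (simp add: w_def r_def foot_def flow_add[symmetric])
  have "norm (\<Phi> r z - p) = norm (\<Phi> (- s) w - \<Phi> (- s) (\<Phi> s p))" by (simp add: wr)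
  also have "\<dots> \<le> exp (L * T) * norm (w - \<Phi> s p)" using s by (intro flow_lipschitz_le) auto
  finally have 1: "norm (\<Phi> r z - p) \<le> exp (L * T) * norm (w - \<Phi> s p)" .
  have "\<bar>r\<bar> \<le> 2 / m * norm (\<Phi> r z - p)" using time_le_dist[of z p 0 r p] r t1_pos z rad_le by simp
  hence "M * \<bar>r\<bar> \<le> M * (2 / m * norm (\<Phi> r z - p))" using M_pos by (intro mult_left_mono) auto
  moreover have "norm (z - p) \<le> norm (\<Phi> r z - p) + norm (\<Phi> r z - z)"
    using norm_triangle_ineq4[of "\<Phi> r z - p" "\<Phi> r z - z"] by simp
  ultimately have "norm (z - p) \<le> slant * norm (\<Phi> r z - p)"
    using flow_speed_0[of r z] by (simp add: algebra_simps)
  also have "\<dots> \<le> slant * (exp (L * T) * norm (w - \<Phi> s p))"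
    using 1 M_pos m_pos by (intro mult_left_mono) auto
  finally have "m * norm (z - p) \<le> m * (slant * (exp (L * T) * norm (w - \<Phi> s p)))"
    using m_pos by (intro mult_left_mono) auto
  also have "\<dots> = exp (L * T) * slant * (m * norm (w - \<Phi> s p))" by simp
  also have "\<dots> \<le> exp (L * T) * slant * (norm (V (\<Phi> s p)) * norm (w - \<Phi> s p))"
    using M_pos m_pos by (intro mult_left_mono mult_right_mono V_ge) auto
  also have "norm (V (\<Phi> s p)) * norm (w - \<Phi> s p) = \<bar>width p z s\<bar>"
    unfolding width_def w_def using foot_orthogonal[OF near]
    by (intro abs_det2_orthogonal[symmetric]) (simp add: inner_commute)
  finally show ?thesis .
qed

text \<open>The displacement and its foot differ by a short orbit piece, which is parallel to the
  field up to second order; its determinant with the field is therefore quadratically small.\<close>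

lemma det2_width:
  assumes near: "norm (\<Phi> s z - \<Phi> s p) \<le> rad"
  shows "\<bar>det2 (V (\<Phi> s p)) (\<Phi> s z - \<Phi> s p) - width p z s\<bar>
     \<le> M * L * (4 * M / m\<^sup>2 + 2 / m) * (norm (\<Phi> s z - \<Phi> s p))\<^sup>2"
proof -
  define y q where "y = \<Phi> s z" "q = \<Phi> s p"
  define r d where "r = hit q y" "d = norm (y - q)"
  have r: "\<bar>r\<bar> \<le> 2 / m * d" using hit_le[OF near] by (simp add: y_q_def r_d_def)
  have "det2 (V q) (\<Phi> r y - y) = det2 (V q) ((\<Phi> r y - y - r *\<^sub>R V y) + r *\<^sub>R (V y - V q)) + r * det2 (V q) (V q)"
    by (simp add: det2_linear[symmetric] scaleR_diff_right)
  hence eq: "det2 (V q) (\<Phi> r y - y) = det2 (V q) ((\<Phi> r y - y - r *\<^sub>R V y) + r *\<^sub>R (V y - V q))"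
    by (simp add: det2_linear)
  have "norm ((\<Phi> r y - y - r *\<^sub>R V y) + r *\<^sub>R (V y - V q)) \<le> L * M * r\<^sup>2 + \<bar>r\<bar> * (L * d)"
  proof (rule norm_triangle_le, rule add_mono)
    have "\<bar>r\<bar> * norm (V y - V q) \<le> \<bar>r\<bar> * (L * d)"
      unfolding r_d_def by (intro mult_left_mono V_lipschitz) auto
    thus "norm (r *\<^sub>R (V y - V q)) \<le> \<bar>r\<bar> * (L * d)" by simp
  qed (rule flow_second_order)
  also have "\<dots> \<le> L * M * (2 / m * d)\<^sup>2 + (2 / m * d) * (L * d)"
    using r L_pos M_pos m_pos by (intro add_mono mult_left_mono mult_right_mono power2_le_iff_abs_le[THEN iffD2])
      (auto simp: r_d_def)
  also have "\<dots> = L * (4 * M / m\<^sup>2 + 2 / m) * d\<^sup>2" by (simp add: power2_eq_square algebra_simps)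
  finally have "\<bar>det2 (V q) (\<Phi> r y - y)\<bar> \<le> norm (V q) * (L * (4 * M / m\<^sup>2 + 2 / m) * d\<^sup>2)"
    unfolding eq by (meson abs_det2_le mult_left_mono norm_ge_zero order_trans)
  also have "\<dots> \<le> M * (L * (4 * M / m\<^sup>2 + 2 / m) * d\<^sup>2)"
    using L_pos M_pos m_pos by (intro mult_right_mono V_le) auto
  finally have "\<bar>det2 (V q) (\<Phi> r y - y)\<bar> \<le> M * L * (4 * M / m\<^sup>2 + 2 / m) * d\<^sup>2" by (simp add: mult.assoc)
  moreover have "width p z s - det2 (V q) (y - q) = det2 (V q) (\<Phi> r y - y)"
    by (simp add: width_def foot_def y_q_def r_d_def det2_linear)
  ultimately show ?thesis by (simp add: y_q_def r_d_def abs_minus_commute)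
qed

end

context closed_flow begin

text \<open>The integrand in \<open>area_difference\<close> is the width up to an error quadratic in
  the distance, and the width has constant sign and at least linear size. The choice
  \<open>A / (2 * C)\<close> makes the error at most half of the main term, so the integral cannot
  vanish; \<open>rad / E\<close> keeps the orbits close for the whole period.\<close>

lemma area_injective_on_sections:
  obtains d where "0 < d" "d \<le> rad"
    "\<And>z p. norm (z - p) \<le> d \<Longrightarrow> (z - p) \<bullet> V p = 0 \<Longrightarrow> area z = area p \<Longrightarrow> z = p"
proof -
  obtain cX cY where c: "0 < cX" "\<And>w. norm (X w) \<le> norm w * cX" "0 < cY" "\<And>w. norm (Y w) \<le> norm w * cY"
    using bounded_linear.pos_bounded[OF X_bounded_linear] bounded_linear.pos_bounded[OF Y_bounded_linear] by metis
  define E where "E = exp (L * T)"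
  define A where "A = m / (E * slant)"
  define C where "C = (M * L * (4 * M / m\<^sup>2 + 2 / m) + cY * (cX * L)) * E\<^sup>2"
  have E: "1 \<le> E" using L_pos T_pos by (simp add: E_def)
  have pos: "0 < E * slant" using E M_pos m_pos by (simp add: add_pos_pos)
  have A: "0 < A" using pos m_pos by (simp add: A_def)
  have C: "0 < C" using E M_pos m_pos L_pos c by (simp add: C_def add_pos_pos)
  define d where "d = min (rad / E) (A / (2 * C))"
  show ?thesis
  proof (rule that)
    show "0 < d" using E rad_pos A C by (simp add: d_def)
    have "rad / E \<le> rad" using E rad_pos by (simp add: divide_le_eq)
    thus d_le: "d \<le> rad" by (simp add: d_def)
    fix z p assume zp: "norm (z - p) \<le> d" "(z - p) \<bullet> V p = 0" "area z = area p"
    show "z = p"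
    proof (rule ccontr)
      assume neq: "z \<noteq> p"
      define \<delta> where "\<delta> = norm (z - p)"
      have \<delta>: "0 < \<delta>" "\<delta> \<le> d" "\<delta> \<le> rad" using neq zp d_le by (auto simp: \<delta>_def)
      have dist: "norm (\<Phi> s z - \<Phi> s p) \<le> E * \<delta>" if "s \<in> {0..T}" for s
        unfolding E_def \<delta>_def using that by (intro flow_lipschitz_le) auto
      have "E * \<delta> \<le> rad" using \<delta>(2) E by (simp add: d_def pos_le_divide_eq mult.commute)
      hence near: "norm (\<Phi> s z - \<Phi> s p) \<le> rad" if "s \<in> {0..T}" for s using dist[OF that] by linarith
      define \<sigma> where "\<sigma> = sgn (width p z 0)"
      have \<sigma>: "\<sigma> * width p z s = \<bar>width p z s\<bar>" "\<bar>\<sigma>\<bar> = 1" if s: "s \<in> {0..T}" for s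
      proof -
        have "0 < width p z 0 * width p z s"
          using near neq zp s by (intro width_same_sign[of T]) auto
        thus "\<sigma> * width p z s = \<bar>width p z s\<bar>" "\<bar>\<sigma>\<bar> = 1"
          by (auto simp: \<sigma>_def zero_less_mult_iff)
      qed
      define q where "q s = det2 (V (\<Phi> s p)) (\<Phi> s z - \<Phi> s p)
        + Y (\<Phi> s z - \<Phi> s p) * X (V (\<Phi> s z) - V (\<Phi> s p))" for s
      have q_ge: "A * \<delta> / 2 \<le> \<sigma> * q s" if s: "s \<in> {0..T}" for s
      proof -
        have sw: "A * \<delta> \<le> \<bar>width p z s\<bar>" using width_ge[OF near[OF s], of T] \<delta>(3) zp(2) s pos
          by (simp add: A_def E_def \<delta>_def field_simps)
        have sq: "(norm (\<Phi> s z - \<Phi> s p))\<^sup>2 \<le> E\<^sup>2 * \<delta>\<^sup>2"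
          using power_mono[OF dist[OF s], of 2] by (simp add: power_mult_distrib)
        have "\<bar>det2 (V (\<Phi> s p)) (\<Phi> s z - \<Phi> s p) - width p z s\<bar>
            \<le> M * L * (4 * M / m\<^sup>2 + 2 / m) * (norm (\<Phi> s z - \<Phi> s p))\<^sup>2"
          by (rule det2_width[OF near[OF s]])
        also have "\<dots> \<le> M * L * (4 * M / m\<^sup>2 + 2 / m) * (E\<^sup>2 * \<delta>\<^sup>2)"
          using sq M_pos L_pos m_pos by (intro mult_left_mono) auto
        finally have 1: "\<bar>det2 (V (\<Phi> s p)) (\<Phi> s z - \<Phi> s p) - width p z s\<bar>
          \<le> M * L * (4 * M / m\<^sup>2 + 2 / m) * (E\<^sup>2 * \<delta>\<^sup>2)" .
        have "\<bar>X (V (\<Phi> s z) - V (\<Phi> s p))\<bar> \<le> norm (V (\<Phi> s z) - V (\<Phi> s p)) * cX" using c(2) by simp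
        also have "\<dots> \<le> (L * norm (\<Phi> s z - \<Phi> s p)) * cX" using c(1) by (intro mult_right_mono V_lipschitz) auto
        finally have "\<bar>Y (\<Phi> s z - \<Phi> s p) * X (V (\<Phi> s z) - V (\<Phi> s p))\<bar>
            \<le> (norm (\<Phi> s z - \<Phi> s p) * cY) * ((L * norm (\<Phi> s z - \<Phi> s p)) * cX)"
          unfolding abs_mult using c(3,4) by (intro mult_mono) auto
        also have "\<dots> = cY * (cX * L) * (norm (\<Phi> s z - \<Phi> s p))\<^sup>2" by (simp add: power2_eq_square)
        also have "\<dots> \<le> cY * (cX * L) * (E\<^sup>2 * \<delta>\<^sup>2)" using sq c L_pos by (intro mult_left_mono) auto
        finally have "\<bar>q s - width p z s\<bar> \<le> C * \<delta>\<^sup>2"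
          using 1 unfolding q_def C_def by (simp add: distrib_right distrib_left mult.assoc) 
        also have "C * \<delta>\<^sup>2 \<le> A * \<delta> / 2"
        proof -
          have "C * \<delta> \<le> A / 2" using \<delta>(2) C by (simp add: d_def field_simps)
          thus ?thesis using mult_right_mono[of "C * \<delta>" "A / 2" \<delta>] \<delta>(1) by (simp add: power2_eq_square)
        qed
        finally have "\<bar>\<sigma> * (q s - width p z s)\<bar> \<le> A * \<delta> / 2" using \<sigma>(2)[OF s] by (simp add: abs_mult)
        hence "- (A * \<delta> / 2) \<le> \<sigma> * q s - \<sigma> * width p z s" unfolding right_diff_distrib by linarith
        thus ?thesis using sw \<sigma>(1)[OF s] by linarith
      qed
      have cont: "continuous_on {0..T} q" unfolding q_def det2_def by (intro continuous_intros)
      have "A * \<delta> / 2 * T = integral {0..T} (\<lambda>s. A * \<delta> / 2)" using T_pos by simp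
      also have "\<dots> \<le> integral {0..T} (\<lambda>s. \<sigma> * q s)"
        using q_ge by (intro integral_le integrable_continuous_real continuous_intros cont) auto
      also have "\<dots> = \<sigma> * (area z - area p)" by (simp add: area_difference q_def)
      also have "\<dots> = 0" using zp by simp
      finally show False using A \<delta> T_pos by (simp add: mult_le_0_iff)
    qed
  qed
qed

lemma area_locally_injective:
  obtains d where "0 < d" "d \<le> rad"
    "\<And>z p. norm (z - p) \<le> d \<Longrightarrow> area z = area p \<Longrightarrow> \<exists>r. \<bar>r\<bar> \<le> t0 \<and> \<Phi> r z = p"
proof -
  obtain d0 where d0: "0 < d0" "d0 \<le> rad"
    "\<And>z p. norm (z - p) \<le> d0 \<Longrightarrow> (z - p) \<bullet> V p = 0 \<Longrightarrow> area z = area p \<Longrightarrow> z = p"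
    using area_injective_on_sections by blast
  have M: "0 < slant" "1 \<le> slant" using M_pos m_pos by (simp_all add: add_pos_pos)
  show ?thesis
  proof (rule that)
    show "0 < d0 / slant" using d0 M by simp
    have "d0 \<le> d0 * slant" using mult_left_mono[OF M(2), of d0] d0(1) by simp
    thus le: "d0 / slant \<le> rad" using d0 M by (auto simp: pos_divide_le_eq intro: order_trans)
    fix z p assume zp: "norm (z - p) \<le> d0 / slant" "area z = area p"
    have near: "norm (z - p) \<le> rad" using zp le by linarith
    have "norm (foot p z - p) \<le> slant * norm (z - p)" by (rule foot_dist[OF near])
    also have "\<dots> \<le> slant * (d0 / slant)" using zp M by (intro mult_left_mono) auto
    also have "\<dots> = d0" using M by simp
    finally have "norm (foot p z - p) \<le> d0" .
    hence "foot p z = p"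
      using foot_orthogonal[OF near] zp(2) by (intro d0(3)) (auto simp: foot_def area_flow)
    thus "\<exists>r. \<bar>r\<bar> \<le> t0 \<and> \<Phi> r z = p" using hit_abs_le[OF near] by (auto simp: foot_def)
  qed
qed

text \<open>For \<open>k = 0\<close> the area is doubly periodic and attains a maximum. Along the
  section through the maximal point it is continuous and injective, hence strictly monotone, a
  contradiction.\<close>

lemma k_nonzero: "k \<noteq> 0"
proof
  assume k: "k = 0"
  obtain p where p: "p \<in> cbox (0, 0) (1, 1)" "\<And>x. x \<in> cbox (0, 0) (1, 1) \<Longrightarrow> area x \<le> area p"
    using continuous_attains_sup[OF compact_cbox _ area_continuous, of "(0, 0)" "(1, 1)"] by (auto simp: cbox_Pair_eq)
  have max: "area x \<le> area p" for x
  proof -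
    obtain \<kappa> where \<kappa>: "\<kappa> \<in> int_vecs" "x - \<kappa> \<in> cbox (0, 0) (1, 1)" by (rule int_vecs_translate_into_square)
    have "area x = area (x - \<kappa>)" using area_translate[OF \<kappa>(1), of "x - \<kappa>"] k by simp
    thus ?thesis using p(2)[OF \<kappa>(2)] by simp
  qed
  obtain d where d: "0 < d" "d \<le> rad"
    "\<And>z p. norm (z - p) \<le> d \<Longrightarrow> area z = area p \<Longrightarrow> \<exists>r. \<bar>r\<bar> \<le> t0 \<and> \<Phi> r z = p"
    using area_locally_injective by blast
  show False
  proof (rule no_interior_max[of "- (d / 2)" "d / 2" "\<lambda>u. area (sec p u)" 0])
    show "continuous_on {- (d / 2)..d / 2} (\<lambda>u. area (sec p u))"
      by (intro continuous_on_compose2[OF area_continuous[of UNIV]] continuous_intros) auto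
    show "inj_on (\<lambda>u. area (sec p u)) {- (d / 2)..d / 2}"
    proof (rule inj_onI)
      fix u u' assume u: "u \<in> {- (d / 2)..d / 2}" "u' \<in> {- (d / 2)..d / 2}"
        "area (sec p u) = area (sec p u')"
      have "\<bar>u - u'\<bar> \<le> d" using u(1,2) by auto
      then obtain r where r: "\<bar>r\<bar> \<le> t0" "\<Phi> r (sec p u) = sec p u'"
        using d(3)[of "sec p u" "sec p u'"] u(3) by (auto simp: dist_sec)
      have "sec p u' = sec p u"
        using same_orbit_on_section[of "sec p u" p "sec p u'" 0 r] r u(1,2) d(1,2) t0_pos
        by (auto simp: t0_def)
      thus "u = u'" by (simp add: sec_inj)
    qed
    show "area (sec p x) \<le> area (sec p 0)" for x using max[of "sec p x"] by (simp add: sec_def[of p 0])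
  qed (use d in auto)
qed

section \<open>The straightening homeomorphism of the plane\<close>

definition straighten :: "real \<times> real \<Rightarrow> real \<times> real" where
  "straighten x = (phase x, area x / of_int k)"

lemma straighten_continuous: "continuous_on S straighten"
  unfolding straighten_def[abs_def] by (intro continuous_intros area_continuous phase_continuous) (simp add: k_nonzero)

lemma straighten_flow: "straighten (\<Phi> t x) = straighten x + (of_int k * t / T, 0)"
  by (simp add: straighten_def phase_flow area_flow)

lemma straighten_translate: "\<kappa> \<in> int_vecs \<Longrightarrow> straighten (x + \<kappa>) = straighten x + (X \<kappa>, Y \<kappa>)"
  by (simp add: straighten_def phase_translate area_translate k_nonzero add_divide_distrib)

lemma XY_int: "\<kappa> \<in> int_vecs \<Longrightarrow> (X \<kappa>, Y \<kappa>) \<in> int_vecs"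
proof (elim int_vecsE)
  fix i j :: int assume "\<kappa> = (of_int i, of_int j)"
  hence "(X \<kappa>, Y \<kappa>) = (of_int (\<alpha> * i + \<beta> * j), of_int (\<mu> * j - \<nu> * i))" by (simp add: X_def Y_def)
  thus "(X \<kappa>, Y \<kappa>) \<in> int_vecs" by (metis int_vecsI)
qed

lemma XY_surj:
  assumes "l \<in> int_vecs"
  obtains \<kappa> where "\<kappa> \<in> int_vecs" "(X \<kappa>, Y \<kappa>) = l"
proof -
  obtain i j :: int where l: "l = (of_int i, of_int j)" using assms by (rule int_vecsE)
  define \<kappa> :: "real \<times> real" where "\<kappa> = (of_int (\<mu> * i - \<beta> * j), of_int (\<nu> * i + \<alpha> * j))"
  have "X \<kappa> = (real_of_int \<alpha> * of_int \<mu> + of_int \<beta> * of_int \<nu>) * of_int i"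
    "Y \<kappa> = (real_of_int \<alpha> * of_int \<mu> + of_int \<beta> * of_int \<nu>) * of_int j"
    by (simp_all add: X_def Y_def \<kappa>_def algebra_simps)
  hence "(X \<kappa>, Y \<kappa>) = l" by (simp add: bezout_real l)
  moreover have "\<kappa> \<in> int_vecs" unfolding \<kappa>_def by (rule int_vecsI)
  ultimately show ?thesis using that by blast
qed

text \<open>The zero set of \<open>phase\<close> meets every orbit exactly once and is a retract of the plane. Along an arc in it
  \<open>area\<close> is locally injective, hence it takes different values at the end points.\<close>

lemma straighten_inj: "inj straighten"
proof (rule injI)
  fix z w assume eq: "straighten z = straighten w"
  define ret where "ret x = \<Phi> (- (phase x * T / of_int k)) x" for x
  define S where "S = range ret"
  have ph: "phase z = phase w" and ar: "area z = area w" using eq by (auto simp: straighten_def k_nonzero)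
  have phase_ret: "phase (ret x) = 0" for x unfolding ret_def phase_flow using T_pos k_nonzero by simp
  have area_ret: "area (ret x) = area x" for x by (simp add: ret_def area_flow)
  have "continuous_on UNIV ret"
    unfolding ret_def using k_nonzero by (intro continuous_intros phase_continuous) auto
  hence "path_connected S" unfolding S_def
    by (intro path_connected_continuous_image convex_imp_path_connected) auto
  obtain d where d: "0 < d" "d \<le> rad"
    "\<And>z p. norm (z - p) \<le> d \<Longrightarrow> area z = area p \<Longrightarrow> \<exists>r. \<bar>r\<bar> \<le> t0 \<and> \<Phi> r z = p"
    using area_locally_injective by blast
  have inj_S: "a = b" if ab: "a \<in> S" "b \<in> S" "norm (a - b) \<le> d" "area a = area b" for a b
  proof -
    obtain r where r: "\<Phi> r a = b" using d(3) ab by blast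
    have "phase a = 0" "phase b = 0" using ab(1,2) phase_ret by (auto simp: S_def)
    hence "of_int k * r / T = 0" using phase_flow[of r a] r by simp
    hence "r = 0" using k_nonzero T_pos by simp
    thus ?thesis using r by simp
  qed
  have "ret z = ret w"
  proof (rule ccontr)
    assume "ret z \<noteq> ret w"
    then obtain g where g: "arc g" "path_image g \<subseteq> S" "pathstart g = ret z" "pathfinish g = ret w"
      using \<open>path_connected S\<close> unfolding path_connected_arcwise S_def by blast
    have gcont: "continuous_on {0..1} g" and ginj: "inj_on g {0..1}"
      using g(1) by (auto simp: arc_def path_def)
    have "uniformly_continuous_on {0..1} g" using gcont by (intro compact_uniformly_continuous) auto
    then obtain \<eta> where \<eta>: "0 < \<eta>"
      "\<And>s t. s \<in> {0..1} \<Longrightarrow> t \<in> {0..1} \<Longrightarrow> \<bar>t - s\<bar> < \<eta> \<Longrightarrow> norm (g t - g s) < d"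
      using d(1) unfolding uniformly_continuous_on_def dist_norm real_norm_def by metis
    have gS: "g s \<in> S" if "s \<in> {0..1}" for s using g(2) that by (auto simp: path_image_def)
    have "area (g 0) \<noteq> area (g 1)"
    proof (rule locally_injective_interval[of "\<lambda>s. area (g s)", OF _ \<eta>(1)])
      show "continuous_on {0..1} (\<lambda>s. area (g s))"
        by (rule continuous_on_compose2[OF area_continuous gcont subset_refl])
      fix s t :: real assume st: "s \<in> {0..1}" "t \<in> {0..1}" "\<bar>s - t\<bar> < \<eta>" "area (g s) = area (g t)"
      have "g s = g t" using \<eta>(2)[OF st(2,1,3)] st by (intro inj_S gS) auto
      thus "s = t" using inj_onD[OF ginj] st by blast
    qed
    moreover have "area (g 0) = area z" "area (g 1) = area w"
      using g(3,4) area_ret by (auto simp: pathstart_def pathfinish_def)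
    ultimately show False using ar by simp
  qed
  thus "z = w" unfolding ret_def ph by (metis flow_inverse(2))
qed

text \<open>The range is open by invariance of domain. By equivariance it is the image of the unit
  square plus the lattice, a compact set plus a closed one, hence closed.\<close>

lemma straighten_surj: "surj straighten"
proof -
  have open_range: "open (range straighten)"
    by (rule invariance_of_domain[OF straighten_continuous open_UNIV straighten_inj])
  have "closed int_vecs" unfolding closed_sequential_limits using int_vecs_limit by blast
  moreover have "compact (straighten ` cbox (0, 0) (1, 1))"
    by (intro compact_continuous_image straighten_continuous compact_cbox)
  ultimately have "closed (\<Union>a\<in>straighten ` cbox (0, 0) (1, 1). \<Union>l\<in>int_vecs. {a + l})"
    by (intro compact_closed_sums)
  also have "(\<Union>a\<in>straighten ` cbox (0, 0) (1, 1). \<Union>l\<in>int_vecs. {a + l}) = range straighten"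
  proof (intro equalityI subsetI)
    fix y assume "y \<in> (\<Union>a\<in>straighten ` cbox (0, 0) (1, 1). \<Union>l\<in>int_vecs. {a + l})"
    then obtain x l where xl: "l \<in> int_vecs" "y = straighten x + l" by blast
    obtain \<kappa> where "\<kappa> \<in> int_vecs" "(X \<kappa>, Y \<kappa>) = l" using XY_surj[OF xl(1)] .
    hence "y = straighten (x + \<kappa>)" using xl by (simp add: straighten_translate)
    thus "y \<in> range straighten" by blast
  next
    fix y assume "y \<in> range straighten"
    then obtain x where x: "y = straighten x" by blast
    obtain \<kappa> where \<kappa>: "\<kappa> \<in> int_vecs" "x - \<kappa> \<in> cbox (0, 0) (1, 1)" by (rule int_vecs_translate_into_square)
    have "y = straighten (x - \<kappa>) + (X \<kappa>, Y \<kappa>)" using straighten_translate[OF \<kappa>(1), of "x - \<kappa>"] x by simp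
    thus "y \<in> (\<Union>a\<in>straighten ` cbox (0, 0) (1, 1). \<Union>l\<in>int_vecs. {a + l})" using \<kappa> XY_int by blast
  qed
  finally have "closed (range straighten)" .
  thus ?thesis using open_range clopen[of "range straighten"] by auto
qed

end

section \<open>The flow on the torus\<close>

lemma torus_proj_cong: "x - y \<in> int_vecs \<Longrightarrow> torus_proj x = torus_proj y"
  using torus_proj_add_int_vec[of "x - y" y] by simp

lemma continuous_on_torus_lift:
  assumes F: "continuous_on UNIV F" and h: "\<And>x. h (torus_proj x) = torus_proj (F x)"
  shows "continuous_on torus h" unfolding continuous_on_iff
proof (intro ballI allI impI)
  fix a and e :: real assume "a \<in> torus" "0 < e"
  then obtain x where a: "a = torus_proj x" by (auto simp: torus_def)
  have "isCont F x" using F by (metis UNIV_I continuous_on_eq_continuous_at open_UNIV)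
  moreover have "0 < e / (4 * pi)" using \<open>0 < e\<close> by simp
  ultimately obtain d1 where d1: "d1 > 0" "\<And>y. dist y x < d1 \<Longrightarrow> dist (F y) (F x) < e / (4 * pi)"
    unfolding continuous_at_eps_delta by blast
  obtain d where d: "d > 0" "\<And>x y. dist (torus_proj x) (torus_proj y) < d \<Longrightarrow> \<exists>k\<in>int_vecs. norm (x - y - k) < d1"
    using torus_proj_close_imp_close[OF d1(1)] by blast
  have "dist (h b) (h a) < e" if b: "b \<in> torus" "dist b a < d" for b
  proof -
    obtain y where y: "b = torus_proj y" using b(1) by (auto simp: torus_def)
    obtain k where k: "k \<in> int_vecs" "norm (y - x - k) < d1" using d(2)[of y x] b(2) a y by blast
    have "y - (y - k) \<in> int_vecs" using k(1) by simp
    hence "b = torus_proj (y - k)" unfolding y by (rule torus_proj_cong)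
    moreover have "dist (y - k) x < d1" using k(2) by (simp add: dist_norm algebra_simps)
    ultimately have "dist (h b) (h a) \<le> 4 * pi * norm (F (y - k) - F x)" "norm (F (y - k) - F x) < e / (4 * pi)"
      using torus_proj_dist_le d1(2) by (auto simp: a h dist_norm)
    thus ?thesis by (simp add: pos_less_divide_eq mult.commute)
  qed
  thus "\<exists>d>0. \<forall>b\<in>torus. dist b a < d \<longrightarrow> dist (h b) (h a) < e" using d(1) by blast
qed

lemma torus_proj_add: "torus_proj (x + c) = torus_translate c (torus_proj x)"
  by (simp add: torus_proj_def torus_translate_def cis_mult ring_distribs add.commute)

lemma dist_torus_translate: "dist (torus_translate c a) (torus_translate c b) = dist a b"
proof -
  have "dist (torus_translate c a) (torus_translate c b)
      = sqrt ((cmod (fst (torus_proj c) * (fst a - fst b)))\<^sup>2 + (cmod (snd (torus_proj c) * (snd a - snd b)))\<^sup>2)"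
    by (simp add: torus_translate_def dist_prod_def dist_norm right_diff_distrib)
  also have "\<dots> = dist a b" by (simp add: norm_mult torus_proj_def dist_prod_def dist_norm)
  finally show ?thesis .
qed

lemma primitive_decomposition:
  fixes a b :: int
  obtains k \<mu> \<nu> \<alpha> \<beta> where "a = k * \<mu>" "b = k * \<nu>" "\<alpha> * \<mu> + \<beta> * \<nu> = 1"
proof (cases "a = 0 \<and> b = 0")
  case True
  \<comment> \<open>The zero vector is \<open>0\<close> times the primitive vector
    \<open>(1, 0)\<close>.\<close>
  thus ?thesis using that[of 0 1 0 1 0] by simp
next
  case False
  define g where "g = gcd a b"
  have "g \<noteq> 0" using False by (simp add: g_def)
  obtain \<alpha> \<beta> where "\<alpha> * a + \<beta> * b = g" using bezout_int unfolding g_def by blast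
  moreover have ab: "a = g * (a div g)" "b = g * (b div g)" by (simp_all add: g_def)
  ultimately have "g * (\<alpha> * (a div g) + \<beta> * (b div g)) = g * 1"
    by (metis distrib_left mult.left_commute mult.right_neutral)
  hence "\<alpha> * (a div g) + \<beta> * (b div g) = 1" using \<open>g \<noteq> 0\<close> by simp
  thus ?thesis using that ab by blast
qed

context closed_flow begin

text \<open>The chosen representative is immaterial because \<open>straighten\<close> carries
  integer translations to integer translations. Injectivity downstairs needs every integer vector to
  arise in this way, which is \<open>XY_surj\<close>.\<close>

lemma straighten_torus:
  obtains h g where "homeomorphism torus torus h g" "\<And>x. h (torus_proj x) = torus_proj (straighten x)"
proof -
  define h where "h a = torus_proj (straighten (SOME x. torus_proj x = a))" for a
  have h: "h (torus_proj x) = torus_proj (straighten x)" for x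
  proof -
    define y where "y = (SOME y. torus_proj y = torus_proj x)"
    have "torus_proj y = torus_proj x" unfolding y_def by (rule someI[of _ x]) simp
    hence k: "y - x \<in> int_vecs" by (rule torus_proj_eqD)
    have "straighten y - straighten x \<in> int_vecs" using straighten_translate[OF k, of x] XY_int[OF k] by simp
    thus ?thesis unfolding h_def y_def[symmetric] by (rule torus_proj_cong)
  qed
  have "continuous_on torus h" by (rule continuous_on_torus_lift[OF straighten_continuous h])
  moreover have "h ` torus = torus"
  proof -
    have "h ` torus = torus_proj ` range straighten" by (auto simp: torus_def h image_image)
    thus ?thesis by (simp add: straighten_surj torus_def)
  qed
  moreover have "inj_on h torus"
  proof (rule inj_onI)
    fix a b assume "a \<in> torus" "b \<in> torus" "h a = h b"
    then obtain x y where xy: "a = torus_proj x" "b = torus_proj y" "torus_proj (straighten x) = torus_proj (straighten y)"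
      by (auto simp: torus_def h)
    then obtain l where l: "l \<in> int_vecs" "(X l, Y l) = straighten x - straighten y"
      using XY_surj torus_proj_eqD by metis
    hence "straighten (y + l) = straighten x" by (simp add: straighten_translate)
    hence "x = y + l" using straighten_inj by (metis injD)
    thus "a = b" using xy l(1) by (simp add: torus_proj_add_int_vec)
  qed
  ultimately obtain g where "homeomorphism torus torus h g" using homeomorphism_compact[OF compact_torus] by blast
  thus ?thesis using that h by blast
qed

end

section \<open>Entropy of the flow on the torus\<close>

locale torus_flow = periodic_flow +
  fixes \<phi> :: "real \<Rightarrow> complex \<times> complex \<Rightarrow> complex \<times> complex"
  assumes lift: "\<phi> t (torus_proj x) = torus_proj (\<Phi> t x)"
begin

lemma torus_invariant: "a \<in> torus \<Longrightarrow> \<phi> s a \<in> torus"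
  by (auto simp: torus_def lift)

lemma flow_dist_le:
  assumes "0 \<le> t" "\<And>s. s \<in> {0..t} \<Longrightarrow> dist (\<phi> s a) (\<phi> s b) \<le> e"
  shows "flow_dist \<phi> t a b \<le> e" unfolding flow_dist_def using assms by (intro cSUP_least) auto

sublocale linear_growth_flow \<phi> torus
proof
  show "bounded torus" using compact_torus by (rule compact_imp_bounded)
  show "torus \<noteq> {}" by (simp add: torus_def)
  show "\<phi> s a \<in> torus" if "a \<in> torus" for s a using that by (rule torus_invariant)
  fix e :: real assume e: "0 < e"
  \<comment> \<open>The projection is Lipschitz with constant \<open>4 * pi\<close>, so this leaves
    \<open>e / 2\<close>, strictly below the radius \<open>e\<close>.\<close>
  hence "0 < e / (8 * pi)" by simp
  from linear_plane_cover[OF this] obtain K where K: "\<And>t. 1 \<le> t \<Longrightarrow> \<exists>S. finite S \<and> real (card S) \<le> K * t \<and>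
     (\<forall>x. \<exists>y\<in>S. \<exists>k\<in>int_vecs. \<forall>s\<in>{0..t}. norm (\<Phi> s x - \<Phi> s y - k) \<le> e / (8 * pi))" by blast
  have "\<exists>C. flow_covering \<phi> torus t e C \<and> real (card C) \<le> K * t" if t: "1 \<le> t" for t
  proof -
    obtain S where S: "finite S" "real (card S) \<le> K * t"
      "\<And>x. \<exists>y\<in>S. \<exists>k\<in>int_vecs. \<forall>s\<in>{0..t}. norm (\<Phi> s x - \<Phi> s y - k) \<le> e / (8 * pi)" using K[OF t] by blast
    have "flow_covering \<phi> torus t e (torus_proj ` S)" unfolding flow_covering_def
    proof (intro conjI ballI)
      show "finite (torus_proj ` S)" "torus_proj ` S \<subseteq> torus" using S(1) by (auto simp: torus_def)
      fix b assume "b \<in> torus"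
      then obtain x where b: "b = torus_proj x" by (auto simp: torus_def)
      obtain y k where y: "y \<in> S" "k \<in> int_vecs"
        "\<And>s. s \<in> {0..t} \<Longrightarrow> norm (\<Phi> s x - \<Phi> s y - k) \<le> e / (8 * pi)" using S(3) by blast
      have "flow_dist \<phi> t (torus_proj y) b \<le> e / 2"
      proof (rule flow_dist_le)
        fix s assume s: "s \<in> {0..t}"
        have "dist (\<phi> s (torus_proj y)) (\<phi> s b) = dist (torus_proj (\<Phi> s x)) (torus_proj (\<Phi> s y + k))"
          using y(2) by (simp add: b lift torus_proj_add_int_vec dist_commute)
        also have "\<dots> \<le> 4 * pi * norm (\<Phi> s x - (\<Phi> s y + k))" by (rule torus_proj_dist_le)
        also have "\<dots> \<le> 4 * pi * (e / (8 * pi))" using y(3)[OF s] by (intro mult_left_mono) (auto simp: algebra_simps)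
        finally show "dist (\<phi> s (torus_proj y)) (\<phi> s b) \<le> e / 2" by simp
      qed (use t in auto)
      hence "flow_dist \<phi> t (torus_proj y) b < e" using e by simp
      thus "\<exists>a\<in>torus_proj ` S. flow_dist \<phi> t a b < e" using y(1) by blast
    qed
    moreover have "real (card (torus_proj ` S)) \<le> K * t" using card_image_le[OF S(1), of torus_proj] S(2) by simp
    ultimately show ?thesis by blast
  qed
  thus "\<exists>K. \<forall>t\<ge>1. \<exists>C. flow_covering \<phi> torus t e C \<and> real (card C) \<le> K * t" by blast
qed

lemma linear_growth_imp_hpol_ge_1:
  assumes linear_growth
  shows "1 \<le> hpol_flow \<phi> torus"
proof -
  obtain e c a where e: "0 < e" "0 < c"
    and S: "\<And>t. a \<le> t \<Longrightarrow> \<exists>S. finite S \<and> c * t \<le> real (card S) \<and> pairwise (separated e t) S"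
    using assms unfolding linear_growth_def by blast
  obtain d where d: "d > 0" "\<And>x y. dist (torus_proj x) (torus_proj y) < d \<Longrightarrow> \<exists>k\<in>int_vecs. norm (x - y - k) < e"
    using torus_proj_close_imp_close[OF e(1)] by blast
  show ?thesis
  proof (rule hpol_flow_ge_1[OF d(1) e(2)])
    fix t assume "a \<le> t"
    from S[OF this] obtain S where S: "finite S" "c * t \<le> real (card S)" "pairwise (separated e t) S" by blast
    have sep: "\<exists>s\<in>{0..t}. d \<le> dist (\<phi> s (torus_proj x)) (\<phi> s (torus_proj y))"
      if xy: "x \<in> S" "y \<in> S" "x \<noteq> y" for x y
    proof -
      obtain s where s: "s \<in> {0..t}" "\<forall>k\<in>int_vecs. e \<le> norm (\<Phi> s x - \<Phi> s y - k)"
        using pairwiseD[OF S(3) xy] unfolding separated_def by blast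
      have "d \<le> dist (\<phi> s (torus_proj x)) (\<phi> s (torus_proj y))"
        unfolding lift using d(2)[of "\<Phi> s x" "\<Phi> s y"] s(2) by (meson not_le)
      thus ?thesis using s(1) by blast
    qed
    have inj: "inj_on torus_proj S"
    proof (rule inj_onI, rule ccontr)
      fix x y assume "x \<in> S" "y \<in> S" "torus_proj x = torus_proj y" "x \<noteq> y"
      thus False using sep[of x y] d(1) by auto
    qed
    show "\<exists>S. finite S \<and> S \<subseteq> torus \<and> c * t \<le> real (card S) \<and> (\<forall>x\<in>S. \<forall>y\<in>S. x \<noteq> y \<longrightarrow> d \<le> flow_dist \<phi> t x y)"
    proof (intro exI[of _ "torus_proj ` S"] conjI ballI impI)
      show "finite (torus_proj ` S)" "torus_proj ` S \<subseteq> torus" using S(1) by (auto simp: torus_def)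
      show "c * t \<le> real (card (torus_proj ` S))" using S(2) by (simp add: card_image[OF inj])
      fix a b assume "a \<in> torus_proj ` S" "b \<in> torus_proj ` S" "a \<noteq> b"
      then obtain x y where xy: "x \<in> S" "y \<in> S" "a = torus_proj x" "b = torus_proj y" "x \<noteq> y" by blast
      then obtain s where "s \<in> {0..t}" "d \<le> dist (\<phi> s a) (\<phi> s b)" using sep by blast
      moreover have "a \<in> torus" "b \<in> torus" using xy by (auto simp: torus_def)
      ultimately show "d \<le> flow_dist \<phi> t a b" using dist_le_flow_dist by (meson order_trans)
    qed
  qed
qed

text \<open>In straightened coordinates the flow is a uniform horizontal translation, and unit time
  advances the phase by \<open>k / T\<close>; hence the rotation vector
  \<open>(of_int k / T, 0)\<close>.\<close>

lemma slow_imp_conjugate: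
  assumes slow: "hpol_flow \<phi> torus < 1" and per: "a \<in> torus" "0 < T" "\<phi> T a = a"
  shows "\<exists>h g c. homeomorphism torus torus h g \<and> (\<forall>z\<in>torus. h (\<phi> 1 z) = torus_translate c (h z))"
proof -
  have lg: "\<not> linear_growth" using linear_growth_imp_hpol_ge_1 slow by auto
  obtain p where p: "a = torus_proj p" using per(1) by (auto simp: torus_def)
  define v where "v = \<Phi> T p - p"
  have v: "v \<in> int_vecs" using per(3) unfolding v_def p lift by (rule torus_proj_eqD)
  have closed: "\<Phi> T x = x + v" for x
    by (rule all_orbits_same_period[OF lg v per(2), of p]) (simp add: v_def)
  obtain i j :: int where ij: "v = (of_int i, of_int j)" using v by (rule int_vecsE)
  obtain k \<mu> \<nu> \<alpha> \<beta> where dec: "i = k * \<mu>" "j = k * \<nu>" "\<alpha> * \<mu> + \<beta> * \<nu> = 1" by (rule primitive_decomposition)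
  interpret closed_flow V \<Phi> L M m T \<alpha> \<beta> \<mu> \<nu> k by unfold_locales (use per(2) dec closed ij in auto)
  obtain h g where hg: "homeomorphism torus torus h g" "\<And>x. h (torus_proj x) = torus_proj (straighten x)"
    using straighten_torus by blast
  have "h (\<phi> 1 z) = torus_translate (of_int k / T, 0) (h z)" if z: "z \<in> torus" for z
  proof -
    obtain x where "z = torus_proj x" using z by (auto simp: torus_def)
    thus ?thesis by (simp add: lift hg(2) straighten_flow torus_proj_add)
  qed
  thus ?thesis using hg(1) by blast
qed

lemma flow_uniformly_continuous:
  assumes "0 < e"
  obtains d where "0 < d"
    "\<And>a b s. a \<in> torus \<Longrightarrow> b \<in> torus \<Longrightarrow> dist a b < d \<Longrightarrow> s \<in> {0..1} \<Longrightarrow> dist (\<phi> s a) (\<phi> s b) \<le> e"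
proof -
  define e' where "e' = e / (4 * pi * exp L)"
  have e': "0 < e'" using assms by (simp add: e'_def)
  obtain d where d: "d > 0" "\<And>x y. dist (torus_proj x) (torus_proj y) < d \<Longrightarrow> \<exists>k\<in>int_vecs. norm (x - y - k) < e'"
    using torus_proj_close_imp_close[OF e'] by blast
  show ?thesis
  proof (rule that[OF d(1)])
    fix a b and s :: real assume ab: "a \<in> torus" "b \<in> torus" "dist a b < d" and s: "s \<in> {0..1}"
    then obtain x y where xy: "a = torus_proj x" "b = torus_proj y" by (auto simp: torus_def)
    then obtain k where k: "k \<in> int_vecs" "norm (x - y - k) < e'" using d(2) ab(3) by blast
    have "dist (\<phi> s a) (\<phi> s b) = dist (torus_proj (\<Phi> s x)) (torus_proj (\<Phi> s (y + k)))"
      using k(1) by (simp add: xy lift flow_translate torus_proj_add_int_vec)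
    also have "\<dots> \<le> 4 * pi * norm (\<Phi> s x - \<Phi> s (y + k))" by (rule torus_proj_dist_le)
    also have "\<dots> \<le> 4 * pi * (exp (L * 1) * norm (x - (y + k)))"
      using s by (intro mult_left_mono flow_lipschitz_le) auto
    also have "\<dots> \<le> 4 * pi * (exp (L * 1) * e')" using k(2) by (intro mult_left_mono) (auto simp: algebra_simps)
    also have "\<dots> = e" by (simp add: e'_def)
    finally show "dist (\<phi> s a) (\<phi> s b) \<le> e" .
  qed
qed

text \<open>Translations are isometries, so the distance of images under \<open>h\<close> is
  constant along integer times, and uniform continuity of \<open>h\<close> and \<open>g\<close>
  makes all powers of the time-one map equicontinuous. The fractional part of the time is absorbed
  by uniform continuity over \<open>{0..1}\<close>, so the same finite set covers for every
  \<open>t\<close>.\<close>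

lemma conjugate_imp_hpol_0:
  assumes hg: "homeomorphism torus torus h g" and conj: "\<And>z. z \<in> torus \<Longrightarrow> h (\<phi> 1 z) = torus_translate c (h z)"
  shows "hpol_flow \<phi> torus = 0"
proof (rule antisym[OF hpol_flow_le[of 0, folded zero_ereal_def] hpol_flow_nonneg])
  fix e :: real assume e: "0 < e"
  obtain d1 where d1: "0 < d1"
    "\<And>a b s. a \<in> torus \<Longrightarrow> b \<in> torus \<Longrightarrow> dist a b < d1 \<Longrightarrow> s \<in> {0..1} \<Longrightarrow> dist (\<phi> s a) (\<phi> s b) \<le> e / 2"
    using flow_uniformly_continuous[of "e / 2"] e by auto
  have cont: "uniformly_continuous_on torus h" "uniformly_continuous_on torus g"
    using hg compact_torus by (auto intro!: compact_uniformly_continuous simp: homeomorphism_def)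
  obtain d2 where d2: "0 < d2" "\<And>a b. a \<in> torus \<Longrightarrow> b \<in> torus \<Longrightarrow> dist a b < d2 \<Longrightarrow> dist (g a) (g b) < d1"
    using cont(2) d1(1) unfolding uniformly_continuous_on_def by metis
  obtain d3 where d3: "0 < d3" "\<And>a b. a \<in> torus \<Longrightarrow> b \<in> torus \<Longrightarrow> dist a b < d3 \<Longrightarrow> dist (h a) (h b) < d2"
    using cont(1) d2(1) unfolding uniformly_continuous_on_def by metis
  have h_torus: "h a \<in> torus" and gh: "g (h a) = a" if "a \<in> torus" for a
    using hg that by (auto simp: homeomorphism_def)
  have \<phi>_add: "\<phi> (s + t) a = \<phi> s (\<phi> t a)" if "a \<in> torus" for s t a
    using that by (auto simp: torus_def lift flow_add)
  have iso: "dist (h (\<phi> (real n) a)) (h (\<phi> (real n) b)) = dist (h a) (h b)" if ab: "a \<in> torus" "b \<in> torus" for n a b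
  proof (induction n)
    case 0
    show ?case using ab by (auto simp: torus_def lift)
  next
    case (Suc n)
    have "h (\<phi> (real (Suc n)) x) = torus_translate c (h (\<phi> (real n) x))" if "x \<in> torus" for x
      using conj[OF torus_invariant[OF that]] \<phi>_add[OF that, of 1 "real n"] by simp
    thus ?case using Suc ab by (simp add: dist_torus_translate del: of_nat_Suc)
  qed
  have close: "dist (\<phi> s a) (\<phi> s b) \<le> e / 2" if ab: "a \<in> torus" "b \<in> torus" "dist a b < d3" and s: "0 \<le> s" for a b s
  proof -
    define n where "n = nat \<lfloor>s\<rfloor>"
    have n: "s - real n \<in> {0..1}" using s by (auto simp: n_def) linarith
    have tn: "\<phi> (real n) a \<in> torus" "\<phi> (real n) b \<in> torus" using ab torus_invariant by auto
    have "dist (h (\<phi> (real n) a)) (h (\<phi> (real n) b)) < d2" using iso[OF ab(1,2)] d3(2)[OF ab] by simp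
    hence "dist (\<phi> (real n) a) (\<phi> (real n) b) < d1"
      using d2(2)[OF h_torus[OF tn(1)] h_torus[OF tn(2)]] gh tn by simp
    hence "dist (\<phi> (s - real n) (\<phi> (real n) a)) (\<phi> (s - real n) (\<phi> (real n) b)) \<le> e / 2"
      using d1(2) tn n by blast
    thus ?thesis using \<phi>_add[OF ab(1), of "s - real n" "real n"] \<phi>_add[OF ab(2), of "s - real n" "real n"] by simp
  qed
  obtain C where C: "finite C" "C \<subseteq> torus" "torus \<subseteq> (\<Union>a\<in>C. ball a d3)"
    using seq_compact_imp_totally_bounded[of torus] compact_imp_seq_compact[OF compact_torus] d3(1) by metis
  have "flow_covering \<phi> torus t e C" if t: "1 \<le> t" for t unfolding flow_covering_def
  proof (intro conjI ballI C)
    fix b assume b: "b \<in> torus"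
    then obtain a where a: "a \<in> C" "dist a b < d3" using C(3) by auto
    have "flow_dist \<phi> t a b \<le> e / 2" using a b C(2) t by (intro flow_dist_le close) auto
    thus "\<exists>a\<in>C. flow_dist \<phi> t a b < e" using a(1) e by (intro bexI[of _ a]) auto
  qed
  thus "\<exists>K. \<forall>t\<ge>1. \<exists>C. flow_covering \<phi> torus t e C \<and> real (card C) \<le> K * t powr 0"
    by (intro exI[of _ "real (card C)"]) auto
qed

end

text \<open>The derivative is periodic along with \<open>V\<close>, by uniqueness of derivatives, so
  compactness of the unit square bounds it and bounds the speed from both sides; the mean value
  inequality then gives the Lipschitz constant.\<close>

lemma periodic_flow_of_C1:
  fixes V :: "real \<times> real \<Rightarrow> real \<times> real"
    and V' :: "real \<times> real \<Rightarrow> (real \<times> real) \<Rightarrow>\<^sub>L (real \<times> real)"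
  assumes C1: "\<And>x. (V has_derivative blinfun_apply (V' x)) (at x)"
    and C1_cont: "continuous_on UNIV V'"
    and periodic: "\<And>x (m::int) (n::int). V (x + (of_int m, of_int n)) = V x"
    and nonvanishing: "\<And>x. V x \<noteq> 0"
    and flow_init: "\<And>x. \<Phi> 0 x = x"
    and flow_ode: "\<And>x t. ((\<lambda>s. \<Phi> s x) has_vector_derivative V (\<Phi> t x)) (at t)"
  obtains L M m where "periodic_flow V \<Phi> L M m"
proof -
  let ?Q = "cbox (0, 0) (1, 1) :: (real \<times> real) set"
  have per: "V (x + k) = V x" if "k \<in> int_vecs" for x k using that periodic by (elim int_vecsE) simp
  have per': "V' (x + k) = V' x" if k: "k \<in> int_vecs" for x k
  proof -
    have "((\<lambda>y. y + k) has_derivative (\<lambda>h. h)) (at x)" by (auto intro!: derivative_eq_intros)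
    from has_derivative_compose[OF this C1] have "((\<lambda>y. V (y + k)) has_derivative blinfun_apply (V' (x + k))) (at x)" .
    hence "(V has_derivative blinfun_apply (V' (x + k))) (at x)" by (simp add: per[OF k])
    hence "blinfun_apply (V' (x + k)) = blinfun_apply (V' x)" using C1 has_derivative_unique by blast
    thus ?thesis by (simp add: blinfun_apply_inject)
  qed
  have reduce: "\<exists>y\<in>?Q. V x = V y \<and> V' x = V' y" for x
  proof -
    obtain k where k: "k \<in> int_vecs" "x - k \<in> ?Q" by (rule int_vecs_translate_into_square)
    thus ?thesis using per[OF k(1), of "x - k"] per'[OF k(1), of "x - k"] by (intro bexI[of _ "x - k"]) auto
  qed
  have V_cont: "continuous_on S V" for S
    using C1 has_derivative_continuous by (meson continuous_at_imp_continuous_on)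
  have "bounded (V' ` ?Q)"
    using C1_cont by (intro compact_imp_bounded compact_continuous_image compact_cbox) (rule continuous_on_subset, auto)
  then obtain B where B: "\<And>y. y \<in> ?Q \<Longrightarrow> norm (V' y) \<le> B" by (auto simp: bounded_iff)
  define L where "L = \<bar>B\<bar> + 1"
  have V'_le: "norm (V' x) \<le> L" for x using reduce[of x] B by (force simp: L_def)
  have ne: "?Q \<noteq> {}" by (auto simp: cbox_Pair_eq)
  have nc: "continuous_on ?Q (\<lambda>x. norm (V x))" by (intro continuous_on_norm V_cont)
  obtain a where a: "\<And>y. y \<in> ?Q \<Longrightarrow> norm (V y) \<le> norm (V a)"
    using continuous_attains_sup[OF compact_cbox ne nc] by blast
  obtain b where b: "\<And>y. y \<in> ?Q \<Longrightarrow> norm (V b) \<le> norm (V y)"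
    using continuous_attains_inf[OF compact_cbox ne nc] by blast
  have "periodic_flow V \<Phi> L (norm (V a)) (norm (V b))"
  proof
    show "norm (V x - V y) \<le> L * norm (x - y)" for x y
    proof (rule differentiable_bound[of UNIV V "\<lambda>x. blinfun_apply (V' x)"])
      show "onorm (blinfun_apply (V' x)) \<le> L" for x using V'_le[of x] by (simp add: norm_blinfun.rep_eq)
    qed (use C1 in auto)
    show "norm (V x) \<le> norm (V a)" for x using reduce[of x] a by force
    show "norm (V b) \<le> norm (V x)" for x using reduce[of x] b by force
    show "0 < norm (V b)" using nonvanishing by simp
    show "0 < L" by (simp add: L_def)
  qed (use per flow_init flow_ode in auto)
  thus ?thesis by (rule that)
qed

theorem theorem2:
  fixes V :: "real \<times> real \<Rightarrow> real \<times> real"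
    and V' :: "real \<times> real \<Rightarrow> (real \<times> real) \<Rightarrow>\<^sub>L (real \<times> real)"
    and \<Phi> :: "real \<Rightarrow> real \<times> real \<Rightarrow> real \<times> real"
    and \<phi> :: "real \<Rightarrow> complex \<times> complex \<Rightarrow> complex \<times> complex"
  assumes C1: "\<And>x. (V has_derivative blinfun_apply (V' x)) (at x)"
      and C1_cont: "continuous_on UNIV V'"
      and periodic: "\<And>x (m::int) (n::int). V (x + (of_int m, of_int n)) = V x"
      and nonvanishing: "\<And>x. V x \<noteq> 0"
      and flow_init: "\<And>x. \<Phi> 0 x = x"
      and flow_ode: "\<And>x t. ((\<lambda>s. \<Phi> s x) has_vector_derivative V (\<Phi> t x)) (at t)"
      and torus_flow: "\<And>t x. \<phi> t (torus_proj x) = torus_proj (\<Phi> t x)"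
  shows "hpol_flow \<phi> torus \<in> {0..1} \<and>
         ((\<exists>z\<in>torus. \<exists>T>0. \<phi> T z = z) \<longrightarrow>
            (hpol_flow \<phi> torus \<in> {0, 1} \<and>
             (hpol_flow \<phi> torus = 0 \<longleftrightarrow>
               (\<exists>h g c. homeomorphism torus torus h g \<and>
                   (\<forall>z\<in>torus. h (\<phi> 1 z) = torus_translate c (h z))))))"
proof -
  obtain L M m where "periodic_flow V \<Phi> L M m"
    using periodic_flow_of_C1[OF C1 C1_cont periodic nonvanishing flow_init flow_ode] by blast
  then interpret torus_flow V \<Phi> L M m \<phi> by (intro torus_flow.intro torus_flow_axioms.intro torus_flow)
  let ?conj = "\<exists>h g c. homeomorphism torus torus h g \<and> (\<forall>z\<in>torus. h (\<phi> 1 z) = torus_translate c (h z))"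
  have conj: "?conj \<Longrightarrow> hpol_flow \<phi> torus = 0" using conjugate_imp_hpol_0 by blast
  have slow: "hpol_flow \<phi> torus = 1 \<or> ?conj" if "\<exists>z\<in>torus. \<exists>T>0. \<phi> T z = z"
    using that slow_imp_conjugate hpol_flow_le_1 by (metis order_le_less)
  show ?thesis
  proof (intro conjI impI)
    show "hpol_flow \<phi> torus \<in> {0..1}" using hpol_flow_nonneg hpol_flow_le_1 by simp
    assume per: "\<exists>z\<in>torus. \<exists>T>0. \<phi> T z = z"
    show "hpol_flow \<phi> torus \<in> {0, 1}" using slow[OF per] conj by blast
    show "hpol_flow \<phi> torus = 0 \<longleftrightarrow> ?conj"
    proof
      assume "hpol_flow \<phi> torus = 0"
      hence "hpol_flow \<phi> torus \<noteq> 1" by simp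
      with slow[OF per] show ?conj by blast
    qed (rule conj)
  qed
qed

end
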